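(* Let $I\subset\mathbb R$ be an open interval. Let $N_0:I\to\mathbb S^2$ and $\mathcal V:I\to\mathbb S^2$ be real analytic with $\langle\mathcal V(t),N_0(t)\rangle=0$ for all $t\in I$, and with $\langle\mathcal V(t)-N_0'(t),\mathcal V(t)\rangle\not\equiv0$ on $I$. Then there is a Lorentzian-harmonic map $N:I\times I\to\mathbb S^2$, unique up to an isometry of $\mathbb S^2$, with null coordinates $(x,y)$ on $I\times I$, satisfying the initial conditions $$N(t,t)=N_0(t),\qquad N_x(t,t)=\mathcal V(t).$$ The solution is produced by the generalized d'Alembert method with potential pair $(\hat\chi,\hat\psi)=(\hat\alpha_0(x),\hat\alpha_0(y))$, where $$\hat\alpha_0(t)=\big(c\,e_3+e_1\lambda+(-b\,e_1+a\,e_2)\lambda^{-1}\big)\,dt,$$ $$c=\varepsilon\,|\mathcal V'|,\qquad a=\langle N_0',N_0\times\mathcal V\rangle,\qquad b=\langle\mathcal V-N_0',\mathcal V\rangle,$$ and $\varepsilon=\operatorname{sign}\langle\mathcal V'\times N_0,\mathcal V\rangle$. Further: 1. The corresponding pseudospherical surface $f$ is a wave front at $(t,t)$ if and only if $(a(t),b(t))\neq(0,0)$. 2. The solution $N$ (and hence $f$) is regular at the point $(x,y)=(t,t)$ if and only if $a(t)\neq0$. 3. At a singular point $(t,t)$ on the initial curve, the singular set in $I\times I$ is locally regular if and only if $(b(t)c(t),a'(t))\neq(0,0)$.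
   Context: **Harmonic maps and pseudospherical surfaces.** A map $N:\Omega\to\mathbb S^2\subset\mathbb R^3$ on a domain with null coordinates $(x,y)$ is Lorentzian-harmonic if $N\times N_{xy}=0$. Its associated pseudospherical surface is $f:\Omega\to\mathbb R^3$ (unique up to translation) with $f_x=N\times N_x$, $f_y=-N\times N_y$. It is a wave front at a point if $(f,N)$ is an immersion there. The singular set, common to $f$ and $N$, is the zero set of $\det(N_x,N_y,N)$ and is called locally regular at a point if this function has non-zero differential there. Regular means immersive. **Loop group.** Identify $\mathbb R^3=\mathfrak{su}(2)$ with $\langle X,Y\rangle=-2\operatorname{trace}(XY)$ and orthonormal basis $e_1=\frac12\begin{pmatrix}0&i\\i&0\end{pmatrix}$, $e_2=\frac12\begin{pmatrix}0&-1\\1&0\end{pmatrix}$, $e_3=\frac12\begin{pmatrix}i&0\\0&-i\end{pmatrix}$. Let $\mathcal G$ be the group of smooth loops $\gamma:\mathbb S^1\to SL(2,\mathbb C)$ (extending holomorphically to an annulus around $\mathbb S^1$ in $\mathbb C^*$) with $\gamma(\lambda)=\mathrm{Ad}_P\gamma(-\lambda)$, $P=\mathrm{diag}(-1,1)$, and $\gamma(\lambda)=\big(\overline{\gamma(\bar\lambda)^t}\big)^{-1}$. Let $\mathcal G^{\pm}$ be the subgroup of loops of the form $\sum_{n\ge0}a_n\lambda^{\pm n}$, and $\mathcal G^\pm_*\subset\mathcal G^{\pm}$ those with $a_0=I$. The Birkhoff decomposition gives diffeomorphisms $\mathcal G\cong\mathcal G^{\pm}_*\times\mathcal G^{\mp}$.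 **Generalized d'Alembert method.** A potential pair consists of $\mathrm{Lie}(\mathcal G)$-valued 1-forms $\hat\chi=\sum_{n\le1}A_n(x)\lambda^n\,dx$ and $\hat\psi=\sum_{n\ge-1}B_n(y)\lambda^n\,dy$. Solve $\hat X^{-1}d\hat X=\hat\chi$, $\hat Y^{-1}d\hat Y=\hat\psi$ with $\hat X(x_0)=I=\hat Y(y_0)$ (here $x_0=y_0\in I$). Factor $\hat X(x)^{-1}\hat Y(y)=\hat H_-(x,y)\hat H_+(x,y)$ with $\hat H_-\in\mathcal G^-_*$, $\hat H_+\in\mathcal G^+$. Set $\hat F=\hat X\hat H_-$ and $F=\hat F|_{\lambda=1}$. The method produces $N=\mathrm{Ad}_Fe_3$ (Lorentzian-harmonic) and $f=\big(\lambda\,\partial_\lambda\hat F\,\hat F^{-1}\big)|_{\lambda=1}$ (its pseudospherical surface).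
   Formalization: In c = ε|V'|, V' is taken to be the covariant derivative of V along N_0 on the sphere (the tangential part of the Euclidean derivative); with the full Euclidean derivative the stated potential does not in general produce the solution. *)

theory Defs
  imports "HOL-Analysis.Analysis"
begin

section \<open>Real analytic and smooth maps\<close>

definition real_analytic_on :: "(real \<Rightarrow> 'b::real_normed_vector) \<Rightarrow> real set \<Rightarrow> bool" where
  "real_analytic_on f S \<longleftrightarrow>
     (\<forall>t\<in>S. \<exists>r>0. \<exists>coeff. \<forall>s. \<bar>s - t\<bar> < r \<longrightarrow> (\<lambda>n. (s - t) ^ n *\<^sub>R coeff n) sums f s)"

primrec Ck_on :: "nat \<Rightarrow> ('a::euclidean_space \<Rightarrow> 'b::real_normed_vector) \<Rightarrow> 'a set \<Rightarrow> bool" where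
  "Ck_on 0 f S \<longleftrightarrow> continuous_on S f"
| "Ck_on (Suc k) f S \<longleftrightarrow>
     (\<forall>p\<in>S. f differentiable (at p)) \<and> (\<forall>v. Ck_on k (\<lambda>p. frechet_derivative f (at p) v) S)"

text \<open>Only used for open sets.\<close>

definition smooth_on :: "('a::euclidean_space \<Rightarrow> 'b::real_normed_vector) \<Rightarrow> 'a set \<Rightarrow> bool" where
  "smooth_on f S \<longleftrightarrow> (\<forall>k. Ck_on k f S)"

definition immersion_at :: "('a::euclidean_space \<Rightarrow> 'b::real_normed_vector) \<Rightarrow> 'a \<Rightarrow> bool" where
  "immersion_at f p \<longleftrightarrow> f differentiable (at p) \<and> inj (frechet_derivative f (at p))"


section \<open>Lorentzian-harmonic maps and pseudospherical surfaces\<close>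

definition pdx :: "(real \<times> real \<Rightarrow> 'b::real_normed_vector) \<Rightarrow> real \<times> real \<Rightarrow> 'b" where
  "pdx g p = vector_derivative (\<lambda>s. g (s, snd p)) (at (fst p))"

definition pdy :: "(real \<times> real \<Rightarrow> 'b::real_normed_vector) \<Rightarrow> real \<times> real \<Rightarrow> 'b" where
  "pdy g p = vector_derivative (\<lambda>s. g (fst p, s)) (at (snd p))"

definition lorentzian_harmonic :: "(real \<times> real) set \<Rightarrow> (real \<times> real \<Rightarrow> real^3) \<Rightarrow> bool" where
  "lorentzian_harmonic \<Omega> N \<longleftrightarrow>
     smooth_on N \<Omega> \<and> N ` \<Omega> \<subseteq> sphere 0 1 \<and> (\<forall>p\<in>\<Omega>. cross3 (N p) (pdy (pdx N) p) = 0)"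

definition associated_surface ::
    "(real \<times> real) set \<Rightarrow> (real \<times> real \<Rightarrow> real^3) \<Rightarrow> (real \<times> real \<Rightarrow> real^3) \<Rightarrow> bool" where
  "associated_surface \<Omega> N f \<longleftrightarrow>
     smooth_on f \<Omega> \<and>
     (\<forall>p\<in>\<Omega>. pdx f p = cross3 (N p) (pdx N p) \<and> pdy f p = - cross3 (N p) (pdy N p))"

definition wave_front_at ::
    "(real \<times> real \<Rightarrow> real^3) \<Rightarrow> (real \<times> real \<Rightarrow> real^3) \<Rightarrow> real \<times> real \<Rightarrow> bool" where
  "wave_front_at f N p \<longleftrightarrow> immersion_at (\<lambda>q. (f q, N q)) p"

definition singular_function :: "(real \<times> real \<Rightarrow> real^3) \<Rightarrow> real \<times> real \<Rightarrow> real" where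
  "singular_function N p = det (vector [pdx N p, pdy N p, N p] :: real^3^3)"

definition singular_set :: "(real \<times> real) set \<Rightarrow> (real \<times> real \<Rightarrow> real^3) \<Rightarrow> (real \<times> real) set" where
  "singular_set \<Omega> N = {p \<in> \<Omega>. singular_function N p = 0}"

definition singular_set_locally_regular_at ::
    "(real \<times> real \<Rightarrow> real^3) \<Rightarrow> real \<times> real \<Rightarrow> bool" where
  "singular_set_locally_regular_at N p \<longleftrightarrow>
     singular_function N differentiable (at p) \<and>
     frechet_derivative (singular_function N) (at p) \<noteq> (\<lambda>v. 0)"


section \<open>The Lie algebra su(2)\<close>

type_synonym cmat2 = "complex^2^2"

definition cscale :: "complex \<Rightarrow> cmat2 \<Rightarrow> cmat2" (infixr "*\<^sub>C" 75) where
  "z *\<^sub>C A = (\<chi> i j. z * A $ i $ j)"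

definition conj_transpose :: "cmat2 \<Rightarrow> cmat2" where
  "conj_transpose A = (\<chi> i j. cnj (A $ j $ i))"

definition Ad :: "cmat2 \<Rightarrow> cmat2 \<Rightarrow> cmat2" where
  "Ad g A = g ** A ** matrix_inv g"

definition e1 :: cmat2 where
  "e1 = (1/2) *\<^sub>R vector [vector [0, \<i>], vector [\<i>, 0]]"

definition e2 :: cmat2 where
  "e2 = (1/2) *\<^sub>R vector [vector [0, -1], vector [1, 0]]"

definition e3 :: cmat2 where
  "e3 = (1/2) *\<^sub>R vector [vector [\<i>, 0], vector [0, -\<i>]]"

text \<open>
  The identification of Euclidean 3-space with su(2). It is isometric for the inner product
  \<open>-2 trace (X Y)\<close> on su(2), and the cross product becomes the commutator.
\<close>

definition su2 :: "real^3 \<Rightarrow> cmat2" where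
  "su2 v = (v $ 1) *\<^sub>R e1 + (v $ 2) *\<^sub>R e2 + (v $ 3) *\<^sub>R e3"


section \<open>The loop group\<close>

text \<open>
  A loop is represented by a function on the complex plane of which only the values on the unit
  circle matter.
\<close>

type_synonym loop = "complex \<Rightarrow> cmat2"

definition extends_to_annulus :: "loop \<Rightarrow> bool" where
  "extends_to_annulus \<gamma> \<longleftrightarrow>
     (\<exists>r R g. 0 < r \<and> r < 1 \<and> 1 < R \<and>
        (\<forall>i j. (\<lambda>z. g z $ i $ j) holomorphic_on {z. r < norm z \<and> norm z < R}) \<and>
        (\<forall>z\<in>sphere 0 1. g z = \<gamma> z))"

definition Pmat :: cmat2 where
  "Pmat = vector [vector [-1, 0], vector [0, 1]]"

definition loop_group :: "loop set" where
  "loop_group = {\<gamma>. extends_to_annulus \<gamma> \<and>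
     (\<forall>z\<in>sphere 0 1. det (\<gamma> z) = 1 \<and> \<gamma> z = Ad Pmat (\<gamma> (- z)) \<and>
        \<gamma> z = matrix_inv (conj_transpose (\<gamma> (cnj z))))}"

definition loop_algebra :: "loop set" where
  "loop_algebra = {\<xi>. extends_to_annulus \<xi> \<and>
     (\<forall>z\<in>sphere 0 1. trace (\<xi> z) = 0 \<and> \<xi> z = Ad Pmat (\<xi> (- z)) \<and>
        \<xi> z = - conj_transpose (\<xi> (cnj z)))}"

definition laurent_on_circle :: "int set \<Rightarrow> (int \<Rightarrow> cmat2) \<Rightarrow> loop \<Rightarrow> bool" where
  "laurent_on_circle S A \<gamma> \<longleftrightarrow>
     (\<forall>z\<in>sphere 0 1. ((\<lambda>n. (z powi n) *\<^sub>C A n) has_sum \<gamma> z) S)"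

definition loop_group_plus :: "loop set" where
  "loop_group_plus = {\<gamma> \<in> loop_group. \<exists>A. laurent_on_circle {0..} A \<gamma>}"

definition loop_group_minus_star :: "loop set" where
  "loop_group_minus_star =
     {\<gamma> \<in> loop_group. \<exists>A. A 0 = mat 1 \<and> laurent_on_circle {..0} A \<gamma>}"

text \<open>
  The derivative in the loop parameter is taken along the circle, where it agrees with the
  derivative of the holomorphic extension.
\<close>

definition loop_deriv :: "loop \<Rightarrow> complex \<Rightarrow> cmat2" where
  "loop_deriv \<gamma> z =
     (\<chi> i j. THE D. ((\<lambda>w. \<gamma> w $ i $ j) has_field_derivative D) (at z within sphere 0 1))"


section \<open>The generalized d'Alembert method\<close>

text \<open>A one-form \<open>\<omega>(t) dt\<close> on \<open>I\<close> is represented by its coefficient \<open>\<omega>\<close>.\<close>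

definition potential_form :: "real set \<Rightarrow> int set \<Rightarrow> (real \<Rightarrow> loop) \<Rightarrow> bool" where
  "potential_form I S \<omega> \<longleftrightarrow>
     (\<exists>A. (\<forall>n\<in>S. smooth_on (A n) I) \<and>
        (\<forall>t\<in>I. \<omega> t \<in> loop_algebra \<and> laurent_on_circle S (\<lambda>n. A n t) (\<omega> t)))"

definition potential_pair :: "real set \<Rightarrow> (real \<Rightarrow> loop) \<Rightarrow> (real \<Rightarrow> loop) \<Rightarrow> bool" where
  "potential_pair I \<eta> \<psi> \<longleftrightarrow> potential_form I {..1} \<eta> \<and> potential_form I {-1..} \<psi>"

definition integrates :: "real set \<Rightarrow> real \<Rightarrow> (real \<Rightarrow> loop) \<Rightarrow> (real \<Rightarrow> loop) \<Rightarrow> bool" where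
  "integrates I t0 \<omega> X \<longleftrightarrow>
     (\<forall>t\<in>I. X t \<in> loop_group) \<and>
     (\<forall>z\<in>sphere 0 1. X t0 z = mat 1 \<and>
        (\<forall>t\<in>I. ((\<lambda>s. X s z) has_vector_derivative X t z ** \<omega> t z) (at t)))"

text \<open>
  \<open>dAlembert I t0 \<eta> \<psi> N f\<close>: the method with potential pair \<open>(\<eta>, \<psi>)\<close> and base point \<open>(t0, t0)\<close>
  produces the harmonic map \<open>N\<close> and the surface \<open>f\<close> on \<open>I \<times> I\<close>.
\<close>

definition dAlembert ::
    "real set \<Rightarrow> real \<Rightarrow> (real \<Rightarrow> loop) \<Rightarrow> (real \<Rightarrow> loop) \<Rightarrow>
     (real \<times> real \<Rightarrow> real^3) \<Rightarrow> (real \<times> real \<Rightarrow> real^3) \<Rightarrow> bool" where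
  "dAlembert I t0 \<eta> \<psi> N f \<longleftrightarrow>
     potential_pair I \<eta> \<psi> \<and>
     (\<exists>X Y Hm Hp Fhat.
        integrates I t0 \<eta> X \<and> integrates I t0 \<psi> Y \<and>
        (\<forall>x\<in>I. \<forall>y\<in>I.
           Hm x y \<in> loop_group_minus_star \<and> Hp x y \<in> loop_group_plus \<and>
           (\<forall>z\<in>sphere 0 1. matrix_inv (X x z) ** Y y z = Hm x y z ** Hp x y z) \<and>
           (\<forall>z\<in>sphere 0 1. Fhat x y z = X x z ** Hm x y z) \<and>
           su2 (N (x, y)) = Ad (Fhat x y 1) e3 \<and>
           su2 (f (x, y)) = (1 *\<^sub>C loop_deriv (Fhat x y) 1) ** matrix_inv (Fhat x y 1)))"


section \<open>The Cauchy problem along the diagonal\<close>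

definition cauchy_solution ::
    "real set \<Rightarrow> (real \<Rightarrow> real^3) \<Rightarrow> (real \<Rightarrow> real^3) \<Rightarrow> (real \<times> real \<Rightarrow> real^3) \<Rightarrow> bool" where
  "cauchy_solution I N0 V N \<longleftrightarrow>
     lorentzian_harmonic (I \<times> I) N \<and> (\<forall>t\<in>I. N (t, t) = N0 t \<and> pdx N (t, t) = V t)"

abbreviation tderiv :: "(real \<Rightarrow> real^3) \<Rightarrow> real \<Rightarrow> real^3" where
  "tderiv g t \<equiv> vector_derivative g (at t)"

definition coef_a :: "(real \<Rightarrow> real^3) \<Rightarrow> (real \<Rightarrow> real^3) \<Rightarrow> real \<Rightarrow> real" where
  "coef_a N0 V t = inner (tderiv N0 t) (cross3 (N0 t) (V t))"

definition coef_b :: "(real \<Rightarrow> real^3) \<Rightarrow> (real \<Rightarrow> real^3) \<Rightarrow> real \<Rightarrow> real" where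
  "coef_b N0 V t = inner (V t - tderiv N0 t) (V t)"

text \<open>
  \<open>V\<close> is a vector field tangent to the sphere along the curve \<open>N0\<close>; in the length \<open>|V'|\<close> entering
  the coefficient \<open>c\<close>, the prime is the covariant derivative of the sphere, that is, the tangential
  part of the derivative in Euclidean space. (The normal part has length \<open>|1 - b|\<close>, and must
  not contribute: the moving frame gives \<open>c = \<langle>V', N0 \<times> V\<rangle>\<close>.) In the sign, the two derivatives
  can be used interchangeably. Note \<open>sgn 0 = 0\<close>.
\<close>

definition covariant_deriv :: "(real \<Rightarrow> real^3) \<Rightarrow> (real \<Rightarrow> real^3) \<Rightarrow> real \<Rightarrow> real^3" where
  "covariant_deriv N0 V t = tderiv V t - inner (tderiv V t) (N0 t) *\<^sub>R N0 t"

definition coef_c :: "(real \<Rightarrow> real^3) \<Rightarrow> (real \<Rightarrow> real^3) \<Rightarrow> real \<Rightarrow> real" where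
  "coef_c N0 V t =
     sgn (inner (cross3 (tderiv V t) (N0 t)) (V t)) * norm (covariant_deriv N0 V t)"

definition alpha0 :: "(real \<Rightarrow> real^3) \<Rightarrow> (real \<Rightarrow> real^3) \<Rightarrow> real \<Rightarrow> loop" where
  "alpha0 N0 V t z =
     coef_c N0 V t *\<^sub>R e3 + z *\<^sub>C e1
     + inverse z *\<^sub>C (- coef_b N0 V t *\<^sub>R e1 + coef_a N0 V t *\<^sub>R e2)"

end

theory Submission
  imports Defs "HOL-Complex_Analysis.Cauchy_Integral_Formula"
begin

text \<open>
  Along the diagonal, the frame \<open>(N0 \<times> V, -V, N0)\<close> has the coefficients \<open>(1 - b, a, c)\<close>. The
  conditions for a frame with \<open>F\<inverse> F\<^sub>x = c e3 + z e1\<close> and \<open>F\<inverse> F\<^sub>y = z\<inverse> (\<beta>1 e1 + \<beta>2 e2)\<close> are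
  \<open>c\<^sub>y = \<beta>2\<close>, \<open>\<beta>1\<^sub>x = c \<beta>2\<close>, \<open>\<beta>2\<^sub>x = - c \<beta>1\<close>. Hence \<open>(\<beta>1, \<beta>2)\<close> is a rotation of its diagonal value
  \<open>(-b, a)\<close> by an angle with \<open>x\<close>-derivative \<open>c\<close>, and the angle satisfies an equation of sine-Gordon
  type with a globally Lipschitz nonlinearity, so the Cauchy problem has a global smooth solution.

  The restriction \<open>X(t) = F(t,t)\<close> integrates the potential on both sides of the method. No
  Birkhoff theorem is needed to factor \<open>X(x)\<inverse> X(y)\<close>: the factors are \<open>F(x,x)\<inverse> F(x,y)\<close>, which solves an
  equation in \<open>y\<close> with coefficients linear in \<open>1/z\<close>, and \<open>F(x,y)\<inverse> F(y,y)\<close>, which comes from the equation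
  in \<open>x\<close> with coefficients affine in \<open>z\<close>.

  Uniqueness follows from \<open>N\<^sub>x\<^sub>y = - \<langle>N\<^sub>x, N\<^sub>y\<rangle> N\<close> by a Gronwall argument started on the diagonal, and the
  three criteria from \<open>N\<^sub>x = V\<close>, \<open>N\<^sub>y = a N0 \<times> V - b V\<close> there.
\<close>

section \<open>Primitives on an open interval\<close>

text \<open>The compatibility equations are quadratic in (c, \<beta>1, \<beta>2), so Picard
  iteration applied to them directly would in general converge only near the diagonal. They preserve
  \<beta>1^2 + \<beta>2^2 along x; the angle exploits this, since a rotation keeps (\<beta>1,
  \<beta>2) bounded whatever c is. The data sit on the diagonal and the unknowns are integrated in
  different directions, but each of them from the diagonal, so the single weight |x - y| measures
  the gain for all. Parameters in linear equations are treated by one identity: the difference of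
  two solutions is exactly a scalar increment times a matrix depending continuously on the
  parameter, which is Caratheodory's form of the derivative. It yields the x-derivative of the
  vertical factor of the frame as well as holomorphy in z. The method starts from F(t0,t0) = I and
  therefore always produces N(t0,t0) = e3; this is why its output matches the prescribed data only
  after a rotation.\<close>

definition prim :: "real \<Rightarrow> (real \<Rightarrow> 'b::banach) \<Rightarrow> real \<Rightarrow> 'b" where
  "prim a f t = integral {a..t} f - integral {t..a} f"

lemma prim_refl [simp]: "prim a f a = 0"
  by (simp add: prim_def)

text \<open>The mean value inequality in the form that every iteration below uses: one integration
  from a raises the power of the distance by one and divides by \<open>Suc n\<close>. Segments allow
  t on either side of a.\<close>

lemma norm_increment_le_power:
  fixes G :: "real \<Rightarrow> 'b::real_normed_vector"
  assumes der: "\<And>s. s \<in> closed_segment a t \<Longrightarrow> (G has_vector_derivative g s) (at s)"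
    and le: "\<And>s. s \<in> closed_segment a t \<Longrightarrow> norm (g s) \<le> C * \<bar>s - a\<bar> ^ n"
  shows "norm (G t - G a) \<le> C * \<bar>t - a\<bar> ^ Suc n / Suc n"
proof -
  \<comment> \<open>It suffices to move to the right from 0; the two positions of t relative to a
    follow by the substitutions a + u and a - u.\<close>
  have main: "norm (H s - H 0) \<le> C * s ^ Suc n / Suc n"
    if "0 \<le> s" and d: "\<And>u. 0 \<le> u \<Longrightarrow> u \<le> s \<Longrightarrow> (H has_vector_derivative h u) (at u)"
      and b: "\<And>u. 0 \<le> u \<Longrightarrow> u \<le> s \<Longrightarrow> norm (h u) \<le> C * u ^ n"
    for H :: "real \<Rightarrow> 'b" and h s
  proof (cases "s = 0")
    case True then show ?thesis by simp
  next
    case False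
    then have s: "0 < s" using \<open>0 \<le> s\<close> by simp
    have cH: "continuous_on {0..s} H"
      using d by (intro continuous_at_imp_continuous_on ballI has_vector_derivative_continuous) auto
    have "norm (H s - H 0) \<le> C * s ^ Suc n / Suc n - C * 0 ^ Suc n / Suc n"
    proof (rule differentiable_bound_general[OF s cH])
      show "continuous_on {0..s} (\<lambda>u. C * u ^ Suc n / Suc n)"
        by (intro continuous_intros) auto
      show "((\<lambda>u. C * u ^ Suc n / Suc n) has_vector_derivative C * u ^ n) (at u)" for u
        unfolding has_real_derivative_iff_has_vector_derivative[symmetric]
        by (rule derivative_eq_intros refl | simp del: of_nat_Suc)+
      show "(H has_vector_derivative h u) (at u)" "norm (h u) \<le> C * u ^ n" if "0 < u" "u < s" for u
        using d b that by auto
    qed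
    then show ?thesis by simp
  qed
  show ?thesis
  proof (cases "a \<le> t")
    case True
    have "norm ((\<lambda>u. G (a + u)) (t - a) - (\<lambda>u. G (a + u)) 0) \<le> C * (t - a) ^ Suc n / Suc n"
    proof (rule main[where h = "\<lambda>u. g (a + u)"])
      fix u assume u: "0 \<le> u" "u \<le> t - a"
      then have mem: "a + u \<in> closed_segment a t" using True by (auto simp: closed_segment_eq_real_ivl)
      from le[OF mem] u show "norm (g (a + u)) \<le> C * u ^ n" by simp
      have "((\<lambda>u. a + u) has_vector_derivative 1) (at u)"
        by (rule derivative_eq_intros refl | simp)+
      then show "((\<lambda>u. G (a + u)) has_vector_derivative g (a + u)) (at u)"
        using vector_diff_chain_at[of "\<lambda>u. a + u" 1 u G "g (a + u)"] der[OF mem] by (simp add: o_def)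
    qed (use True in auto)
    then show ?thesis using True by simp
  next
    case False
    have "norm ((\<lambda>u. G (a - u)) (a - t) - (\<lambda>u. G (a - u)) 0) \<le> C * (a - t) ^ Suc n / Suc n"
    proof (rule main[where h = "\<lambda>u. - g (a - u)"])
      fix u assume u: "0 \<le> u" "u \<le> a - t"
      then have mem: "a - u \<in> closed_segment a t" using False by (auto simp: closed_segment_eq_real_ivl)
      from le[OF mem] u show "norm (- g (a - u)) \<le> C * u ^ n" by simp
      have "((\<lambda>u. a - u) has_vector_derivative -1) (at u)"
        by (rule derivative_eq_intros refl | simp)+
      then show "((\<lambda>u. G (a - u)) has_vector_derivative - g (a - u)) (at u)"
        using vector_diff_chain_at[of "\<lambda>u. a - u" "-1" u G "g (a - u)"] der[OF mem] by (simp add: o_def)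
    qed (use False in auto)
    then show ?thesis using False by (simp add: abs_if)
  qed
qed

locale open_interval =
  fixes I :: "real set"
  assumes open_I: "open I" and interval_I: "is_interval I"
begin

lemma convex_I: "convex I"
  using interval_I is_interval_convex by blast

lemma segment_subset: "a \<in> I \<Longrightarrow> b \<in> I \<Longrightarrow> closed_segment a b \<subseteq> I"
  using convex_I closed_segment_subset by blast

lemma ivl_subset: "a \<in> I \<Longrightarrow> b \<in> I \<Longrightarrow> {a..b} \<subseteq> I"
  using segment_subset[of a b] by (auto simp: closed_segment_eq_real_ivl split: if_splits)

lemma affine_mem: "a \<in> I \<Longrightarrow> b \<in> I \<Longrightarrow> s \<in> {0..1} \<Longrightarrow> a + s * (b - a) \<in> I"
  using segment_subset[of a b] closed_segment_real_eq[of a b]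
  by (metis (no_types, lifting) add.commute image_eqI mult.commute subsetD)

lemma obtain_enclosing:
  assumes "s \<in> I" "t \<in> I"
  obtains a b where "a \<in> I" "b \<in> I" "a < s" "a < t" "s < b" "t < b"
proof -
  have "\<exists>a\<in>I. a < u" "\<exists>b\<in>I. u < b" if u: "u \<in> I" for u
  proof -
    obtain e where e: "e > 0" "ball u e \<subseteq> I" using open_I u open_contains_ball by blast
    then have "u - e/2 \<in> I" "u + e/2 \<in> I"
      by (auto intro!: subsetD[OF e(2)] simp: dist_real_def)
    moreover have "u - e/2 < u" "u < u + e/2" using e(1) by auto
    ultimately show "\<exists>a\<in>I. a < u" "\<exists>b\<in>I. u < b" by blast+
  qed
  from this[of "min s t"] this[of "max s t"] assms
  show thesis using that by (metis min_less_iff_conj max_less_iff_conj min_def max_def)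
qed

lemma at_within_I: "t \<in> I \<Longrightarrow> at t within I = at t"
  using open_I at_within_open by blast

lemma constant_on_I:
  fixes G :: "real \<Rightarrow> 'b::real_normed_vector"
  assumes "\<And>t. t \<in> I \<Longrightarrow> (G has_vector_derivative 0) (at t)" "a \<in> I" "t \<in> I"
  shows "G t = G a"
proof -
  have "norm (G t - G a) \<le> 0 * \<bar>t - a\<bar> ^ Suc 0 / Suc 0"
    by (rule norm_increment_le_power[where g = "\<lambda>_. 0"])
       (use assms segment_subset[of a t] in auto)
  then show ?thesis by simp
qed

lemma has_vector_derivative_prim:
  fixes f :: "real \<Rightarrow> 'b::banach"
  assumes f: "continuous_on I f" and "a \<in> I" "t \<in> I"
  shows "(prim a f has_vector_derivative f t) (at t)"
proof -
  obtain l u where lu: "l \<in> I" "u \<in> I" "l < a" "l < t" "a < u" "t < u"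
    using obtain_enclosing[OF assms(2,3)] by blast
  have cf: "continuous_on {l..u} f"
    using f ivl_subset lu continuous_on_subset by blast
  \<comment> \<open>One of the two integrals in \<open>prim\<close> is over an empty or degenerate
    interval and vanishes, so \<open>prim\<close> is the oriented integral. Taking l as base point
    puts a and t into the interior of one interval.\<close>
  have eq: "prim a f v = integral {l..v} f - integral {l..a} f" if v: "v \<in> {l..u}" for v
  proof -
    have ii: "f integrable_on {l..u'}" if "u' \<in> {l..u}" for u'
      using cf that by (intro integrable_continuous_real continuous_on_subset[OF cf]) auto
    show ?thesis
    proof (cases "a \<le> v")
      case True
      then have "integral {l..a} f + integral {a..v} f = integral {l..v} f"
        using lu v ii by (intro Henstock_Kurzweil_Integration.integral_combine) auto
      moreover have "integral {v..a} f = 0" using True by (cases "a = v") auto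
      ultimately show ?thesis by (simp add: prim_def algebra_simps)
    next
      case False
      then have "integral {l..v} f + integral {v..a} f = integral {l..a} f"
        using lu v ii by (intro Henstock_Kurzweil_Integration.integral_combine) auto
      moreover have "integral {a..v} f = 0" using False by auto
      ultimately show ?thesis by (simp add: prim_def algebra_simps)
    qed
  qed
  have "((\<lambda>v. integral {l..v} f - integral {l..a} f) has_vector_derivative f t) (at t within {l..u})"
    using integral_has_vector_derivative[OF cf, of t] lu
    by (auto intro!: derivative_eq_intros)
  then have "(prim a f has_vector_derivative f t) (at t within {l..u})"
    by (rule has_vector_derivative_transform[rotated 2]) (use lu eq in auto)
  moreover have "at t within {l..u} = at t"
    using lu by (intro at_within_interior) auto
  ultimately show ?thesis by simp
qed

lemma prim_eq_increment:
  fixes G :: "real \<Rightarrow> 'b::banach"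
  assumes "\<And>t. t \<in> I \<Longrightarrow> (G has_vector_derivative g t) (at t)" "continuous_on I g" "a \<in> I" "t \<in> I"
  shows "prim a g t = G t - G a"
proof -
  have "(\<lambda>s. G s - prim a g s) t = (\<lambda>s. G s - prim a g s) a"
  proof (rule constant_on_I)
    fix s assume "s \<in> I"
    then have "((\<lambda>s. G s - prim a g s) has_vector_derivative g s - g s) (at s)"
      using assms by (intro derivative_intros has_vector_derivative_prim) auto
    then show "((\<lambda>s. G s - prim a g s) has_vector_derivative 0) (at s)" by simp
  qed (use assms in auto)
  then show ?thesis by (simp add: algebra_simps)
qed

lemma prim_cong:
  assumes "\<And>s. s \<in> I \<Longrightarrow> f s = g s" "a \<in> I" "t \<in> I"
  shows "prim a f t = prim a g t"
proof -
  have "integral {a..t} f = integral {a..t} g" "integral {t..a} f = integral {t..a} g"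
    using assms ivl_subset[of a t] ivl_subset[of t a]
    by (auto intro!: Henstock_Kurzweil_Integration.integral_cong)
  then show ?thesis by (simp add: prim_def)
qed

lemma prim_linear:
  fixes f :: "real \<Rightarrow> 'b::banach" and h :: "'b \<Rightarrow> 'c::banach"
  assumes h: "bounded_linear h" and f: "continuous_on I f" and "a \<in> I" "t \<in> I"
  shows "prim a (\<lambda>s. h (f s)) t = h (prim a f t)"
proof -
  have "prim a (\<lambda>s. h (f s)) t = h (prim a f t) - h (prim a f a)"
  proof (rule prim_eq_increment)
    show "continuous_on I (\<lambda>s. h (f s))" using h f by (rule bounded_linear.continuous_on)
    show "((\<lambda>s. h (prim a f s)) has_vector_derivative h (f s)) (at s)" if "s \<in> I" for s
      using has_vector_derivative_prim[OF f assms(3) that] h bounded_linear.has_vector_derivative by blast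
  qed fact+
  then show ?thesis by (simp add: linear_0[OF bounded_linear.linear[OF h]])
qed

lemma prim_diff:
  fixes f g :: "real \<Rightarrow> 'b::banach"
  assumes f: "continuous_on I f" and g: "continuous_on I g" and a: "a \<in> I" and t: "t \<in> I"
  shows "prim a (\<lambda>s. f s - g s) t = prim a f t - prim a g t"
proof -
  have "prim a (\<lambda>s. f s - g s) t = (\<lambda>s. prim a f s - prim a g s) t - (\<lambda>s. prim a f s - prim a g s) a"
    by (rule prim_eq_increment) (use assms in \<open>auto intro!: derivative_intros has_vector_derivative_prim continuous_intros\<close>)
  then show ?thesis by simp
qed

lemma norm_prim_le_power:
  fixes f :: "real \<Rightarrow> 'b::banach"
  assumes f: "continuous_on I f" and "a \<in> I" "t \<in> I"
    and le: "\<And>s. s \<in> closed_segment a t \<Longrightarrow> norm (f s) \<le> C * \<bar>s - a\<bar> ^ n"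
  shows "norm (prim a f t) \<le> C * \<bar>t - a\<bar> ^ Suc n / Suc n"
proof -
  have "norm (prim a f t - prim a f a) \<le> C * \<bar>t - a\<bar> ^ Suc n / Suc n"
    by (rule norm_increment_le_power[where g = f])
       (use segment_subset[OF assms(2,3)] has_vector_derivative_prim[OF f assms(2)] le in auto)
  then show ?thesis by simp
qed

text \<open>On the fixed interval [0,1] the endpoints become parameters of the integrand, so joint
  continuity in both endpoints reduces to that of a parameter integral.\<close>

lemma prim_eq_scaled:
  fixes f :: "real \<Rightarrow> 'b::banach"
  assumes f: "continuous_on I f" and "a \<in> I" "t \<in> I"
  shows "prim a f t = (t - a) *\<^sub>R integral {0..1} (\<lambda>s. f (a + s * (t - a)))"
proof -
  have "((\<lambda>s. (t - a) *\<^sub>R f (a + s * (t - a))) has_integral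
      (\<lambda>s. prim a f (a + s * (t - a))) 1 - (\<lambda>s. prim a f (a + s * (t - a))) 0) {0..1}"
  proof (rule fundamental_theorem_of_calculus)
    fix s :: real assume s: "s \<in> {0..1}"
    have "((\<lambda>s. a + s * (t - a)) has_vector_derivative (t - a)) (at s)"
      by (rule derivative_eq_intros refl | simp)+
    from vector_diff_chain_at[OF this has_vector_derivative_prim[OF f \<open>a \<in> I\<close> affine_mem[OF assms(2,3) s]]]
    show "((\<lambda>s. prim a f (a + s * (t - a))) has_vector_derivative (t - a) *\<^sub>R f (a + s * (t - a))) (at s within {0..1})"
      by (auto simp: o_def intro: has_vector_derivative_at_within)
  qed simp
  from integral_unique[OF this, symmetric] show ?thesis by simp
qed

lemma continuous_on_prim:
  fixes f :: "'p::topological_space \<Rightarrow> real \<Rightarrow> 'b::banach"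
  assumes f: "continuous_on (P \<times> I) (\<lambda>(p, s). f p s)"
    and a: "continuous_on P a" "a ` P \<subseteq> I" and t: "continuous_on P t" "t ` P \<subseteq> I"
  shows "continuous_on P (\<lambda>p. prim (a p) (f p) (t p))"
proof -
  have f1: "continuous_on I (f p)" if "p \<in> P" for p
  proof -
    have "continuous_on I (\<lambda>s. case (p, s) of (p, s) \<Rightarrow> f p s)"
      by (rule continuous_on_compose2[OF f]) (use that in \<open>auto intro!: continuous_intros\<close>)
    then show ?thesis by simp
  qed
  have "continuous_on (P \<times> cbox 0 1) (\<lambda>x. (fst x, a (fst x) + snd x * (t (fst x) - a (fst x))))"
    by (intro continuous_intros continuous_on_compose2[OF a(1)] continuous_on_compose2[OF t(1)]) auto
  moreover have "(\<lambda>x. (fst x, a (fst x) + snd x * (t (fst x) - a (fst x)))) ` (P \<times> cbox 0 1) \<subseteq> P \<times> I"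
  proof (intro subsetI, elim imageE)
    fix y x assume "y = (fst x, a (fst x) + snd x * (t (fst x) - a (fst x)))" "x \<in> P \<times> cbox (0::real) 1"
    then show "y \<in> P \<times> I" using a(2) t(2) affine_mem[of "a (fst x)" "t (fst x)" "snd x"]
      by (auto simp: image_subset_iff mem_Times_iff)
  qed
  ultimately have "continuous_on (P \<times> cbox 0 1)
      (\<lambda>x. case (fst x, a (fst x) + snd x * (t (fst x) - a (fst x))) of (p, s) \<Rightarrow> f p s)"
    by (rule continuous_on_compose2[OF f])
  then have "continuous_on (P \<times> cbox 0 1) (\<lambda>(p, s). f p (a p + s * (t p - a p)))"
    by (simp add: case_prod_unfold)
  then have "continuous_on P (\<lambda>p. integral (cbox 0 1) (\<lambda>s. f p (a p + s * (t p - a p))))"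
    by (rule integral_continuous_on_param)
  then have "continuous_on P (\<lambda>p. (t p - a p) *\<^sub>R integral {0..1} (\<lambda>s. f p (a p + s * (t p - a p))))"
    using a(1) t(1) by (intro continuous_on_scaleR continuous_on_diff) simp_all
  then show ?thesis
    using a t prim_eq_scaled[OF f1] by (simp add: image_subset_iff cong: continuous_on_cong)
qed

lemma has_vector_derivative_prim_param:
  fixes f f' :: "real \<Rightarrow> real \<Rightarrow> 'b::banach"
  assumes d: "\<And>x s. x \<in> I \<Longrightarrow> s \<in> I \<Longrightarrow> ((\<lambda>x. f x s) has_vector_derivative f' x s) (at x)"
    and c: "\<And>x. x \<in> I \<Longrightarrow> continuous_on I (f x)"
    and c': "continuous_on (I \<times> I) (\<lambda>(x, s). f' x s)"
    and "a \<in> I" "b \<in> I" "x \<in> I"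
  shows "((\<lambda>x. prim a (f x) b) has_vector_derivative prim a (f' x) b) (at x)"
proof -
  have "((\<lambda>x. integral (cbox a b) (f x)) has_vector_derivative integral (cbox a b) (f' x)) (at x within I)"
    if "a \<in> I" "b \<in> I" for a b
  proof (rule leibniz_rule_vector_derivative[where U = I and f = f and fx = f'])
    show "((\<lambda>x. f x t) has_vector_derivative f' x t) (at x within I)" if "x \<in> I" "t \<in> cbox a b" for x t
      using has_vector_derivative_at_within[OF d[of x t]] that ivl_subset[OF \<open>a \<in> I\<close> \<open>b \<in> I\<close>] by auto
    show "f x integrable_on cbox a b" if "x \<in> I" for x
      using continuous_on_subset[OF c[OF that] ivl_subset[OF \<open>a \<in> I\<close> \<open>b \<in> I\<close>]]
      by (simp add: integrable_continuous_real)
    show "continuous_on (I \<times> cbox a b) (\<lambda>(x, t). f' x t)"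
      using ivl_subset[OF \<open>a \<in> I\<close> \<open>b \<in> I\<close>] by (intro continuous_on_subset[OF c']) auto
  qed (fact \<open>x \<in> I\<close> convex_I)+
  from has_vector_derivative_diff[OF this[of a b] this[of b a]] \<open>a \<in> I\<close> \<open>b \<in> I\<close> \<open>x \<in> I\<close> show ?thesis
    unfolding prim_def by (simp add: at_within_I)
qed

end

section \<open>Calculus of \<open>C\<^sup>k\<close> maps\<close>

lemma Ck_on_cong:
  assumes "open S" "\<And>p. p \<in> S \<Longrightarrow> f p = g p" "Ck_on k f S"
  shows "Ck_on k g S"
  using assms(2,3)
proof (induction k arbitrary: f g)
  case 0
  then show ?case using continuous_on_cong[of S S f g] by simp
next
  case (Suc k)
  have d: "(g has_derivative frechet_derivative f (at p)) (at p)" if "p \<in> S" for p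
  proof (rule has_derivative_transform_within_open)
    show "(f has_derivative frechet_derivative f (at p)) (at p)"
      using Suc.prems(2) that by (simp add: frechet_derivative_works)
  qed (use assms(1) that Suc.prems(1) in auto)
  have e: "frechet_derivative f (at p) v = frechet_derivative g (at p) v" if "p \<in> S" for p v
    using frechet_derivative_at[OF d[OF that]] by simp
  have "Ck_on k (\<lambda>p. frechet_derivative g (at p) v) S" for v
    using Suc.IH[of "\<lambda>p. frechet_derivative f (at p) v"] e Suc.prems(2) by simp
  moreover have "g differentiable (at p)" if "p \<in> S" for p
    using d[OF that] by (auto simp: differentiable_def)
  ultimately show ?case by simp
qed

text \<open>\<open>Ck_on\<close> speaks of the chosen \<open>frechet_derivative\<close>; by
  uniqueness of derivatives any explicit derivative may take its place.\<close>

lemma Ck_on_SucI: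
  assumes "open S" "\<And>p. p \<in> S \<Longrightarrow> (f has_derivative f' p) (at p)" "\<And>v. Ck_on k (\<lambda>p. f' p v) S"
  shows "Ck_on (Suc k) f S"
proof -
  have e: "f' p v = frechet_derivative f (at p) v" if "p \<in> S" for p v
    using frechet_derivative_at[OF assms(2)[OF that]] by simp
  have "Ck_on k (\<lambda>p. frechet_derivative f (at p) v) S" for v
    by (rule Ck_on_cong[OF assms(1) e assms(3)])
  moreover have "f differentiable (at p)" if "p \<in> S" for p
    using assms(2)[OF that] by (auto simp: differentiable_def)
  ultimately show ?thesis by simp
qed

lemma Ck_on_SucD:
  assumes "Ck_on (Suc k) f S"
  shows "p \<in> S \<Longrightarrow> (f has_derivative frechet_derivative f (at p)) (at p)"
    and "Ck_on k (\<lambda>p. frechet_derivative f (at p) v) S"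
  using assms by (auto simp: frechet_derivative_works)

lemma Ck_on_Suc_imp: "Ck_on (Suc k) f S \<Longrightarrow> Ck_on k f S"
proof (induction k arbitrary: f)
  case 0
  have "isCont f p" if "p \<in> S" for p
    using has_derivative_continuous[OF Ck_on_SucD(1)[OF 0 that]] .
  then show ?case by (simp add: continuous_at_imp_continuous_on)
next
  case (Suc k)
  have "Ck_on k (\<lambda>p. frechet_derivative f (at p) v) S" for v
    using Suc.IH[OF Ck_on_SucD(2)[OF Suc.prems]] .
  moreover have "\<forall>p\<in>S. f differentiable (at p)"
    using Suc.prems by simp
  ultimately show ?case by simp
qed

lemma Ck_on_imp_continuous: "Ck_on k f S \<Longrightarrow> continuous_on S f"
  by (induction k) (use Ck_on_Suc_imp in \<open>auto simp del: Ck_on.simps(2)\<close>)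

lemma Ck_on_const: "open S \<Longrightarrow> Ck_on k (\<lambda>_. c) S"
proof (induction k arbitrary: c)
  case (Suc k)
  show ?case by (rule Ck_on_SucI[where f' = "\<lambda>_ _. 0"]) (use Suc in \<open>auto simp del: Ck_on.simps\<close>)
qed simp

lemma Ck_on_add:
  "open S \<Longrightarrow> Ck_on k f S \<Longrightarrow> Ck_on k g S \<Longrightarrow> Ck_on k (\<lambda>p. f p + g p) S"
proof (induction k arbitrary: f g)
  case 0
  then show ?case by (auto intro: continuous_on_add)
next
  case (Suc k)
  note f = Ck_on_SucD[OF Suc.prems(2)] and g = Ck_on_SucD[OF Suc.prems(3)]
  show ?case
    by (rule Ck_on_SucI[OF Suc.prems(1) has_derivative_add[OF f(1) g(1)] Suc.IH[OF Suc.prems(1) f(2) g(2)]])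
qed

lemma Ck_on_linear:
  assumes h: "bounded_linear h" and S: "open S"
  shows "Ck_on k f S \<Longrightarrow> Ck_on k (\<lambda>p. h (f p)) S"
proof (induction k arbitrary: f)
  case 0
  then show ?case using bounded_linear.continuous_on[OF h] by simp
next
  case (Suc k)
  note f = Ck_on_SucD[OF Suc.prems]
  show ?case
    by (rule Ck_on_SucI[OF S bounded_linear.has_derivative[OF h f(1)] Suc.IH[OF f(2)]])
qed

text \<open>One induction for all products that occur: real, scalar, matrix, inner and cross
  products.\<close>

lemma Ck_on_bilinear:
  assumes h: "bounded_bilinear h" and S: "open S"
  shows "Ck_on k f S \<Longrightarrow> Ck_on k g S \<Longrightarrow> Ck_on k (\<lambda>p. h (f p) (g p)) S"
proof (induction k arbitrary: f g)
  case 0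
  then show ?case using bounded_bilinear.continuous_on[OF h] by simp
next
  case (Suc k)
  note f = Ck_on_SucD[OF Suc.prems(1)] and g = Ck_on_SucD[OF Suc.prems(2)]
  note f0 = Ck_on_Suc_imp[OF Suc.prems(1)] and g0 = Ck_on_Suc_imp[OF Suc.prems(2)]
  show ?case
    by (rule Ck_on_SucI[OF S bounded_bilinear.FDERIV[OF h f(1) g(1)]
          Ck_on_add[OF S Suc.IH[OF f0 g(2)] Suc.IH[OF f(2) g0]]])
qed

lemma Ck_on_compose_linear:
  assumes h: "bounded_linear h" and S: "open S" and sub: "\<And>p. p \<in> S \<Longrightarrow> h p \<in> T"
  shows "Ck_on k f T \<Longrightarrow> Ck_on k (\<lambda>p. f (h p)) S"
proof (induction k arbitrary: f)
  case 0
  then have "continuous_on T f" by simp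
  then have "continuous_on S (\<lambda>p. f (h p))"
    by (rule continuous_on_compose2) (use h sub in \<open>auto intro: linear_continuous_on\<close>)
  then show ?case by simp
next
  case (Suc k)
  note f = Ck_on_SucD[OF Suc.prems]
  have "((\<lambda>p. f (h p)) has_derivative (\<lambda>v. frechet_derivative f (at (h p)) (h v))) (at p)"
    if "p \<in> S" for p
    using has_derivative_compose[OF bounded_linear_imp_has_derivative[OF h] f(1)[OF sub[OF that]]] .
  then show ?case by (rule Ck_on_SucI[OF S _ Suc.IH[OF f(2)]])
qed

lemmas Ck_on_scaleR = Ck_on_bilinear[OF bounded_bilinear_scaleR]
lemmas Ck_on_mult = Ck_on_bilinear[OF bounded_bilinear_mult]
lemmas Ck_on_minus = Ck_on_linear[OF bounded_linear_minus[OF bounded_linear_ident]]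

lemma Ck_on_diff:
  assumes "open S" "Ck_on k f S" "Ck_on k g S"
  shows "Ck_on k (\<lambda>p. f p - g p) S"
  using Ck_on_add[OF assms(1,2) Ck_on_minus[OF assms(1,3)]] by simp

text \<open>Proved jointly, because each derivative contains the other function.\<close>

lemma Ck_on_sin_cos:
  fixes f :: "'a::euclidean_space \<Rightarrow> real"
  assumes S: "open S"
  shows "Ck_on k f S \<Longrightarrow> Ck_on k (\<lambda>p. sin (f p)) S \<and> Ck_on k (\<lambda>p. cos (f p)) S"
proof (induction k)
  case 0
  then show ?case by (auto intro: continuous_intros)
next
  case (Suc k)
  note f = Ck_on_SucD[OF Suc.prems]
  note IH = Suc.IH[OF Ck_on_Suc_imp[OF Suc.prems]]
  have "Ck_on (Suc k) (\<lambda>p. sin (f p)) S"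
  proof (rule Ck_on_SucI[OF S])
    show "((\<lambda>p. sin (f p)) has_derivative (\<lambda>v. frechet_derivative f (at p) v * cos (f p))) (at p)" if "p \<in> S" for p
      using has_derivative_sin[OF f(1)[OF that]] by simp
    show "Ck_on k (\<lambda>p. frechet_derivative f (at p) v * cos (f p)) S" for v
      using Ck_on_mult[OF S f(2)] IH by blast
  qed
  moreover have "Ck_on (Suc k) (\<lambda>p. cos (f p)) S"
  proof (rule Ck_on_SucI[OF S])
    show "((\<lambda>p. cos (f p)) has_derivative (\<lambda>v. frechet_derivative f (at p) v * - sin (f p))) (at p)" if "p \<in> S" for p
      using has_derivative_cos[OF f(1)[OF that]] by simp
    show "Ck_on k (\<lambda>p. frechet_derivative f (at p) v * - sin (f p)) S" for v
      using Ck_on_mult[OF S f(2) Ck_on_minus[OF S]] IH by blast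
  qed
  ultimately show ?case by blast
qed

lemma Ck_on_Suc_realI:
  fixes f :: "real \<Rightarrow> 'b::real_normed_vector"
  assumes S: "open S" and d: "\<And>t. t \<in> S \<Longrightarrow> (f has_vector_derivative f' t) (at t)" and "Ck_on k f' S"
  shows "Ck_on (Suc k) f S"
proof (rule Ck_on_SucI[OF S])
  show "(f has_derivative (\<lambda>v. v *\<^sub>R f' t)) (at t)" if "t \<in> S" for t
    using d[OF that] by (simp add: has_vector_derivative_def)
  show "Ck_on k (\<lambda>t. v *\<^sub>R f' t) S" for v
    using Ck_on_linear[OF bounded_linear_scaleR_right S] assms(3) by blast
qed

lemma Ck_on_Suc_realD:
  fixes f :: "real \<Rightarrow> 'b::real_normed_vector"
  assumes "open S" "Ck_on (Suc k) f S"
  shows "t \<in> S \<Longrightarrow> (f has_vector_derivative vector_derivative f (at t)) (at t)"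
    and "Ck_on k (\<lambda>t. vector_derivative f (at t)) S"
proof -
  have d: "(f has_vector_derivative frechet_derivative f (at t) 1) (at t)" if "t \<in> S" for t
  proof -
    have D: "(f has_derivative frechet_derivative f (at t)) (at t)" using Ck_on_SucD(1)[OF assms(2) that] .
    interpret bounded_linear "frechet_derivative f (at t)" using D by (rule has_derivative_bounded_linear)
    have "frechet_derivative f (at t) = (\<lambda>v. v *\<^sub>R frechet_derivative f (at t) 1)"
      by (rule ext) (metis scaleR mult.right_neutral real_scaleR_def)
    then show ?thesis using D by (simp add: has_vector_derivative_def)
  qed
  have e: "frechet_derivative f (at t) 1 = vector_derivative f (at t)" if "t \<in> S" for t
    using vector_derivative_at[OF d[OF that]] by simp
  show "(f has_vector_derivative vector_derivative f (at t)) (at t)" if "t \<in> S"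
    using d[OF that] e[OF that] by simp
  show "Ck_on k (\<lambda>t. vector_derivative f (at t)) S"
    by (rule Ck_on_cong[OF assms(1) e Ck_on_SucD(2)[OF assms(2)]])
qed

lemma has_derivative_imp_partials:
  fixes g :: "real \<times> real \<Rightarrow> 'b::real_normed_vector"
  assumes "(g has_derivative D) (at (x, y))"
  shows "((\<lambda>s. g (s, y)) has_vector_derivative D (1, 0)) (at x)"
    and "((\<lambda>s. g (x, s)) has_vector_derivative D (0, 1)) (at y)"
proof -
  interpret bounded_linear D using assms by (rule has_derivative_bounded_linear)
  have 1: "((\<lambda>s. (s, y)) has_derivative (\<lambda>h. (h, 0))) (at x)"
    and 2: "((\<lambda>s. (x, s)) has_derivative (\<lambda>h. (0, h))) (at y)"
    by (auto intro!: derivative_eq_intros)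
  have "(\<lambda>h. D (h, 0)) = (\<lambda>h. h *\<^sub>R D (1, 0))" "(\<lambda>h. D (0, h)) = (\<lambda>h. h *\<^sub>R D (0, 1))"
    by (simp_all flip: scaleR)
  with has_derivative_compose[OF 1 assms] has_derivative_compose[OF 2 assms]
  show "((\<lambda>s. g (s, y)) has_vector_derivative D (1, 0)) (at x)"
    and "((\<lambda>s. g (x, s)) has_vector_derivative D (0, 1)) (at y)"
    by (simp_all add: has_vector_derivative_def)
qed

lemma has_derivative_imp_diagonal:
  fixes g :: "real \<times> real \<Rightarrow> 'b::real_normed_vector"
  assumes "(g has_derivative D) (at (t, t))"
  shows "((\<lambda>s. g (s, s)) has_vector_derivative D (1, 0) + D (0, 1)) (at t)"
proof -
  interpret bounded_linear D using assms by (rule has_derivative_bounded_linear)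
  have 1: "((\<lambda>s. (s, s)) has_derivative (\<lambda>h. (h, h))) (at t)"
    by (auto intro!: derivative_eq_intros)
  have "D (h, h) = h *\<^sub>R (D (1, 0) + D (0, 1))" for h
    by (simp flip: scaleR add)
  then have "(\<lambda>h. D (h, h)) = (\<lambda>h. h *\<^sub>R (D (1, 0) + D (0, 1)))" by (rule ext)
  with has_derivative_compose[OF 1 assms] show ?thesis
    by (simp add: has_vector_derivative_def)
qed

lemma prim_base_change:
  fixes f :: "real \<Rightarrow> 'b::banach"
  assumes "open_interval I" "continuous_on I f" "a \<in> I" "b \<in> I" "t \<in> I"
  shows "prim b f t = prim a f t - prim a f b"
proof -
  interpret open_interval I by fact
  show ?thesis
    by (rule prim_eq_increment) (use has_vector_derivative_prim[OF assms(2,3)] assms in auto)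
qed

section \<open>Partial derivatives and integrals on the square\<close>

context open_interval
begin

abbreviation II :: "(real \<times> real) set" where "II \<equiv> I \<times> I"

lemma open_II: "open II"
  using open_I by (simp add: open_Times)

lemma continuous_on_slices:
  assumes "continuous_on II g" "t \<in> I"
  shows "continuous_on I (\<lambda>s. g (s, t))" "continuous_on I (\<lambda>s. g (t, s))"
  using assms(2)
  by (auto intro!: continuous_on_compose2[OF assms(1)] continuous_on_Pair continuous_on_id continuous_on_const)

text \<open>Unlike \<open>pdx\<close> and \<open>pdy\<close>, which return a value whether or not a
  derivative exists, this asserts differentiability along both axes.\<close>

definition partials_on :: "(real \<times> real \<Rightarrow> 'b::real_normed_vector) \<Rightarrow> (real \<times> real \<Rightarrow> 'b) \<Rightarrow> (real \<times> real \<Rightarrow> 'b) \<Rightarrow> bool" where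
  "partials_on g gx gy \<longleftrightarrow> (\<forall>x\<in>I. \<forall>y\<in>I. ((\<lambda>s. g (s, y)) has_vector_derivative gx (x, y)) (at x) \<and>
     ((\<lambda>s. g (x, s)) has_vector_derivative gy (x, y)) (at y))"

lemma partials_onD:
  assumes "partials_on g gx gy" "x \<in> I" "y \<in> I"
  shows "((\<lambda>s. g (s, y)) has_vector_derivative gx (x, y)) (at x)"
    and "((\<lambda>s. g (x, s)) has_vector_derivative gy (x, y)) (at y)"
  using assms by (auto simp: partials_on_def)

lemma partials_on_pd:
  assumes "partials_on g gx gy" "p \<in> II"
  shows "pdx g p = gx p" "pdy g p = gy p"
  using partials_onD[OF assms(1), of "fst p" "snd p"] assms(2)
  by (auto simp: pdx_def pdy_def vector_derivative_at mem_Times_iff)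

text \<open>Split an increment into a step in x at fixed y and then a step in y: continuity of
  \<open>gy\<close> makes the second step uniform, while the first uses the x-derivative at the
  point alone.\<close>

lemma partials_imp_has_derivative:
  assumes p: "partials_on g gx gy" and c: "continuous_on II gy" and m: "p \<in> II"
  shows "(g has_derivative (\<lambda>v. fst v *\<^sub>R gx p + snd v *\<^sub>R gy p)) (at p)"
proof -
  obtain x y where xy: "p = (x, y)" "x \<in> I" "y \<in> I" using m by auto
  have "((\<lambda>(x, y). g (x, y)) has_derivative
      (\<lambda>(tx, ty). tx *\<^sub>R gx (x, y) + blinfun_scaleR_left (gy (x, y)) ty)) (at (x, y) within II)"
  proof (rule has_derivative_partialsI)
    show "((\<lambda>s. g (s, y)) has_derivative (\<lambda>h. h *\<^sub>R gx (x, y))) (at x within I)"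
      using partials_onD(1)[OF p xy(2,3)] unfolding has_vector_derivative_def
      by (rule has_derivative_at_withinI)
    show "((\<lambda>s. g (u, s)) has_derivative blinfun_apply (blinfun_scaleR_left (gy (u, v)))) (at v within I)"
      if "u \<in> I" "v \<in> I" for u v
    proof -
      have "((\<lambda>s. g (u, s)) has_derivative (\<lambda>h. h *\<^sub>R gy (u, v))) (at v within I)"
        using partials_onD(2)[OF p that] unfolding has_vector_derivative_def
        by (rule has_derivative_at_withinI)
      moreover have "blinfun_apply (blinfun_scaleR_left (gy (u, v))) = (\<lambda>h. h *\<^sub>R gy (u, v))"
        by (rule ext) simp
      ultimately show ?thesis by simp
    qed
    have "continuous (at (x, y) within II) gy"
      using c m xy by (simp add: continuous_on_eq_continuous_within)
    then have "continuous (at (x, y) within II) (\<lambda>q. blinfun_scaleR_left (gy q))"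
      by (rule bounded_linear.continuous[OF bounded_linear_blinfun_scaleR_left])
    then show "continuous (at (x, y) within II) (\<lambda>(x, y). blinfun_scaleR_left (gy (x, y)))"
      by (simp add: case_prod_unfold)
  qed (use xy convex_I in auto)
  moreover have "at (x, y) within II = at (x, y)"
    using m xy(1) open_II by (intro at_within_open) auto
  ultimately show ?thesis unfolding xy(1) case_prod_unfold prod.collapse fst_conv snd_conv
    blinfun_scaleR_left.rep_eq by simp
qed

lemma Ck_on_partials:
  assumes "partials_on g gx gy" "Ck_on k gx II" "Ck_on k gy II"
  shows "Ck_on (Suc k) g II"
proof (rule Ck_on_SucI[OF open_II partials_imp_has_derivative[OF assms(1)]])
  show "continuous_on II gy" using assms(3) by (rule Ck_on_imp_continuous)
  show "Ck_on k (\<lambda>p. fst v *\<^sub>R gx p + snd v *\<^sub>R gy p) II" for v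
    by (intro Ck_on_add[OF open_II] Ck_on_linear[OF bounded_linear_scaleR_right open_II] assms)
qed

lemma Ck_on_Suc_imp_partials:
  assumes "Ck_on (Suc k) g II"
  shows "partials_on g (pdx g) (pdy g)" "Ck_on k (pdx g) II" "Ck_on k (pdy g) II"
    and "p \<in> II \<Longrightarrow> frechet_derivative g (at p) v = fst v *\<^sub>R pdx g p + snd v *\<^sub>R pdy g p"
proof -
  let ?D = "\<lambda>p. frechet_derivative g (at p)"
  have d: "partials_on g (\<lambda>p. ?D p (1, 0)) (\<lambda>p. ?D p (0, 1))"
    unfolding partials_on_def using has_derivative_imp_partials[OF Ck_on_SucD(1)[OF assms]] by auto
  note e = partials_on_pd[OF d]
  show pd: "partials_on g (pdx g) (pdy g)"
    using d e unfolding partials_on_def by simp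
  show "Ck_on k (pdx g) II" "Ck_on k (pdy g) II"
    using Ck_on_cong[OF open_II e(1)[symmetric] Ck_on_SucD(2)[OF assms]]
      Ck_on_cong[OF open_II e(2)[symmetric] Ck_on_SucD(2)[OF assms]] by auto
  then have "continuous_on II (pdy g)" by (auto intro: Ck_on_imp_continuous)
  from frechet_derivative_at[OF partials_imp_has_derivative[OF pd this], symmetric]
  show "?D p v = fst v *\<^sub>R pdx g p + snd v *\<^sub>R pdy g p" if "p \<in> II"
    using that by (simp del: frechet_derivative_at)
qed

text \<open>The antiderivative in y that vanishes on the diagonal: its base point is the
  x-coordinate. \<open>J2\<close> is the mirror image, an antiderivative in x.\<close>

definition J1 :: "(real \<times> real \<Rightarrow> 'b::banach) \<Rightarrow> real \<times> real \<Rightarrow> 'b" where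
  "J1 G p = prim (fst p) (\<lambda>s. G (fst p, s)) (snd p)"

definition J2 :: "(real \<times> real \<Rightarrow> 'b::banach) \<Rightarrow> real \<times> real \<Rightarrow> 'b" where
  "J2 G p = prim (snd p) (\<lambda>s. G (s, snd p)) (fst p)"

lemma J2_eq_J1: "J2 G p = J1 (\<lambda>q. G (prod.swap q)) (prod.swap p)"
  by (simp add: J1_def J2_def)

lemma bounded_linear_swap: "bounded_linear (prod.swap :: real \<times> real \<Rightarrow> real \<times> real)"
  unfolding prod.swap_def by (intro bounded_linear_Pair bounded_linear_snd bounded_linear_fst)

lemma continuous_on_J1:
  assumes G: "continuous_on II G"
  shows "continuous_on II (J1 G)"
proof -
  have "continuous_on (II \<times> I) (\<lambda>x. G (fst (fst x), snd x))"
    by (rule continuous_on_compose2[OF G]) (auto intro!: continuous_on_Pair continuous_on_fst continuous_on_snd continuous_on_id)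
  then have c: "continuous_on (II \<times> I) (\<lambda>(p, s). G (fst p, s))"
    by (simp add: case_prod_unfold)
  have "continuous_on II (\<lambda>p. prim (fst p) (\<lambda>s. G (fst p, s)) (snd p))"
    by (rule continuous_on_prim[OF c continuous_on_fst[OF continuous_on_id] _ continuous_on_snd[OF continuous_on_id]]) auto
  then show ?thesis by (simp add: J1_def[abs_def])
qed

text \<open>The base point of \<open>J1\<close> moves with x, which produces the boundary term
  G(x,x).\<close>

lemma partials_on_J1:
  fixes G :: "real \<times> real \<Rightarrow> 'b::banach"
  assumes G: "continuous_on II G" and Gx: "continuous_on II Gx"
    and d: "\<And>x y. x \<in> I \<Longrightarrow> y \<in> I \<Longrightarrow> ((\<lambda>s. G (s, y)) has_vector_derivative Gx (x, y)) (at x)"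
  shows "partials_on (J1 G) (\<lambda>p. J1 Gx p - G (fst p, fst p)) G"
  unfolding partials_on_def
proof (intro ballI conjI)
  fix x y assume x: "x \<in> I" and y: "y \<in> I"
  show "((\<lambda>s. J1 G (x, s)) has_vector_derivative G (x, y)) (at y)"
    unfolding J1_def using has_vector_derivative_prim[OF continuous_on_slices(2)[OF G x] x y] by simp
  \<comment> \<open>With the base point frozen at the given y, the two roles of x are separated into
    an upper limit and a parameter. Exchanging the limits gives J1 G (s,y) = - H(s,s), so the
    derivative is one along the diagonal of H.\<close>
  define H where "H = (\<lambda>p. prim y (\<lambda>s. G (fst p, s)) (snd p))"
  have H: "partials_on H (\<lambda>p. prim y (\<lambda>s. Gx (fst p, s)) (snd p)) G"
    unfolding partials_on_def H_def
  proof (intro ballI conjI)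
    fix u v assume u: "u \<in> I" and v: "v \<in> I"
    show "((\<lambda>s. prim y (\<lambda>r. G (fst (u, s), r)) (snd (u, s))) has_vector_derivative G (u, v)) (at v)"
      using has_vector_derivative_prim[OF continuous_on_slices(2)[OF G u] y v] by simp
    have "((\<lambda>u. prim y (\<lambda>s. G (u, s)) v) has_vector_derivative prim y (\<lambda>s. Gx (u, s)) v) (at u)"
      by (rule has_vector_derivative_prim_param) (use d continuous_on_slices(2)[OF G] Gx y u v in auto)
    then show "((\<lambda>s. prim y (\<lambda>sa. G (fst (s, v), sa)) (snd (s, v)))
        has_vector_derivative prim y (\<lambda>s. Gx (fst (u, v), s)) (snd (u, v))) (at u)" by simp
  qed
  have "((\<lambda>s. - H (s, s)) has_vector_derivative - (prim y (\<lambda>s. Gx (x, s)) x + G (x, x))) (at x)"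
    using has_vector_derivative_minus[OF
        has_derivative_imp_diagonal[OF partials_imp_has_derivative[OF H G, of "(x, x)"]]] x by simp
  moreover have "- (prim y (\<lambda>s. Gx (x, s)) x + G (x, x)) = J1 Gx (x, y) - G (x, x)"
    using prim_base_change[OF open_interval_axioms continuous_on_slices(2)[OF Gx x] y x y]
    by (simp add: J1_def)
  ultimately have "((\<lambda>s. - H (s, s)) has_vector_derivative J1 Gx (x, y) - G (x, x)) (at x)" by simp
  then have "((\<lambda>s. J1 G (s, y)) has_vector_derivative J1 Gx (x, y) - G (x, x)) (at x)"
  proof (rule has_vector_derivative_transform_within_open[OF _ open_I x])
    show "- H (s, s) = J1 G (s, y)" if "s \<in> I" for s
      using prim_base_change[OF open_interval_axioms continuous_on_slices(2)[OF G that] y that y]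
      by (simp add: J1_def H_def)
  qed
  then show "((\<lambda>s. J1 G (s, y)) has_vector_derivative J1 Gx (x, y) - G (fst (x, y), fst (x, y))) (at x)"
    by simp
qed

lemma continuous_on_swap: "continuous_on II G \<Longrightarrow> continuous_on II (\<lambda>q. G (prod.swap q))"
  by (erule continuous_on_compose2) (auto intro!: linear_continuous_on bounded_linear_swap)

lemma continuous_on_J2: "continuous_on II G \<Longrightarrow> continuous_on II (J2 G)"
  using continuous_on_swap[OF continuous_on_J1[OF continuous_on_swap]]
  unfolding J2_eq_J1[abs_def] by auto

lemma partials_on_J2:
  fixes G :: "real \<times> real \<Rightarrow> 'b::banach"
  assumes G: "continuous_on II G" and Gy: "continuous_on II Gy"
    and d: "\<And>x y. x \<in> I \<Longrightarrow> y \<in> I \<Longrightarrow> ((\<lambda>s. G (x, s)) has_vector_derivative Gy (x, y)) (at y)"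
  shows "partials_on (J2 G) G (\<lambda>p. J2 Gy p - G (snd p, snd p))"
  using partials_on_J1[OF continuous_on_swap[OF G] continuous_on_swap[OF Gy]] d
  unfolding partials_on_def J2_eq_J1 by simp

text \<open>The x-derivative of \<open>J1 G\<close> is again a \<open>J1\<close>, of the
  x-derivative of G, up to the trace of G on the diagonal; the y-derivative is G itself. So
  induction on the order closes.\<close>

lemma Ck_on_J1: "Ck_on k G II \<Longrightarrow> Ck_on k (J1 G) II"
proof (induction k arbitrary: G)
  case 0
  then show ?case by (simp add: continuous_on_J1)
next
  case (Suc k)
  note P = Ck_on_Suc_imp_partials[OF Suc.prems]
  have lin: "bounded_linear (\<lambda>p::real \<times> real. (fst p, fst p))"
    by (intro bounded_linear_Pair bounded_linear_fst)
  show ?case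
  proof (rule Ck_on_partials[OF partials_on_J1])
    show "continuous_on II G" "continuous_on II (pdx G)"
      using Suc.prems P(2) by (auto intro: Ck_on_imp_continuous simp del: Ck_on.simps)
    show "Ck_on k (\<lambda>p. J1 (pdx G) p - G (fst p, fst p)) II"
      by (rule Ck_on_diff[OF open_II Suc.IH[OF P(2)] Ck_on_compose_linear[OF lin open_II]])
         (use Ck_on_Suc_imp[OF Suc.prems] in auto)
    show "Ck_on k G II" using Suc.prems by (rule Ck_on_Suc_imp)
  qed (use partials_onD[OF P(1)] in auto)
qed

lemma Ck_on_J2:
  assumes "Ck_on k G II"
  shows "Ck_on k (J2 G) II"
proof -
  have s: "Ck_on k (\<lambda>q. F (prod.swap q)) II" if "Ck_on k F II" for F :: "real \<times> real \<Rightarrow> 'a"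
    by (rule Ck_on_compose_linear[OF bounded_linear_swap open_II _ that]) auto
  show ?thesis unfolding J2_eq_J1[abs_def] using s[OF Ck_on_J1[OF s[OF assms]]] .
qed

end

section \<open>Volterra fixed points\<close>

text \<open>
  The weight \<open>r\<close> plays the role of the distance to the initial set: each application of \<open>\<Phi>\<close> gains
  one power of \<open>r\<close> and a factor \<open>1/n\<close>, so that the Picard iterates converge locally uniformly
  without any smallness assumption.
\<close>

lemma volterra_fixpoint:
  fixes \<Phi> :: "('d::t2_space \<Rightarrow> 'b::banach) \<Rightarrow> 'd \<Rightarrow> 'b" and r :: "'d \<Rightarrow> real"
  assumes cont: "\<And>u. continuous_on D u \<Longrightarrow> continuous_on D (\<Phi> u)"
    and r: "continuous_on D r" "\<And>p. p \<in> D \<Longrightarrow> 0 \<le> r p"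
    and loc: "\<And>p. p \<in> D \<Longrightarrow> \<exists>U K L. open U \<and> p \<in> U \<and> U \<inter> D \<subseteq> K \<and> K \<subseteq> D \<and> compact K \<and> 0 \<le> L \<and>
      (\<forall>u v C n. continuous_on D u \<longrightarrow> continuous_on D v \<longrightarrow> 0 \<le> C \<longrightarrow>
         (\<forall>q\<in>K. norm (u q - v q) \<le> C * r q ^ n) \<longrightarrow>
         (\<forall>q\<in>K. norm (\<Phi> u q - \<Phi> v q) \<le> L * C * r q ^ Suc n / Suc n))"
  obtains u where "continuous_on D u" "\<And>p. p \<in> D \<Longrightarrow> \<Phi> u p = u p"
proof -
  define w where "w n = (\<Phi> ^^ n) (\<lambda>_. 0)" for n
  have cw: "continuous_on D (w n)" for n
    by (induction n) (auto simp: w_def intro: cont)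
  have wS: "w (Suc n) = \<Phi> (w n)" for n by (simp add: w_def)
  \<comment> \<open>The limit of the iterates as a telescoping series, in reach of the Weierstrass
    test; this uses that \<open>w 0\<close> is zero.\<close>
  define W where "W q = (\<Sum>i. w (Suc i) q - w i q)" for q
  have unif: "\<exists>U K L R. open U \<and> p \<in> U \<and> U \<inter> D \<subseteq> K \<and> K \<subseteq> D \<and> 0 \<le> L \<and> (\<forall>q\<in>K. r q \<le> R) \<and>
      (\<forall>u v C n. continuous_on D u \<longrightarrow> continuous_on D v \<longrightarrow> 0 \<le> C \<longrightarrow>
         (\<forall>q\<in>K. norm (u q - v q) \<le> C * r q ^ n) \<longrightarrow>
         (\<forall>q\<in>K. norm (\<Phi> u q - \<Phi> v q) \<le> L * C * r q ^ Suc n / Suc n)) \<and>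
      uniform_limit K w W sequentially" if p: "p \<in> D" for p
  proof -
    obtain U K L where UKL: "open U" "p \<in> U" "U \<inter> D \<subseteq> K" "K \<subseteq> D" "compact K" "0 \<le> L"
      and step: "\<And>u v C n q. continuous_on D u \<Longrightarrow> continuous_on D v \<Longrightarrow> 0 \<le> C \<Longrightarrow>
         (\<And>q. q \<in> K \<Longrightarrow> norm (u q - v q) \<le> C * r q ^ n) \<Longrightarrow> q \<in> K \<Longrightarrow>
         norm (\<Phi> u q - \<Phi> v q) \<le> L * C * r q ^ Suc n / Suc n"
      using loc[OF p] by metis
    have bd: "\<exists>B\<ge>0. \<forall>q\<in>K. norm (g q) \<le> B" if g: "continuous_on D g" for g :: "'d \<Rightarrow> 'x::real_normed_vector"
    proof -
      have "bounded (g ` K)"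
        using compact_imp_bounded[OF compact_continuous_image[OF continuous_on_subset[OF g UKL(4)] UKL(5)]] .
      then obtain B where "\<forall>q\<in>K. norm (g q) \<le> B" by (auto simp: bounded_iff)
      then show ?thesis by (intro exI[of _ "max B 0"]) (meson max.cobounded1 max.cobounded2 order_trans)
    qed
    obtain R where R: "R \<ge> 0" "\<And>q. q \<in> K \<Longrightarrow> r q \<le> R"
      using bd[OF r(1)] by (metis abs_ge_self order_trans real_norm_def)
    obtain C0 where C0: "C0 \<ge> 0" "\<And>q. q \<in> K \<Longrightarrow> norm (w 1 q - w 0 q) \<le> C0"
      using bd[OF continuous_on_diff[OF cw[of 1] cw[of 0]]] by blast
    \<comment> \<open>The gain hypothesis is applied to consecutive iterates: the factors L / (n +
      1) multiply up to L^n / n!, and \<open>C0\<close> bounds the first step.\<close>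
    have est: "norm (w (Suc n) q - w n q) \<le> C0 * L ^ n / fact n * r q ^ n" if "q \<in> K" for n q
      using that
    proof (induction n arbitrary: q)
      case 0
      then show ?case using C0(2)[of q] by simp
    next
      case (Suc n)
      have "norm (w (Suc (Suc n)) q - w (Suc n) q) \<le> L * (C0 * L ^ n / fact n) * r q ^ Suc n / Suc n"
        using step[OF cw cw _ Suc.IH Suc.prems] C0(1) UKL(6) by (simp add: wS)
      also have "\<dots> = C0 * L ^ Suc n / fact (Suc n) * r q ^ Suc n"
        by (simp add: field_simps)
      finally show ?case .
    qed
    have est': "norm (w (Suc n) q - w n q) \<le> C0 * ((L * R) ^ n / fact n)" if q: "q \<in> K" for n q
    proof -
      have "C0 * L ^ n / fact n * r q ^ n \<le> C0 * L ^ n / fact n * R ^ n"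
        using C0(1) UKL(4,6) R(2)[OF q] r(2)[of q] q by (intro mult_left_mono power_mono) auto
      then show ?thesis using est[OF q, of n] by (simp add: power_mult_distrib)
    qed
    have "summable (\<lambda>n. C0 * ((L * R) ^ n / fact n))"
      using summable_exp[of "L * R"] by (intro summable_mult) (simp add: field_simps)
    then have "uniform_limit K (\<lambda>n q. \<Sum>i<n. w (Suc i) q - w i q) (\<lambda>q. \<Sum>i. w (Suc i) q - w i q) sequentially"
      by (intro Weierstrass_m_test[where f = "\<lambda>i q. w (Suc i) q - w i q"]) (simp_all only: est')
    moreover have "(\<lambda>n q. \<Sum>i<n. w (Suc i) q - w i q) = w"
      by (intro ext) (subst sum_lessThan_telescope, simp add: w_def)
    ultimately have "uniform_limit K w W sequentially" by (simp add: W_def[abs_def])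
    with UKL R step show ?thesis by (metis (no_types, lifting))
  qed
  have cW: "continuous_on D W"
    unfolding continuous_on_eq_continuous_within
  proof
    fix p assume p: "p \<in> D"
    obtain U K where UK: "open U" "p \<in> U" "U \<inter> D \<subseteq> K" "K \<subseteq> D" "uniform_limit K w W sequentially"
      using unif[OF p] by metis
    have "continuous_on K W"
      by (rule uniform_limit_theorem[OF _ UK(5)])
         (auto intro!: always_eventually continuous_on_subset[OF cw UK(4)])
    then have "continuous (at p within U \<inter> D) W"
      using UK p by (meson IntI continuous_on_eq_continuous_within continuous_on_subset)
    moreover have "at p within U \<inter> D = at p within D"
      by (rule at_within_nhd[OF UK(2,1)]) auto
    ultimately show "continuous (at p within D) W" by simp
  qed
  have "\<Phi> W p = W p" if p: "p \<in> D" for p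
  proof -
    obtain U K L R where UK: "open U" "p \<in> U" "U \<inter> D \<subseteq> K" "K \<subseteq> D" "0 \<le> L" "\<And>q. q \<in> K \<Longrightarrow> r q \<le> R"
      and step: "\<And>u v C n q. continuous_on D u \<Longrightarrow> continuous_on D v \<Longrightarrow> 0 \<le> C \<Longrightarrow>
         (\<And>q. q \<in> K \<Longrightarrow> norm (u q - v q) \<le> C * r q ^ n) \<Longrightarrow> q \<in> K \<Longrightarrow>
         norm (\<Phi> u q - \<Phi> v q) \<le> L * C * r q ^ Suc n / Suc n"
      and ul: "uniform_limit K w W sequentially"
      using unif[OF p] by metis
    have pK: "p \<in> K" using UK p by auto
    \<comment> \<open>The gain hypothesis with exponent 0 turns uniform closeness of
      \<open>w n\<close> to W on K into closeness of their images at p.\<close>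
    have "(\<lambda>n. w (Suc n) p) \<longlonglongrightarrow> \<Phi> W p"
    proof (rule tendstoI)
      fix e :: real assume e: "0 < e"
      have R0: "0 \<le> R" using UK(6)[OF pK] r(2)[OF p] by linarith
      \<comment> \<open>The summand 1 keeps the denominator positive when L * R = 0 and makes L * d
        * R strictly smaller than e.\<close>
      define d where "d = e / (L * R + 1)"
      have pos: "0 < L * R + 1" using UK(5) R0 by (simp add: add_nonneg_pos)
      then have d: "d > 0" using e by (simp add: d_def)
      have "\<forall>\<^sub>F n in sequentially. \<forall>q\<in>K. dist (w n q) (W q) < d"
        using ul d by (auto simp: uniform_limit_iff)
      then show "\<forall>\<^sub>F n in sequentially. dist (w (Suc n) p) (\<Phi> W p) < e"
      proof eventually_elim
        case (elim n)
        have "norm (\<Phi> (w n) p - \<Phi> W p) \<le> L * d * r p ^ Suc 0 / Suc 0"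
          using d elim by (intro step[OF cw cW]) (auto simp: dist_norm pK less_imp_le)
        also have "\<dots> \<le> L * d * R"
          using UK(5) UK(6)[OF pK] d by (simp add: mult_left_mono)
        also have "\<dots> < e"
        proof -
          have "L * d * R = (L * R) * d" by simp
          also have "\<dots> < (L * R + 1) * d" using d by (simp add: algebra_simps)
          also have "\<dots> = e" using pos by (simp add: d_def)
          finally show ?thesis .
        qed
        finally show ?case by (simp add: wS dist_norm)
      qed
    qed
    moreover have "(\<lambda>n. w (Suc n) p) \<longlonglongrightarrow> W p"
      using tendsto_uniform_limitI[OF ul pK] by (rule LIMSEQ_Suc)
    ultimately show ?thesis by (rule LIMSEQ_unique)
  qed
  with cW show thesis by (rule that)
qed

section \<open>Two by two matrices\<close>

lemma mat2_eq_iff: "A = B \<longleftrightarrow> A $ 1 $ 1 = B $ 1 $ 1 \<and> A $ 1 $ 2 = B $ 1 $ 2 \<and> A $ 2 $ 1 = B $ 2 $ 1 \<and> A $ 2 $ 2 = B $ 2 $ 2"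
  for A B :: "'a^2^2"
  by (auto simp: vec_eq_iff forall_2)

lemma matmul2_nth: "(A ** B) $ i $ j = A $ i $ 1 * B $ 1 $ j + A $ i $ 2 * B $ 2 $ j"
  for A B :: cmat2
  by (simp add: matrix_matrix_mult_def sum_2)

lemma mat_1_nth2: "(mat 1 :: cmat2) $ 1 $ 1 = 1" "(mat 1 :: cmat2) $ 1 $ 2 = 0"
  "(mat 1 :: cmat2) $ 2 $ 1 = 0" "(mat 1 :: cmat2) $ 2 $ 2 = 1"
  by (simp_all add: mat_def)

lemma cscale_nth [simp]: "(z *\<^sub>C A) $ i $ j = z * A $ i $ j"
  by (simp add: cscale_def)

text \<open>The adjugate is the inverse on SL(2), but it is linear in the matrix, so inverses of
  frames can be differentiated without a quotient rule.\<close>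

definition adj2 :: "cmat2 \<Rightarrow> cmat2" where
  "adj2 A = vector [vector [A $ 2 $ 2, - A $ 1 $ 2], vector [- A $ 2 $ 1, A $ 1 $ 1]]"

lemma adj2_nth [simp]: "adj2 A $ 1 $ 1 = A $ 2 $ 2" "adj2 A $ 1 $ 2 = - A $ 1 $ 2"
  "adj2 A $ 2 $ 1 = - A $ 2 $ 1" "adj2 A $ 2 $ 2 = A $ 1 $ 1"
  by (simp_all add: adj2_def)

lemmas mat2_simps = mat2_eq_iff matmul2_nth mat_1_nth2

lemma bounded_bilinear_matmul: "bounded_bilinear ((**) :: cmat2 \<Rightarrow> cmat2 \<Rightarrow> cmat2)"
  unfolding bilinear_conv_bounded_bilinear[symmetric] bilinear_def
  by (auto intro!: linearI simp: mat2_simps algebra_simps)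

lemma bounded_bilinear_cscale: "bounded_bilinear ((*\<^sub>C))"
  unfolding bilinear_conv_bounded_bilinear[symmetric] bilinear_def
  by (auto intro!: linearI simp: mat2_simps algebra_simps)

lemma bounded_linear_adj2: "bounded_linear adj2"
  by (auto intro!: linearI simp: mat2_simps simp flip: linear_conv_bounded_linear)

lemmas bounded_linear_matmul_left = bounded_bilinear.bounded_linear_left[OF bounded_bilinear_matmul]
lemmas bounded_linear_matmul_right = bounded_bilinear.bounded_linear_right[OF bounded_bilinear_matmul]

lemmas continuous_on_matmul = bounded_bilinear.continuous_on[OF bounded_bilinear_matmul]
lemmas continuous_on_cscale = bounded_bilinear.continuous_on[OF bounded_bilinear_cscale]
lemmas continuous_on_adj2 = bounded_linear.continuous_on[OF bounded_linear_adj2]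
lemmas has_vector_derivative_matmul =
  bounded_bilinear.has_vector_derivative[OF bounded_bilinear_matmul]
lemmas has_vector_derivative_adj2 =
  bounded_linear.has_vector_derivative[OF bounded_linear_adj2]
lemmas matmul_diff_left = bounded_bilinear.diff_left[OF bounded_bilinear_matmul]
lemmas matmul_diff_right = bounded_bilinear.diff_right[OF bounded_bilinear_matmul]

lemmas matmul_minus_left = bounded_bilinear.minus_left[OF bounded_bilinear_matmul]
lemmas matmul_minus_right = bounded_bilinear.minus_right[OF bounded_bilinear_matmul]
lemmas matmul_zero_left = bounded_bilinear.zero_left[OF bounded_bilinear_matmul]
lemmas matmul_zero_right = bounded_bilinear.zero_right[OF bounded_bilinear_matmul]

lemma adj2_matmul: "adj2 (A ** B) = adj2 B ** adj2 A"
  by (simp add: mat2_simps algebra_simps)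

lemma adj2_traceless: "trace A = 0 \<Longrightarrow> adj2 A = - A"
  by (auto simp: mat2_simps trace_def sum_2 add_eq_0_iff)

lemma adj2_mat_1 [simp]: "adj2 (mat 1) = mat 1"
  by (simp add: mat2_simps)

lemma matmul_adj2: "A ** adj2 A = det A *\<^sub>C mat 1" "adj2 A ** A = det A *\<^sub>C mat 1"
  by (simp_all add: mat2_simps det_2 algebra_simps)

lemma cscale_1 [simp]: "1 *\<^sub>C A = A"
  by (simp add: mat2_simps)

lemma cscale_matmul: "(z *\<^sub>C A) ** B = z *\<^sub>C (A ** B)" "A ** (z *\<^sub>C B) = z *\<^sub>C (A ** B)"
  by (simp_all add: mat2_simps algebra_simps)

lemma adj2_inverse: "det A = 1 \<Longrightarrow> A ** adj2 A = mat 1" "det A = 1 \<Longrightarrow> adj2 A ** A = mat 1"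
  by (simp_all add: matmul_adj2)

lemma det_adj2 [simp]: "det (adj2 A) = det A"
  by (simp add: det_2)

lemma matrix_inv_eq_adj2: "det A = 1 \<Longrightarrow> matrix_inv A = adj2 A"
  unfolding matrix_inv_def
  by (rule some_equality) (metis adj2_inverse matrix_mul_assoc matrix_mul_lid matrix_mul_rid)+

section \<open>Linear differential equations for matrices\<close>

context open_interval
begin

definition fundamental :: "real \<Rightarrow> (real \<Rightarrow> cmat2) \<Rightarrow> (real \<Rightarrow> cmat2) \<Rightarrow> bool" where
  "fundamental t0 A Y \<longleftrightarrow> Y t0 = mat 1 \<and> (\<forall>t\<in>I. (Y has_vector_derivative Y t ** A t) (at t))"

lemma fundamental_continuous: "fundamental t0 A Y \<Longrightarrow> continuous_on I Y"
  unfolding fundamental_def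
  by (intro continuous_at_imp_continuous_on ballI has_vector_derivative_continuous) auto

text \<open>The parameter p is part of the point at which the fixed point is evaluated. Solving for
  all parameters at once gives joint continuity in p and t directly.\<close>

lemma fundamental_exists:
  fixes A :: "'p::euclidean_space \<Rightarrow> real \<Rightarrow> cmat2"
  assumes P: "open P" and A: "continuous_on (P \<times> I) (\<lambda>(p, s). A p s)" and t0: "t0 \<in> I"
  obtains Y where "continuous_on (P \<times> I) (\<lambda>(p, s). Y p s)" "\<And>p. p \<in> P \<Longrightarrow> fundamental t0 (A p) (Y p)"
proof -
  define \<Phi> where "\<Phi> u q = mat 1 + prim t0 (\<lambda>s. u (fst q, s) ** A (fst q) s) (snd q)" for u :: "'p \<times> real \<Rightarrow> cmat2" and q
  let ?D = "P \<times> I"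
  have cA: "continuous_on I (A p)" if "p \<in> P" for p
  proof -
    have "continuous_on I (\<lambda>s. case (p, s) of (p, s) \<Rightarrow> A p s)"
      by (rule continuous_on_compose2[OF A]) (use that in \<open>auto intro!: continuous_intros\<close>)
    then show ?thesis by simp
  qed
  have cu: "continuous_on I (\<lambda>s. u (p, s))" if "continuous_on ?D u" "p \<in> P" for u p
    by (rule continuous_on_compose2[OF that(1)]) (use that(2) in \<open>auto intro!: continuous_intros\<close>)
  have cuA: "continuous_on I (\<lambda>s. u (p, s) ** A p s)" if "continuous_on ?D u" "p \<in> P" for u :: "'p \<times> real \<Rightarrow> cmat2" and p
    using cu[OF that] cA[OF that(2)] by (rule continuous_on_matmul)
  \<comment> \<open>The norm is used only through a bound \<kappa> of the bilinear matrix product,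
    so no submultiplicativity is required.\<close>
  obtain \<kappa> where \<kappa>: "0 \<le> \<kappa>" "\<And>(X :: cmat2) (Y :: cmat2). norm (X ** Y) \<le> norm X * norm Y * \<kappa>"
    using bounded_bilinear.nonneg_bounded[OF bounded_bilinear_matmul] by metis
  obtain u where u: "continuous_on ?D u" "\<And>q. q \<in> ?D \<Longrightarrow> \<Phi> u q = u q"
  proof (rule volterra_fixpoint[of ?D \<Phi> "\<lambda>q. \<bar>snd q - t0\<bar>"])
    fix u :: "'p \<times> real \<Rightarrow> cmat2" assume u: "continuous_on ?D u"
    have "continuous_on (?D \<times> I) (\<lambda>x. u (fst (fst x), snd x) ** (case (fst (fst x), snd x) of (p, s) \<Rightarrow> A p s))"
      by (rule continuous_on_matmul;
          rule continuous_on_compose2[OF u] continuous_on_compose2[OF A])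
         (auto intro!: continuous_on_Pair continuous_on_fst continuous_on_snd continuous_on_id)
    then have c: "continuous_on (?D \<times> I) (\<lambda>(q, s). u (fst q, s) ** A (fst q) s)"
      by (simp add: case_prod_unfold)
    have "continuous_on ?D (\<lambda>q. prim t0 (\<lambda>s. u (fst q, s) ** A (fst q) s) (snd q))"
      by (rule continuous_on_prim[OF c continuous_on_const _ continuous_on_snd[OF continuous_on_id]])
         (use t0 in auto)
    then show "continuous_on ?D (\<Phi> u)"
      unfolding \<Phi>_def[abs_def] by (intro continuous_on_add continuous_on_const)
  next
    show "continuous_on ?D (\<lambda>q. \<bar>snd q - t0\<bar>)"
      by (intro continuous_intros)
  next
    fix q assume q: "q \<in> ?D"
    obtain p t where pt: "q = (p, t)" "p \<in> P" "t \<in> I" using q by auto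
    obtain e where e: "0 < e" "cball p e \<subseteq> P" using P pt(2) open_contains_cball by blast
    obtain a b where ab: "a \<in> I" "b \<in> I" "a < t0" "a < t" "t0 < b" "t < b"
      using obtain_enclosing[OF t0 pt(3)] by blast
    \<comment> \<open>The interval {a..b} contains t0, so every segment of integration stays in K
      and the estimate on K closes on itself.\<close>
    define K where "K = cball p e \<times> {a..b}"
    have KD: "K \<subseteq> ?D" using e(2) ivl_subset[OF ab(1,2)] by (auto simp: K_def)
    have cK: "compact K" by (simp add: K_def compact_Times)
    have "bounded ((\<lambda>(p, s). A p s) ` K)"
      using compact_imp_bounded[OF compact_continuous_image[OF continuous_on_subset[OF A KD] cK]] .
    then obtain M where M: "0 < M" "\<And>p s. (p, s) \<in> K \<Longrightarrow> norm (A p s) \<le> M"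
      by (force simp: bounded_pos)
    have "norm (\<Phi> u q' - \<Phi> v q') \<le> M * \<kappa> * C * \<bar>snd q' - t0\<bar> ^ Suc n / Suc n"
      if uv: "continuous_on ?D u" "continuous_on ?D v" "0 \<le> C" "\<forall>q\<in>K. norm (u q - v q) \<le> C * \<bar>snd q - t0\<bar> ^ n"
        and q': "q' \<in> K" for u v C n q'
    proof -
      obtain p' t' where pt': "q' = (p', t')" "p' \<in> P" "t' \<in> I" "a \<le> t'" "t' \<le> b" "p' \<in> cball p e"
        using q' KD by (auto simp: K_def)
      have "\<Phi> u q' - \<Phi> v q' = prim t0 (\<lambda>s. u (p', s) ** A p' s - v (p', s) ** A p' s) t'"
        using prim_diff[OF cuA[OF uv(1) pt'(2)] cuA[OF uv(2) pt'(2)] t0 pt'(3)] by (simp add: \<Phi>_def pt'(1))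
      moreover have "norm (prim t0 (\<lambda>s. u (p', s) ** A p' s - v (p', s) ** A p' s) t')
          \<le> (M * \<kappa> * C) * \<bar>t' - t0\<bar> ^ Suc n / Suc n"
      proof (rule norm_prim_le_power[OF _ t0 pt'(3)])
        show "continuous_on I (\<lambda>s. u (p', s) ** A p' s - v (p', s) ** A p' s)"
          by (intro continuous_on_diff cuA uv pt')
        fix s assume s: "s \<in> closed_segment t0 t'"
        have "a \<le> s" "s \<le> b"
          using s ab pt'(4,5) by (auto simp: closed_segment_eq_real_ivl split: if_splits)
        then have sK: "(p', s) \<in> K" using pt'(6) by (simp add: K_def)
        have "norm (u (p', s) ** A p' s - v (p', s) ** A p' s) \<le> norm (u (p', s) - v (p', s)) * norm (A p' s) * \<kappa>"
          unfolding matmul_diff_left[symmetric] by (rule \<kappa>(2))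
        also have "\<dots> \<le> (C * \<bar>s - t0\<bar> ^ n) * M * \<kappa>"
          using uv(3,4) sK M \<kappa>(1) by (intro mult_right_mono mult_mono) force+
        finally show "norm (u (p', s) ** A p' s - v (p', s) ** A p' s) \<le> M * \<kappa> * C * \<bar>s - t0\<bar> ^ n"
          by (simp add: mult_ac)
      qed
      ultimately show ?thesis using pt'(1) by simp
    qed
    then show "\<exists>U K L. open U \<and> q \<in> U \<and> U \<inter> ?D \<subseteq> K \<and> K \<subseteq> ?D \<and> compact K \<and> 0 \<le> L \<and>
      (\<forall>u v C n. continuous_on ?D u \<longrightarrow> continuous_on ?D v \<longrightarrow> 0 \<le> C \<longrightarrow>
         (\<forall>q\<in>K. norm (u q - v q) \<le> C * \<bar>snd q - t0\<bar> ^ n) \<longrightarrow>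
         (\<forall>q\<in>K. norm (\<Phi> u q - \<Phi> v q) \<le> L * C * \<bar>snd q - t0\<bar> ^ Suc n / Suc n))"
      using KD cK M(1) \<kappa>(1) e(1) ab pt
      by (intro exI[of _ "ball p e \<times> {a<..<b}"] exI[of _ K] exI[of _ "M * \<kappa>"] conjI open_Times)
         (auto simp: K_def)
  qed auto
  have "fundamental t0 (A p) (\<lambda>s. u (p, s))" if p: "p \<in> P" for p
    unfolding fundamental_def
  proof (intro conjI ballI)
    show "u (p, t0) = mat 1" using u(2)[of "(p, t0)"] p t0 by (simp add: \<Phi>_def)
    fix t assume t: "t \<in> I"
    have "((\<lambda>t. \<Phi> u (p, t)) has_vector_derivative u (p, t) ** A p t) (at t)"
      using has_vector_derivative_add[OF has_vector_derivative_const has_vector_derivative_prim[OF cuA[OF u(1) p] t0 t]]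
      by (simp add: \<Phi>_def)
    then show "((\<lambda>s. u (p, s)) has_vector_derivative u (p, t) ** A p t) (at t)"
      by (rule has_vector_derivative_transform_within_open[OF _ open_I t]) (use u(2) p in auto)
  qed
  then show thesis using that[of "\<lambda>p s. u (p, s)"] u(1) by (simp add: case_prod_unfold)
qed

text \<open>In place of Liouville's formula: Y adj(Y) = det(Y) I has derivative Y (A + adj(A))
  adj(Y), which vanishes for traceless A.\<close>

lemma fundamental_det:
  assumes Y: "fundamental t0 A Y" and tr: "\<And>t. t \<in> I \<Longrightarrow> trace (A t) = 0" and t0: "t0 \<in> I" and t: "t \<in> I"
  shows "det (Y t) = 1"
proof -
  have "Y t ** adj2 (Y t) = Y t0 ** adj2 (Y t0)"
  proof (rule constant_on_I[of "\<lambda>t. Y t ** adj2 (Y t)", OF _ t0 t])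
    fix s assume s: "s \<in> I"
    have d: "(Y has_vector_derivative Y s ** A s) (at s)" using Y s by (simp add: fundamental_def)
    have "((\<lambda>t. Y t ** adj2 (Y t)) has_vector_derivative Y s ** adj2 (Y s ** A s) + (Y s ** A s) ** adj2 (Y s)) (at s)"
      using has_vector_derivative_matmul[OF d has_vector_derivative_adj2[OF d]] .
    moreover have "Y s ** adj2 (Y s ** A s) + (Y s ** A s) ** adj2 (Y s) = 0"
      unfolding adj2_matmul adj2_traceless[OF tr[OF s]]
      by (simp add: matmul_minus_left matmul_minus_right matrix_mul_assoc)
    ultimately show "((\<lambda>t. Y t ** adj2 (Y t)) has_vector_derivative 0) (at s)" by simp
  qed
  then have "Y t ** adj2 (Y t) = mat 1" using Y by (simp add: fundamental_def)
  then show ?thesis unfolding matmul_adj2 by (simp add: mat2_simps)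
qed

lemma fundamental_adj2_deriv:
  assumes "fundamental t0 A Y" "\<And>t. t \<in> I \<Longrightarrow> trace (A t) = 0" "t \<in> I"
  shows "((\<lambda>t. adj2 (Y t)) has_vector_derivative - (A t ** adj2 (Y t))) (at t)"
proof -
  have "(Y has_vector_derivative Y t ** A t) (at t)" using assms by (simp add: fundamental_def)
  from has_vector_derivative_adj2[OF this] show ?thesis
    using adj2_traceless[OF assms(2)[OF assms(3)]] unfolding adj2_matmul
    by (simp add: matmul_minus_left)
qed

text \<open>Variation of constants: Z times the inverse of Y has derivative Z (B - A) times the
  inverse of Y.\<close>

lemma fundamental_quotient:
  fixes Z :: "real \<Rightarrow> cmat2"
  assumes Y: "fundamental t0 A Y" and tr: "\<And>t. t \<in> I \<Longrightarrow> trace (A t) = 0"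
    and cA: "continuous_on I A" "continuous_on I B" and t0: "t0 \<in> I" and t: "t \<in> I"
    and Z: "\<And>t. t \<in> I \<Longrightarrow> (Z has_vector_derivative Z t ** B t) (at t)"
  shows "Z t ** adj2 (Y t) - Z t0 = prim t0 (\<lambda>s. Z s ** (B s - A s) ** adj2 (Y s)) t"
proof -
  have cZ: "continuous_on I Z"
    using Z by (intro continuous_at_imp_continuous_on ballI has_vector_derivative_continuous) auto
  have "prim t0 (\<lambda>s. Z s ** (B s - A s) ** adj2 (Y s)) t = Z t ** adj2 (Y t) - Z t0 ** adj2 (Y t0)"
  proof (rule prim_eq_increment[of "\<lambda>t. Z t ** adj2 (Y t)", OF _ _ t0 t])
    show "continuous_on I (\<lambda>s. Z s ** (B s - A s) ** adj2 (Y s))"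
      by (intro continuous_on_matmul continuous_on_adj2 continuous_on_diff cA cZ fundamental_continuous[OF Y])
    fix s assume s: "s \<in> I"
    have "((\<lambda>t. Z t ** adj2 (Y t)) has_vector_derivative Z s ** - (A s ** adj2 (Y s)) + (Z s ** B s) ** adj2 (Y s)) (at s)"
      by (rule has_vector_derivative_matmul[OF Z[OF s] fundamental_adj2_deriv[OF Y tr s]])
    moreover have "Z s ** - (A s ** adj2 (Y s)) + (Z s ** B s) ** adj2 (Y s) = Z s ** (B s - A s) ** adj2 (Y s)"
      by (simp add: matmul_minus_left matmul_minus_right matmul_diff_left matmul_diff_right matrix_mul_assoc)
    ultimately show "((\<lambda>t. Z t ** adj2 (Y t)) has_vector_derivative Z s ** (B s - A s) ** adj2 (Y s)) (at s)"
      by simp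
  qed
  moreover have "Z t0 ** adj2 (Y t0) = Z t0" using Y by (simp add: fundamental_def)
  ultimately show ?thesis by simp
qed

text \<open>The case of equal coefficients in the quotient formula: Z times the inverse of Y is
  constant.\<close>

lemma fundamental_unique:
  fixes Z :: "real \<Rightarrow> cmat2"
  assumes Y: "fundamental t0 A Y" and tr: "\<And>t. t \<in> I \<Longrightarrow> trace (A t) = 0"
    and cA: "continuous_on I A" and t0: "t0 \<in> I" and t: "t \<in> I"
    and Z: "\<And>t. t \<in> I \<Longrightarrow> (Z has_vector_derivative Z t ** A t) (at t)"
  shows "Z t = Z t0 ** Y t"
proof -
  have "prim t0 (\<lambda>s. Z s ** (A s - A s) ** adj2 (Y s)) t = 0"
    using prim_eq_increment[of "\<lambda>_. 0::cmat2" "\<lambda>_. 0" t0 t, OF has_vector_derivative_const continuous_on_const t0 t]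
    by (simp add: matmul_zero_left matmul_zero_right)
  then have "Z t ** adj2 (Y t) = Z t0"
    using fundamental_quotient[OF Y tr cA cA t0 t Z] by simp
  then have "Z t ** (adj2 (Y t) ** Y t) = Z t0 ** Y t"
    by (metis matrix_mul_assoc)
  then show ?thesis by (simp add: adj2_inverse fundamental_det[OF Y tr t0 t])
qed

end

section \<open>The angle equation\<close>

lemma norm_diff_fst: "norm (fst a - fst b) \<le> norm (a - b)"
  and norm_diff_snd: "norm (snd a - snd b) \<le> norm (a - b)"
  by (metis norm_fst_le prod.collapse fst_diff, metis norm_snd_le prod.collapse snd_diff)

context open_interval
begin

lemma partials_on_cong:
  assumes g: "partials_on g gx gy" and "\<And>p. p \<in> II \<Longrightarrow> g p = h p"
    and "\<And>p. p \<in> II \<Longrightarrow> gx p = hx p" and "\<And>p. p \<in> II \<Longrightarrow> gy p = hy p"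
  shows "partials_on h hx hy"
  unfolding partials_on_def
proof (intro ballI conjI)
  fix x y assume xy: "x \<in> I" "y \<in> I"
  then have e: "gx (x, y) = hx (x, y)" "gy (x, y) = hy (x, y)" using assms(3,4) by auto
  show "((\<lambda>s. h (s, y)) has_vector_derivative hx (x, y)) (at x)"
    by (rule has_vector_derivative_transform_within_open[OF partials_onD(1)[OF g xy, unfolded e] open_I xy(1)])
       (use assms(2) xy in auto)
  show "((\<lambda>s. h (x, s)) has_vector_derivative hy (x, y)) (at y)"
    by (rule has_vector_derivative_transform_within_open[OF partials_onD(2)[OF g xy, unfolded e] open_I xy(2)])
       (use assms(2) xy in auto)
qed

lemma partials_on_add:
  assumes "partials_on f fx fy" "partials_on g gx gy"
  shows "partials_on (\<lambda>p. f p + g p) (\<lambda>p. fx p + gx p) (\<lambda>p. fy p + gy p)"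
  unfolding partials_on_def
  by (intro ballI conjI has_vector_derivative_add partials_onD[OF assms(1)] partials_onD[OF assms(2)])

text \<open>
  With \<open>c\<close> the \<open>x\<close>-derivative of an angle \<open>\<theta>\<close> vanishing on the diagonal and \<open>(\<beta>1, \<beta>2)\<close> the
  rotation of \<open>(b1, b2)\<close> by \<open>\<theta>\<close>, the system becomes an equation of sine-Gordon type for \<open>\<theta>\<close>,
  whose nonlinearity is globally Lipschitz.
\<close>

lemma angle_system_solution:
  fixes c0 b1 b2 :: "real \<Rightarrow> real"
  assumes c0: "\<And>k. Ck_on k c0 I" and b1: "\<And>k. Ck_on k b1 I" and b2: "\<And>k. Ck_on k b2 I"
  obtains c \<beta>1 \<beta>2 :: "real \<times> real \<Rightarrow> real"
  where "\<And>k. Ck_on k c II" "\<And>k. Ck_on k \<beta>1 II" "\<And>k. Ck_on k \<beta>2 II"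
    and "\<And>t. t \<in> I \<Longrightarrow> c (t, t) = c0 t" "\<And>t. t \<in> I \<Longrightarrow> \<beta>1 (t, t) = b1 t" "\<And>t. t \<in> I \<Longrightarrow> \<beta>2 (t, t) = b2 t"
    and "\<And>x y. x \<in> I \<Longrightarrow> y \<in> I \<Longrightarrow> ((\<lambda>s. c (x, s)) has_vector_derivative \<beta>2 (x, y)) (at y)"
    and "\<And>x y. x \<in> I \<Longrightarrow> y \<in> I \<Longrightarrow> ((\<lambda>s. \<beta>1 (s, y)) has_vector_derivative c (x, y) * \<beta>2 (x, y)) (at x)"
    and "\<And>x y. x \<in> I \<Longrightarrow> y \<in> I \<Longrightarrow> ((\<lambda>s. \<beta>2 (s, y)) has_vector_derivative - (c (x, y) * \<beta>1 (x, y))) (at x)"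
proof -
  \<comment> \<open>The second component of (b1, b2) rotated by \<theta>. Its \<theta>-derivative is
    bounded by |b1| + |b2| whatever the angle, which makes the iteration global.\<close>
  define g where "g \<theta> y = cos \<theta> * b2 y - sin \<theta> * b1 y" for \<theta> y
  have cont: "continuous_on I c0" "continuous_on I b1" "continuous_on I b2"
    using c0 b1 b2 by (auto intro: Ck_on_imp_continuous)
  have lip: "\<bar>g \<theta> y - g \<theta>' y\<bar> \<le> (\<bar>b1 y\<bar> + \<bar>b2 y\<bar>) * \<bar>\<theta> - \<theta>'\<bar>" for \<theta> \<theta>' y
  proof -
    have "norm (g \<theta> y - g \<theta>' y) \<le> (\<bar>b1 y\<bar> + \<bar>b2 y\<bar>) * \<bar>\<theta> - \<theta>'\<bar> ^ Suc 0 / Suc 0"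
    proof (rule norm_increment_le_power[where g = "\<lambda>\<theta>. - sin \<theta> * b2 y - cos \<theta> * b1 y"])
      fix s
      show "((\<lambda>\<theta>. g \<theta> y) has_vector_derivative - sin s * b2 y - cos s * b1 y) (at s)"
        unfolding g_def has_real_derivative_iff_has_vector_derivative[symmetric]
        by (auto intro!: derivative_eq_intros)
      have "\<bar>- sin s * b2 y - cos s * b1 y\<bar> \<le> \<bar>sin s\<bar> * \<bar>b2 y\<bar> + \<bar>cos s\<bar> * \<bar>b1 y\<bar>"
        by (metis abs_minus_cancel abs_mult abs_triangle_ineq4 mult_minus_left)
      also have "\<dots> \<le> 1 * \<bar>b2 y\<bar> + 1 * \<bar>b1 y\<bar>"
        by (intro add_mono mult_right_mono) auto
      finally show "norm (- sin s * b2 y - cos s * b1 y) \<le> (\<bar>b1 y\<bar> + \<bar>b2 y\<bar>) * \<bar>s - \<theta>'\<bar> ^ 0" by simp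
    qed
    then show ?thesis by simp
  qed
  define G where "G u = (\<lambda>q. g (fst (u q)) (snd q))" for u :: "real \<times> real \<Rightarrow> real \<times> real"
  \<comment> \<open>The unknown is the pair (\<theta>, c): the angle integrates c in x, and c
    integrates the rotated component in y, both starting on the diagonal with the values 0 and
    \<open>c0\<close>.\<close>
  define \<Phi> where "\<Phi> u p = (J2 (\<lambda>q. snd (u q)) p, c0 (fst p) + J1 (G u) p)" for u :: "real \<times> real \<Rightarrow> real \<times> real" and p
  have cG: "continuous_on II (G u)" if "continuous_on II u" for u
    unfolding G_def g_def
    by (intro continuous_intros that continuous_on_compose2[OF cont(2)] continuous_on_compose2[OF cont(3)]) auto
  obtain u where u: "continuous_on II u" "\<And>q. q \<in> II \<Longrightarrow> \<Phi> u q = u q"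
  proof (rule volterra_fixpoint[of II \<Phi> "\<lambda>p. \<bar>snd p - fst p\<bar>"])
    fix u :: "real \<times> real \<Rightarrow> real \<times> real" assume u: "continuous_on II u"
    show "continuous_on II (\<Phi> u)"
      unfolding \<Phi>_def[abs_def]
      by (intro continuous_on_Pair continuous_on_J2 continuous_on_add continuous_on_J1 cG u
          continuous_on_snd continuous_on_compose2[OF cont(1)] continuous_on_fst continuous_on_id) auto
  next
    show "continuous_on II (\<lambda>p. \<bar>snd p - fst p\<bar>)" by (intro continuous_intros)
  next
    fix q assume "q \<in> II"
    then obtain x0 y0 where q: "q = (x0, y0)" "x0 \<in> I" "y0 \<in> I" by auto
    obtain a b where ab: "a \<in> I" "b \<in> I" "a < x0" "a < y0" "x0 < b" "y0 < b"
      using obtain_enclosing[OF q(2,3)] by blast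
    define K where "K = {a..b} \<times> {a..b}"
    have KD: "K \<subseteq> II" using ivl_subset[OF ab(1,2)] by (auto simp: K_def)
    have "continuous_on {a..b} (\<lambda>y. \<bar>b1 y\<bar> + \<bar>b2 y\<bar>)"
      by (intro continuous_intros continuous_on_subset[OF cont(2)] continuous_on_subset[OF cont(3)] ivl_subset ab)
    from compact_imp_bounded[OF compact_continuous_image[OF this compact_Icc]]
    obtain M where M: "0 < M" "\<And>y. y \<in> {a..b} \<Longrightarrow> \<bar>b1 y\<bar> + \<bar>b2 y\<bar> \<le> M"
      unfolding bounded_pos by force
    \<comment> \<open>The summand 1 comes from the first component, which is linear in c, and M from
      the Lipschitz constant in the second.\<close>
    have "norm (\<Phi> u q' - \<Phi> v q') \<le> (1 + M) * C * \<bar>snd q' - fst q'\<bar> ^ Suc n / Suc n"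
      if uv: "continuous_on II u" "continuous_on II v" "0 \<le> C"
        "\<And>q. q \<in> K \<Longrightarrow> norm (u q - v q) \<le> C * \<bar>snd q - fst q\<bar> ^ n"
        and q': "q' \<in> K" for u v C n q'
    proof -
      obtain x y where xy: "q' = (x, y)" "x \<in> I" "y \<in> I" "a \<le> x" "x \<le> b" "a \<le> y" "y \<le> b"
        using q' KD by (auto simp: K_def)
      have seg: "a \<le> s \<and> s \<le> b" if "s \<in> closed_segment x y" for s
        using that xy by (auto simp: closed_segment_eq_real_ivl split: if_splits)
      have cs: "continuous_on II (\<lambda>q. snd (u q))" "continuous_on II (\<lambda>q. snd (v q))"
        using uv by (auto intro: continuous_on_snd)
      note cs' = continuous_on_slices(1)[OF cs(1) xy(3)] continuous_on_slices(1)[OF cs(2) xy(3)]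
      have 1: "norm (J2 (\<lambda>q. snd (u q)) q' - J2 (\<lambda>q. snd (v q)) q') \<le> C * \<bar>x - y\<bar> ^ Suc n / Suc n"
      proof -
        have "norm (prim y (\<lambda>s. snd (u (s, y)) - snd (v (s, y))) x) \<le> C * \<bar>x - y\<bar> ^ Suc n / Suc n"
        proof (rule norm_prim_le_power[OF continuous_on_diff[OF cs'] xy(3,2)])
          fix s assume "s \<in> closed_segment y x"
          then have "(s, y) \<in> K" using seg[of s] xy by (simp add: K_def closed_segment_commute)
          from order_trans[OF norm_diff_snd uv(4)[OF this]]
          show "norm (snd (u (s, y)) - snd (v (s, y))) \<le> C * \<bar>s - y\<bar> ^ n"
            by (simp add: abs_minus_commute)
        qed
        then show ?thesis using prim_diff[OF cs' xy(3,2)] by (simp add: J2_def xy(1))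
      qed
      note cg = continuous_on_slices(2)[OF cG[OF uv(1)] xy(2)] continuous_on_slices(2)[OF cG[OF uv(2)] xy(2)]
      have 2: "norm (J1 (G u) q' - J1 (G v) q') \<le> (M * C) * \<bar>y - x\<bar> ^ Suc n / Suc n"
      proof -
        have "norm (prim x (\<lambda>s. G u (x, s) - G v (x, s)) y) \<le> (M * C) * \<bar>y - x\<bar> ^ Suc n / Suc n"
        proof (rule norm_prim_le_power[OF continuous_on_diff[OF cg] xy(2,3)])
          fix s assume s: "s \<in> closed_segment x y"
          then have sK: "(x, s) \<in> K" using seg[of s] xy by (simp add: K_def)
          have "norm (G u (x, s) - G v (x, s)) \<le> (\<bar>b1 s\<bar> + \<bar>b2 s\<bar>) * \<bar>fst (u (x, s)) - fst (v (x, s))\<bar>"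
            using lip by (simp add: G_def)
          also have "\<dots> \<le> M * (C * \<bar>s - x\<bar> ^ n)"
          proof (rule mult_mono)
            show "\<bar>b1 s\<bar> + \<bar>b2 s\<bar> \<le> M" using M(2)[of s] seg[OF s] by simp
            show "\<bar>fst (u (x, s)) - fst (v (x, s))\<bar> \<le> C * \<bar>s - x\<bar> ^ n"
              using order_trans[OF norm_diff_fst uv(4)[OF sK]] by simp
          qed (use M(1) in auto)
          finally show "norm (G u (x, s) - G v (x, s)) \<le> M * C * \<bar>s - x\<bar> ^ n" by (simp add: mult_ac)
        qed
        then show ?thesis using prim_diff[OF cg xy(2,3)] by (simp add: J1_def xy(1))
      qed
      have "norm (\<Phi> u q' - \<Phi> v q') \<le> norm (J2 (\<lambda>q. snd (u q)) q' - J2 (\<lambda>q. snd (v q)) q') + norm (J1 (G u) q' - J1 (G v) q')"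
        unfolding \<Phi>_def by (rule order_trans[OF _ norm_Pair_le]) (simp add: algebra_simps)
      also have "\<dots> \<le> C * \<bar>x - y\<bar> ^ Suc n / Suc n + (M * C) * \<bar>y - x\<bar> ^ Suc n / Suc n"
        using 1 2 by (rule add_mono)
      also have "\<dots> = (1 + M) * C * \<bar>snd q' - fst q'\<bar> ^ Suc n / Suc n"
        using xy(1) by (simp add: abs_minus_commute field_simps del: of_nat_Suc)
      finally show ?thesis .
    qed
    then show "\<exists>U K L. open U \<and> q \<in> U \<and> U \<inter> II \<subseteq> K \<and> K \<subseteq> II \<and> compact K \<and> 0 \<le> L \<and>
      (\<forall>u v C n. continuous_on II u \<longrightarrow> continuous_on II v \<longrightarrow> 0 \<le> C \<longrightarrow>
         (\<forall>q\<in>K. norm (u q - v q) \<le> C * \<bar>snd q - fst q\<bar> ^ n) \<longrightarrow>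
         (\<forall>q\<in>K. norm (\<Phi> u q - \<Phi> v q) \<le> L * C * \<bar>snd q - fst q\<bar> ^ Suc n / Suc n))"
      using KD M(1) ab q
      by (intro exI[of _ "{a<..<b} \<times> {a<..<b}"] exI[of _ K] exI[of _ "1 + M"] conjI open_Times)
         (auto simp: K_def compact_Times)
  qed auto
  define \<theta> where "\<theta> q = fst (u q)" for q
  define c where "c q = snd (u q)" for q
  define \<beta>1 where "\<beta>1 q = cos (\<theta> q) * b1 (snd q) + sin (\<theta> q) * b2 (snd q)" for q
  define \<beta>2 where "\<beta>2 q = cos (\<theta> q) * b2 (snd q) - sin (\<theta> q) * b1 (snd q)" for q
  have \<beta>2: "G u = \<beta>2" by (simp add: fun_eq_iff G_def g_def \<beta>2_def \<theta>_def)
  have \<theta>J: "\<theta> q = J2 c q" and cJ: "c q = c0 (fst q) + J1 \<beta>2 q" if "q \<in> II" for q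
    using u(2)[OF that] unfolding \<Phi>_def \<beta>2 \<theta>_def c_def by (metis fst_conv snd_conv c_def)+
  have cont\<theta>: "continuous_on II \<theta>" and contc: "continuous_on II c"
    using u(1) unfolding \<theta>_def c_def by (auto intro: continuous_on_fst continuous_on_snd)
  have cont\<beta>2: "continuous_on II \<beta>2" using cG[OF u(1)] \<beta>2 by simp
  have cy: "((\<lambda>s. c (x, s)) has_vector_derivative \<beta>2 (x, y)) (at y)" if "x \<in> I" "y \<in> I" for x y
  proof -
    have "((\<lambda>s. c0 x + J1 \<beta>2 (x, s)) has_vector_derivative \<beta>2 (x, y)) (at y)"
      unfolding J1_def fst_conv snd_conv
      using has_vector_derivative_add[OF has_vector_derivative_const
          has_vector_derivative_prim[OF continuous_on_slices(2)[OF cont\<beta>2 that(1)] that]] by simp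
    then show ?thesis
      by (rule has_vector_derivative_transform_within_open[OF _ open_I that(2)]) (use cJ that in auto)
  qed
  have p\<theta>: "partials_on \<theta> c (\<lambda>p. J2 \<beta>2 p - c (snd p, snd p))"
    by (rule partials_on_cong[OF partials_on_J2[OF contc cont\<beta>2 cy]]) (use \<theta>J in auto)
  have d\<theta>: "((\<lambda>s. \<theta> (s, y)) has_real_derivative c (x, y)) (at x)" if "x \<in> I" "y \<in> I" for x y
    using partials_onD(1)[OF p\<theta> that] by (simp add: has_real_derivative_iff_has_vector_derivative)
  have \<beta>1x: "((\<lambda>s. \<beta>1 (s, y)) has_vector_derivative c (x, y) * \<beta>2 (x, y)) (at x)"
    and \<beta>2x: "((\<lambda>s. \<beta>2 (s, y)) has_vector_derivative - (c (x, y) * \<beta>1 (x, y))) (at x)"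
    if "x \<in> I" "y \<in> I" for x y
    unfolding \<beta>1_def \<beta>2_def snd_conv has_real_derivative_iff_has_vector_derivative[symmetric]
    by (auto intro!: derivative_eq_intros d\<theta>[OF that] simp: algebra_simps)
  have p\<beta>2: "Ck_on k \<theta> II \<Longrightarrow> Ck_on k \<beta>2 II" and p\<beta>1: "Ck_on k \<theta> II \<Longrightarrow> Ck_on k \<beta>1 II" for k
    unfolding \<beta>1_def \<beta>2_def
    using Ck_on_sin_cos[OF open_II, of k \<theta>]
    by (auto intro!: Ck_on_diff Ck_on_add Ck_on_mult open_II Ck_on_compose_linear[OF bounded_linear_snd open_II _ b1]
        Ck_on_compose_linear[OF bounded_linear_snd open_II _ b2])
  have diag: "bounded_linear (\<lambda>p::real \<times> real. (snd p, snd p))" "bounded_linear (\<lambda>p::real \<times> real. (fst p, fst p))"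
    by (intro bounded_linear_Pair bounded_linear_snd bounded_linear_fst)+
  \<comment> \<open>Bootstrapping: the first derivatives of \<theta> and c are expressed by
    \<theta>, c, the given functions and their \<open>J1\<close> and \<open>J2\<close>, so C^k for
    both implies one order more for both.\<close>
  have smooth: "Ck_on k \<theta> II \<and> Ck_on k c II" for k
  proof (induction k)
    case 0
    then show ?case using cont\<theta> contc by simp
  next
    case (Suc k)
    note IH\<theta> = conjunct1[OF Suc.IH] and IHc = conjunct2[OF Suc.IH]
    note k\<beta>2 = p\<beta>2[OF IH\<theta>] and k\<beta>1 = p\<beta>1[OF IH\<theta>]
    have "Ck_on (Suc k) \<theta> II"
      by (rule Ck_on_partials[OF p\<theta> IHc Ck_on_diff[OF open_II Ck_on_J2[OF k\<beta>2]
            Ck_on_compose_linear[OF diag(1) open_II _ IHc]]]) auto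
    moreover have "Ck_on (Suc k) c II"
    proof -
      have cx: "continuous_on II (\<lambda>p. - (c p * \<beta>1 p))"
        using contc Ck_on_imp_continuous[OF k\<beta>1] by (intro continuous_intros)
      have "partials_on (\<lambda>p. c0 (fst p)) (\<lambda>p. vector_derivative c0 (at (fst p))) (\<lambda>_. 0)"
        unfolding partials_on_def using Ck_on_Suc_realD(1)[OF open_I c0] by auto
      moreover have "partials_on (J1 \<beta>2) (\<lambda>p. J1 (\<lambda>p. - (c p * \<beta>1 p)) p - \<beta>2 (fst p, fst p)) \<beta>2"
        by (rule partials_on_J1[OF cont\<beta>2 cx \<beta>2x])
      ultimately have "partials_on (\<lambda>p. c0 (fst p) + J1 \<beta>2 p)
          (\<lambda>p. vector_derivative c0 (at (fst p)) + (J1 (\<lambda>p. - (c p * \<beta>1 p)) p - \<beta>2 (fst p, fst p))) (\<lambda>p. 0 + \<beta>2 p)"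
        by (rule partials_on_add)
      then have "partials_on c
          (\<lambda>p. vector_derivative c0 (at (fst p)) + (J1 (\<lambda>p. - (c p * \<beta>1 p)) p - \<beta>2 (fst p, fst p))) \<beta>2"
        by (rule partials_on_cong) (use cJ in auto)
      moreover have "Ck_on k (\<lambda>p. vector_derivative c0 (at (fst p)) + (J1 (\<lambda>p. - (c p * \<beta>1 p)) p - \<beta>2 (fst p, fst p))) II"
        by (intro Ck_on_add Ck_on_diff Ck_on_J1 Ck_on_minus Ck_on_mult open_II IHc k\<beta>1
            Ck_on_compose_linear[OF diag(2) open_II _ k\<beta>2]
            Ck_on_compose_linear[OF bounded_linear_fst open_II _ Ck_on_Suc_realD(2)[OF open_I c0]]) auto
      ultimately show ?thesis using k\<beta>2 by (rule Ck_on_partials)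
    qed
    ultimately show ?case ..
  qed
  have \<theta>0: "\<theta> (t, t) = 0" if "t \<in> I" for t using \<theta>J[of "(t, t)"] that by (simp add: J2_def)
  show thesis
  proof (rule that[of c \<beta>1 \<beta>2])
    show "Ck_on k c II" "Ck_on k \<beta>1 II" "Ck_on k \<beta>2 II" for k
      using smooth p\<beta>1 p\<beta>2 by blast+
    show "c (t, t) = c0 t" "\<beta>1 (t, t) = b1 t" "\<beta>2 (t, t) = b2 t" if "t \<in> I" for t
      using cJ[of "(t, t)"] that by (simp_all add: J1_def \<beta>1_def \<beta>2_def \<theta>0)
  qed (fact cy \<beta>1x \<beta>2x)+
qed

section \<open>Dependence on parameters\<close>

text \<open>The factor \<sigma> by which the coefficients differ comes out of the variation of
  constants exactly. What remains is a difference quotient that is still defined when \<sigma> =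
  0.\<close>

lemma fundamental_difference:
  fixes Y1 Y2 \<Phi> :: "real \<Rightarrow> cmat2"
  assumes Y1: "fundamental t0 A1 Y1" and Y2: "fundamental t0 A2 Y2"
    and tr: "\<And>t. t \<in> I \<Longrightarrow> trace (A2 t) = 0"
    and c: "continuous_on I A1" "continuous_on I A2" "continuous_on I \<Phi>" and t0: "t0 \<in> I" and t: "t \<in> I"
    and d: "\<And>s. s \<in> I \<Longrightarrow> A1 s - A2 s = \<sigma> *\<^sub>C \<Phi> s"
  shows "Y1 t - Y2 t = \<sigma> *\<^sub>C (prim t0 (\<lambda>s. Y1 s ** \<Phi> s ** adj2 (Y2 s)) t ** Y2 t)"
proof -
  let ?J = "prim t0 (\<lambda>s. Y1 s ** \<Phi> s ** adj2 (Y2 s)) t"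
  have "Y1 t ** adj2 (Y2 t) - Y1 t0 = prim t0 (\<lambda>s. Y1 s ** (A1 s - A2 s) ** adj2 (Y2 s)) t"
    using fundamental_quotient[where Z = Y1, OF Y2 tr c(2,1) t0 t] Y1 unfolding fundamental_def by blast
  also have "\<dots> = prim t0 (\<lambda>s. \<sigma> *\<^sub>C (Y1 s ** \<Phi> s ** adj2 (Y2 s))) t"
    by (rule prim_cong[OF _ t0 t]) (simp add: d cscale_matmul)
  also have "\<dots> = \<sigma> *\<^sub>C ?J"
    by (rule prim_linear[OF bounded_bilinear.bounded_linear_right[OF bounded_bilinear_cscale] _ t0 t])
       (intro continuous_on_matmul continuous_on_adj2 c fundamental_continuous[OF Y1] fundamental_continuous[OF Y2])
  finally have "Y1 t ** adj2 (Y2 t) - mat 1 = \<sigma> *\<^sub>C ?J"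
    using Y1 by (simp add: fundamental_def)
  from arg_cong[OF this, of "\<lambda>A. A ** Y2 t"] show ?thesis
    by (simp add: matmul_diff_left matrix_mul_assoc[symmetric] adj2_inverse fundamental_det[OF Y2 tr t0 t] cscale_matmul)
qed

end

text \<open>As \<open>cmat2\<close> is a real vector space, complex differentiability is stated
  entry by entry.\<close>

definition cmat_deriv :: "(complex \<Rightarrow> cmat2) \<Rightarrow> cmat2 \<Rightarrow> complex \<Rightarrow> bool" where
  "cmat_deriv f D z \<longleftrightarrow> (\<forall>i j. ((\<lambda>w. f w $ i $ j) has_field_derivative D $ i $ j) (at z))"

lemma cmat_deriv_caratheodory:
  assumes "\<And>w. f w - f z = (w - z) *\<^sub>C g w" "isCont g z"
  shows "cmat_deriv f (g z) z"
  unfolding cmat_deriv_def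
proof (intro allI)
  fix i j
  have "f w $ i $ j - f z $ i $ j = g w $ i $ j * (w - z)" for w
    using arg_cong[OF assms(1)[of w], of "\<lambda>A. A $ i $ j"] by (simp add: mult.commute)
  moreover have "isCont (\<lambda>w. g w $ i $ j) z"
    using assms(2) by (intro continuous_intros)
  ultimately show "((\<lambda>w. f w $ i $ j) has_field_derivative g z $ i $ j) (at z)"
    unfolding CARAT_DERIV by (intro exI[of _ "\<lambda>w. g w $ i $ j"]) auto
qed

lemma has_vector_derivative_caratheodory:
  fixes f :: "real \<Rightarrow> 'b::real_normed_vector"
  assumes S: "open S" "x \<in> S" and d: "\<And>u. u \<in> S \<Longrightarrow> f u - f x = (u - x) *\<^sub>R g u" and g: "continuous_on S g"
  shows "(f has_vector_derivative g x) (at x)"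
proof -
  have "isCont g x" using g S by (simp add: continuous_on_eq_continuous_at)
  then have "((\<lambda>u. norm (g u - g x)) \<longlongrightarrow> 0) (at x)"
    unfolding isCont_def by (intro tendsto_norm_zero) (simp add: LIM_zero_iff)
  moreover have "\<forall>\<^sub>F u in at x. u \<in> S" using S eventually_at_topological by blast
  then have "\<forall>\<^sub>F u in at x. norm ((1 / norm (u - x)) *\<^sub>R (f u - (f x + (u - x) *\<^sub>R g x))) \<le> norm (g u - g x)"
  proof eventually_elim
    case (elim u)
    have "f u - (f x + (u - x) *\<^sub>R g x) = (u - x) *\<^sub>R (g u - g x)"
      using d[OF elim] by (simp add: algebra_simps)
    then show ?case by (cases "u = x") simp_all
  qed
  ultimately have "((\<lambda>u. (1 / norm (u - x)) *\<^sub>R (f u - (f x + (u - x) *\<^sub>R g x))) \<longlongrightarrow> 0) (at x)"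
    by (rule Lim_null_comparison[rotated])
  then show ?thesis
    unfolding has_vector_derivative_def has_derivative_within
    by (simp add: bounded_linear_scaleR_left)
qed

section \<open>The extended frame\<close>

lemma scaleR_nth2: "(r *\<^sub>R A) $ i $ j = complex_of_real r * A $ i $ j" for A :: cmat2
  unfolding vector_scaleR_component by (rule scaleR_conv_of_real)

lemmas matmul_add_left = bounded_bilinear.add_left[OF bounded_bilinear_matmul]
lemmas matmul_add_right = bounded_bilinear.add_right[OF bounded_bilinear_matmul]

lemma e_nth [simp]:
  "e1 $ 1 $ 1 = 0" "e1 $ 1 $ 2 = \<i> / 2" "e1 $ 2 $ 1 = \<i> / 2" "e1 $ 2 $ 2 = 0"
  "e2 $ 1 $ 1 = 0" "e2 $ 1 $ 2 = - 1 / 2" "e2 $ 2 $ 1 = 1 / 2" "e2 $ 2 $ 2 = 0"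
  "e3 $ 1 $ 1 = \<i> / 2" "e3 $ 1 $ 2 = 0" "e3 $ 2 $ 1 = 0" "e3 $ 2 $ 2 = - \<i> / 2"
  unfolding e1_def e2_def e3_def scaleR_nth2 by simp_all

lemma trace2: "trace A = A $ 1 $ 1 + A $ 2 $ 2" for A :: cmat2
  by (simp add: trace_def sum_2)

lemma trace_cscale: "trace (w *\<^sub>C A) = w * trace A"
  by (simp add: trace2 algebra_simps)

lemma cscale_of_real: "complex_of_real r *\<^sub>C A = r *\<^sub>R A"
  unfolding mat2_eq_iff scaleR_nth2 by simp

lemma cmat_deriv_matmul:
  assumes "cmat_deriv f D z" "cmat_deriv g E z"
  shows "cmat_deriv (\<lambda>z. f z ** g z) (D ** g z + f z ** E) z"
  unfolding cmat_deriv_def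
proof (intro allI)
  fix i j
  have f: "((\<lambda>w. f w $ i $ k) has_field_derivative D $ i $ k) (at z)"
    and g: "((\<lambda>w. g w $ k $ j) has_field_derivative E $ k $ j) (at z)" for k
    using assms by (auto simp: cmat_deriv_def)
  show "((\<lambda>w. (f w ** g w) $ i $ j) has_field_derivative (D ** g z + f z ** E) $ i $ j) (at z)"
    unfolding matmul2_nth vector_add_component
    by (rule derivative_eq_intros f g refl)+ (simp add: algebra_simps)
qed

lemma cmat_deriv_inverse:
  assumes "cmat_deriv f D (inverse z)" "z \<noteq> 0"
  shows "cmat_deriv (\<lambda>z. f (inverse z)) ((- inverse (z ^ 2)) *\<^sub>C D) z"
  unfolding cmat_deriv_def
proof (intro allI)
  fix i j
  have "((\<lambda>w. f w $ i $ j) has_field_derivative D $ i $ j) (at (inverse z))"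
    using assms(1) by (auto simp: cmat_deriv_def)
  from DERIV_chain2[OF this DERIV_inverse[OF assms(2)]]
  show "((\<lambda>w. f (inverse w) $ i $ j) has_field_derivative ((- inverse (z ^ 2)) *\<^sub>C D) $ i $ j) (at z)"
    by (simp add: power2_eq_square mult.commute)
qed

context open_interval
begin

text \<open>For a coefficient affine in z, the coefficients at w and z differ by exactly (w - z) A1.
  The difference identity then gives the derivative at every complex z, and the solution is entire
  in z.\<close>

lemma spectral_deriv:
  fixes C A1 :: "real \<Rightarrow> cmat2"
  assumes c: "continuous_on I C" "continuous_on I A1"
    and tr: "\<And>s. s \<in> I \<Longrightarrow> trace (C s) = 0" "\<And>s. s \<in> I \<Longrightarrow> trace (A1 s) = 0"
    and cY: "continuous_on (UNIV \<times> I) (\<lambda>(z, s). Y z s)"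
    and Y: "\<And>z. fundamental t0 (\<lambda>s. C s + z *\<^sub>C A1 s) (Y z)" and t0: "t0 \<in> I" and t: "t \<in> I"
  shows "cmat_deriv (\<lambda>z. Y z t) (prim t0 (\<lambda>s. Y z s ** A1 s ** adj2 (Y z s)) t ** Y z t) z"
proof (rule cmat_deriv_caratheodory[where g = "\<lambda>w. prim t0 (\<lambda>s. Y w s ** A1 s ** adj2 (Y z s)) t ** Y z t"])
  have cA: "continuous_on I (\<lambda>s. C s + w *\<^sub>C A1 s)" for w
    by (intro continuous_on_add continuous_on_cscale continuous_on_const c)
  show "Y w t - Y z t = (w - z) *\<^sub>C (prim t0 (\<lambda>s. Y w s ** A1 s ** adj2 (Y z s)) t ** Y z t)" for w
  proof (rule fundamental_difference[OF Y Y _ cA cA c(2) t0 t])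
    show "trace (C s + z *\<^sub>C A1 s) = 0" if "s \<in> I" for s
      using tr[OF that] by (simp add: trace_add trace_cscale)
  qed (simp add: mat2_eq_iff algebra_simps)
  have "continuous_on (UNIV \<times> I) (\<lambda>x. (case (fst x, snd x) of (w, s) \<Rightarrow> Y w s) ** A1 (snd x) ** adj2 (Y z (snd x)))"
    by (intro continuous_on_matmul continuous_on_adj2 continuous_on_compose2[OF cY] continuous_on_compose2[OF c(2)]
        continuous_on_compose2[OF fundamental_continuous[OF Y]] continuous_on_Pair continuous_on_fst continuous_on_snd continuous_on_id) auto
  then have "continuous_on (UNIV \<times> I) (\<lambda>(w, s). Y w s ** A1 s ** adj2 (Y z s))"
    by (simp add: case_prod_unfold)
  from continuous_on_prim[OF this continuous_on_const _ continuous_on_const, of t0 t] t0 t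
  have "continuous_on UNIV (\<lambda>w. prim t0 (\<lambda>s. Y w s ** A1 s ** adj2 (Y z s)) t ** Y z t)"
    by (intro continuous_on_matmul continuous_on_const) auto
  then show "isCont (\<lambda>w. prim t0 (\<lambda>s. Y w s ** A1 s ** adj2 (Y z s)) t ** Y z t) z"
    by (simp add: continuous_on_eq_continuous_at)
qed

end

text \<open>Only the smooth solution of the compatibility equations is assumed here; the Cauchy data
  enter later, through the values on the diagonal.\<close>

locale angle_frame = open_interval I for I +
  fixes t0 :: real and c \<beta>1 \<beta>2 :: "real \<times> real \<Rightarrow> real"
  assumes t0: "t0 \<in> I"
    and Ck_c: "\<And>k. Ck_on k c II" and Ck_\<beta>1: "\<And>k. Ck_on k \<beta>1 II" and Ck_\<beta>2: "\<And>k. Ck_on k \<beta>2 II"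
    and cy: "\<And>x y. x \<in> I \<Longrightarrow> y \<in> I \<Longrightarrow> ((\<lambda>s. c (x, s)) has_vector_derivative \<beta>2 (x, y)) (at y)"
    and \<beta>1x: "\<And>x y. x \<in> I \<Longrightarrow> y \<in> I \<Longrightarrow> ((\<lambda>s. \<beta>1 (s, y)) has_vector_derivative c (x, y) * \<beta>2 (x, y)) (at x)"
    and \<beta>2x: "\<And>x y. x \<in> I \<Longrightarrow> y \<in> I \<Longrightarrow> ((\<lambda>s. \<beta>2 (s, y)) has_vector_derivative - (c (x, y) * \<beta>1 (x, y))) (at x)"
begin

text \<open>The coefficient of F in the y-direction is \<open>B\<close> divided by z, the one in the
  x-direction is \<open>U z\<close>; \<open>Bx\<close> is the x-derivative of \<open>B\<close>
  according to the compatibility equations.\<close>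

definition B :: "real \<times> real \<Rightarrow> cmat2" where
  "B p = \<beta>1 p *\<^sub>R e1 + \<beta>2 p *\<^sub>R e2"

definition Bx :: "real \<times> real \<Rightarrow> cmat2" where
  "Bx p = (c p * \<beta>2 p) *\<^sub>R e1 - (c p * \<beta>1 p) *\<^sub>R e2"

definition U :: "complex \<Rightarrow> real \<times> real \<Rightarrow> cmat2" where
  "U z p = c p *\<^sub>R e3 + z *\<^sub>C e1"

lemma Ck_B: "Ck_on k B II"
  unfolding B_def[abs_def]
  by (intro Ck_on_add Ck_on_scaleR Ck_on_const open_II Ck_\<beta>1 Ck_\<beta>2)

lemma Ck_Bx: "Ck_on k Bx II"
  unfolding Bx_def[abs_def]
  by (intro Ck_on_diff Ck_on_scaleR Ck_on_mult Ck_on_const open_II Ck_\<beta>1 Ck_\<beta>2 Ck_c)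

lemma Ck_U: "Ck_on k (U z) II"
  unfolding U_def[abs_def]
  by (intro Ck_on_add Ck_on_scaleR Ck_on_const open_II Ck_c)

lemmas continuous_B = Ck_on_imp_continuous[OF Ck_B]
lemmas continuous_Bx = Ck_on_imp_continuous[OF Ck_Bx]
lemmas continuous_U = Ck_on_imp_continuous[OF Ck_U]
lemmas continuous_c = Ck_on_imp_continuous[OF Ck_c]

lemma trace_BU [simp]: "trace (B p) = 0" "trace (U z p) = 0"
  by (simp_all add: B_def U_def trace2)

lemma B_deriv_x:
  assumes x: "x \<in> I" and y: "y \<in> I"
  shows "((\<lambda>s. B (s, y)) has_vector_derivative Bx (x, y)) (at x)"
proof -
  have l: "bounded_linear (\<lambda>r. r *\<^sub>R e)" for e :: cmat2 by (rule bounded_linear_scaleR_left)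
  show ?thesis
    using has_vector_derivative_add[OF
        bounded_linear.has_vector_derivative[OF l \<beta>1x[OF x y], of e1]
        bounded_linear.has_vector_derivative[OF l \<beta>2x[OF x y], of e2]]
    by (simp add: B_def Bx_def)
qed

lemma U_deriv_y:
  assumes "x \<in> I" "y \<in> I"
  shows "((\<lambda>s. U z (x, s)) has_vector_derivative \<beta>2 (x, y) *\<^sub>R e3) (at y)"
  unfolding U_def
  using has_vector_derivative_add[OF
        bounded_linear.has_vector_derivative[OF bounded_linear_scaleR_left cy[OF assms], of e3]
        has_vector_derivative_const[of "z *\<^sub>C e1"]] by simp

text \<open>Equality of the mixed derivatives of F, with w = 1/z. The parameter cancels in the
  commutator of e1 and B, whose e3-component is balanced by c_y = \<beta>2; the commutator with c e3
  rotates (\<beta>1, \<beta>2) and gives \<open>Bx\<close>.\<close>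

lemma zero_curvature:
  assumes "z * w = 1"
  shows "(w *\<^sub>C B p) ** U z p + \<beta>2 p *\<^sub>R e3 - U z p ** (w *\<^sub>C B p) = w *\<^sub>C Bx p"
proof -
  have zw: "z * (w * r) = r" "w * (z * r) = r" for r
    using assms by (simp_all add: mult.assoc[symmetric] mult.commute[of w])
  show ?thesis
    unfolding mat2_eq_iff B_def Bx_def U_def
    by (simp add: matmul2_nth scaleR_nth2 algebra_simps zw del: vector_scaleR_component)
qed

text \<open>
  The frame is \<open>Qf\<close> along the line \<open>y = t0\<close>, followed by \<open>Mf\<close> along the vertical line through \<open>x\<close>,
  where \<open>w\<close> stands for \<open>1 / z\<close>. Both factors are entire in their parameter, which makes the
  Birkhoff factors explicit.
\<close>

definition Mf :: "real \<times> complex \<Rightarrow> real \<Rightarrow> cmat2" where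
  "Mf = (SOME Y. continuous_on ((I \<times> UNIV) \<times> I) (\<lambda>(p, s). Y p s) \<and>
     (\<forall>p\<in>I \<times> UNIV. fundamental t0 (\<lambda>s. snd p *\<^sub>C B (fst p, s)) (Y p)))"

definition Qf :: "real \<times> complex \<Rightarrow> real \<Rightarrow> cmat2" where
  "Qf = (SOME Y. continuous_on ((I \<times> UNIV) \<times> I) (\<lambda>(p, s). Y p s) \<and>
     (\<forall>p\<in>I \<times> UNIV. fundamental t0 (\<lambda>s. U (snd p) (s, fst p)) (Y p)))"

lemma Mf_all: "continuous_on ((I \<times> UNIV) \<times> I) (\<lambda>(p, s). Mf p s) \<and>
     (\<forall>p\<in>I \<times> UNIV. fundamental t0 (\<lambda>s. snd p *\<^sub>C B (fst p, s)) (Mf p))"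
proof -
  have "continuous_on ((I \<times> UNIV) \<times> I) (\<lambda>x. snd (fst x) *\<^sub>C B (fst (fst x), snd x))"
    by (intro continuous_on_cscale continuous_on_compose2[OF continuous_B]
        continuous_on_Pair continuous_on_fst continuous_on_snd continuous_on_id) auto
  then have "continuous_on ((I \<times> UNIV) \<times> I) (\<lambda>(p, s). snd p *\<^sub>C B (fst p, s))"
    by (simp add: case_prod_unfold)
  from fundamental_exists[OF open_Times[OF open_I open_UNIV] this t0]
  have "\<exists>Y. continuous_on ((I \<times> UNIV) \<times> I) (\<lambda>(p, s). Y p s) \<and>
     (\<forall>p\<in>I \<times> UNIV. fundamental t0 (\<lambda>s. snd p *\<^sub>C B (fst p, s)) (Y p))" by metis
  from someI_ex[OF this] show ?thesis unfolding Mf_def .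
qed

lemma Qf_all: "continuous_on ((I \<times> UNIV) \<times> I) (\<lambda>(p, s). Qf p s) \<and>
     (\<forall>p\<in>I \<times> UNIV. fundamental t0 (\<lambda>s. U (snd p) (s, fst p)) (Qf p))"
proof -
  have "continuous_on ((I \<times> UNIV) \<times> I) (\<lambda>x. c (snd x, fst (fst x)) *\<^sub>R e3 + snd (fst x) *\<^sub>C e1)"
    by (intro continuous_on_add continuous_on_scaleR continuous_on_cscale continuous_on_const continuous_on_compose2[OF continuous_c]
        continuous_on_Pair continuous_on_fst continuous_on_snd continuous_on_id) auto
  then have "continuous_on ((I \<times> UNIV) \<times> I) (\<lambda>(p, s). U (snd p) (s, fst p))"
    by (simp add: case_prod_unfold U_def)
  from fundamental_exists[OF open_Times[OF open_I open_UNIV] this t0]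
  have "\<exists>Y. continuous_on ((I \<times> UNIV) \<times> I) (\<lambda>(p, s). Y p s) \<and>
     (\<forall>p\<in>I \<times> UNIV. fundamental t0 (\<lambda>s. U (snd p) (s, fst p)) (Y p))" by metis
  from someI_ex[OF this] show ?thesis unfolding Qf_def .
qed

lemma Mf_fundamental: "x \<in> I \<Longrightarrow> fundamental t0 (\<lambda>s. w *\<^sub>C B (x, s)) (Mf (x, w))"
  using Mf_all by force

lemma Qf_fundamental: "y \<in> I \<Longrightarrow> fundamental t0 (\<lambda>s. U z (s, y)) (Qf (y, z))"
  using Qf_all by force

lemma Mf_t0: "x \<in> I \<Longrightarrow> Mf (x, w) t0 = mat 1" and Qf_t0: "x \<in> I \<Longrightarrow> Qf (x, w) t0 = mat 1"
  using Mf_fundamental Qf_fundamental by (auto simp: fundamental_def)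

lemma Mf_deriv: "x \<in> I \<Longrightarrow> y \<in> I \<Longrightarrow> (Mf (x, w) has_vector_derivative Mf (x, w) y ** (w *\<^sub>C B (x, y))) (at y)"
  using Mf_fundamental[of x w] unfolding fundamental_def by blast

lemma Qf_deriv: "x \<in> I \<Longrightarrow> y \<in> I \<Longrightarrow> (Qf (y, z) has_vector_derivative Qf (y, z) x ** U z (x, y)) (at x)"
  using Qf_fundamental[of y z] unfolding fundamental_def by blast

lemma det_Mf: "x \<in> I \<Longrightarrow> y \<in> I \<Longrightarrow> det (Mf (x, w) y) = 1"
  by (rule fundamental_det[OF Mf_fundamental _ t0]) (simp_all add: trace_cscale)

lemma det_Qf: "x \<in> I \<Longrightarrow> y \<in> I \<Longrightarrow> det (Qf (y, z) x) = 1"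
  by (rule fundamental_det[OF Qf_fundamental _ t0]) simp_all

lemma continuous_on_Mf:
  assumes "continuous_on S f" "continuous_on S g" "continuous_on S h"
    and "\<And>s. s \<in> S \<Longrightarrow> f s \<in> I" "\<And>s. s \<in> S \<Longrightarrow> h s \<in> I"
  shows "continuous_on S (\<lambda>s. Mf (f s, g s) (h s))"
proof -
  have "continuous_on S (\<lambda>s. case ((f s, g s), h s) of (p, s) \<Rightarrow> Mf p s)"
    by (rule continuous_on_compose2[OF conjunct1[OF Mf_all]]) (use assms in \<open>auto intro: continuous_on_Pair\<close>)
  then show ?thesis by simp
qed

lemma continuous_on_Qf:
  assumes "continuous_on S f" "continuous_on S g" "continuous_on S h"
    and "\<And>s. s \<in> S \<Longrightarrow> f s \<in> I" "\<And>s. s \<in> S \<Longrightarrow> h s \<in> I"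
  shows "continuous_on S (\<lambda>s. Qf (f s, g s) (h s))"
proof -
  have "continuous_on S (\<lambda>s. case ((f s, g s), h s) of (p, s) \<Rightarrow> Qf p s)"
    by (rule continuous_on_compose2[OF conjunct1[OF Qf_all]]) (use assms in \<open>auto intro: continuous_on_Pair\<close>)
  then show ?thesis by simp
qed

text \<open>Here x is a parameter of the y-equation. The difference identity with \<sigma> = u - x,
  followed by u \<rightarrow> x, gives the derivative.\<close>

lemma Mf_deriv_x:
  assumes x: "x \<in> I" and y: "y \<in> I"
  shows "((\<lambda>u. Mf (u, w) y) has_vector_derivative
    prim t0 (\<lambda>s. Mf (x, w) s ** (w *\<^sub>C Bx (x, s)) ** adj2 (Mf (x, w) s)) y ** Mf (x, w) y) (at x)"
proof -
  \<comment> \<open>The difference quotient of the coefficient in x, written as a mean of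
    \<open>Bx\<close> so that it is continuous up to u = x.\<close>
  define D where "D u s = w *\<^sub>C integral {0..1} (\<lambda>\<tau>. Bx (x + \<tau> * (u - x), s))" for u s
  define g where "g u = prim t0 (\<lambda>s. Mf (u, w) s ** D u s ** adj2 (Mf (x, w) s)) y ** Mf (x, w) y" for u
  have "continuous_on (II \<times> cbox 0 1) (\<lambda>q. Bx (x + snd q * (fst (fst q) - x), snd (fst q)))"
    by (rule continuous_on_compose2[OF continuous_Bx])
       (use affine_mem[OF x] in \<open>auto intro!: continuous_intros\<close>)
  then have "continuous_on (II \<times> cbox 0 1) (\<lambda>(p, \<tau>). Bx (x + \<tau> * (fst p - x), snd p))"
    by (simp add: case_prod_unfold)
  then have "continuous_on II (\<lambda>p. integral (cbox 0 1) (\<lambda>\<tau>. Bx (x + \<tau> * (fst p - x), snd p)))"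
    by (rule integral_continuous_on_param)
  then have cD: "continuous_on II (\<lambda>p. D (fst p) (snd p))"
    unfolding D_def box_real[symmetric] by (intro continuous_on_cscale continuous_on_const)
  have cg: "continuous_on I g"
  proof -
    have "continuous_on II (\<lambda>p. Mf (fst p, w) (snd p) ** D (fst p) (snd p) ** adj2 (Mf (x, w) (snd p)))"
      using x by (intro continuous_on_matmul cD continuous_on_adj2 continuous_on_Mf continuous_on_const
        continuous_on_fst continuous_on_snd continuous_on_id) auto
    then have "continuous_on II (\<lambda>(u, s). Mf (u, w) s ** D u s ** adj2 (Mf (x, w) s))"
      by (simp add: case_prod_unfold)
    from continuous_on_prim[OF this continuous_on_const _ continuous_on_const, of t0 y] t0 y
    show ?thesis unfolding g_def by (intro continuous_on_matmul continuous_on_const) auto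
  qed
  have dg: "Mf (u, w) y - Mf (x, w) y = (u - x) *\<^sub>R g u" if u: "u \<in> I" for u
  proof -
    have cB: "continuous_on I (\<lambda>s. w *\<^sub>C B (v, s))" if "v \<in> I" for v
      using continuous_on_slices(2)[OF continuous_B that] by (intro continuous_on_cscale continuous_on_const)
    have "Mf (u, w) y - Mf (x, w) y = complex_of_real (u - x) *\<^sub>C g u"
      unfolding g_def
    proof (rule fundamental_difference[OF Mf_fundamental[OF u] Mf_fundamental[OF x] _ cB[OF u] cB[OF x] _ t0 y])
      show "continuous_on I (D u)" using continuous_on_slices(2)[OF cD u] by simp
      fix s assume s: "s \<in> I"
      have "B (u, s) - B (x, s) = prim x (\<lambda>r. Bx (r, s)) u"
        by (rule prim_eq_increment[OF B_deriv_x[OF _ s] continuous_on_slices(1)[OF continuous_Bx s] x u, symmetric])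
      also have "\<dots> = (u - x) *\<^sub>R integral {0..1} (\<lambda>\<tau>. Bx (x + \<tau> * (u - x), s))"
        by (rule prim_eq_scaled[OF continuous_on_slices(1)[OF continuous_Bx s] x u])
      finally have e: "B (u, s) - B (x, s) = (u - x) *\<^sub>R integral {0..1} (\<lambda>\<tau>. Bx (x + \<tau> * (u - x), s))" .
      have "w *\<^sub>C (B (u, s) - B (x, s)) = complex_of_real (u - x) *\<^sub>C D u s"
        unfolding D_def e unfolding mat2_eq_iff cscale_nth scaleR_nth2 by simp
      then show "w *\<^sub>C B (u, s) - w *\<^sub>C B (x, s) = complex_of_real (u - x) *\<^sub>C D u s"
        by (simp add: mat2_eq_iff right_diff_distrib)
    qed (simp add: trace_cscale)
    then show ?thesis by (simp only: cscale_of_real)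
  qed
  have "((\<lambda>u. Mf (u, w) y) has_vector_derivative g x) (at x)"
    by (rule has_vector_derivative_caratheodory[OF open_I x dg cg])
  moreover have "D x s = w *\<^sub>C Bx (x, s)" for s by (simp add: D_def)
  ultimately show ?thesis by (simp add: g_def)
qed

definition F :: "complex \<Rightarrow> real \<times> real \<Rightarrow> cmat2" where
  "F z p = Qf (t0, z) (fst p) ** Mf (fst p, inverse z) (snd p)"

lemma F_t0: "F z (t0, t0) = mat 1"
  by (simp add: F_def Mf_t0 Qf_t0 t0)

lemma det_F: "p \<in> II \<Longrightarrow> det (F z p) = 1"
  by (auto simp: F_def det_mul det_Mf det_Qf t0)

text \<open>The y-equation is built into \<open>F\<close>. The x-equation is built in only on the
  line y = t0; zero curvature propagates it along the vertical lines.\<close>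

lemma F_partials:
  assumes z: "z \<noteq> 0"
  shows "partials_on (F z) (\<lambda>p. F z p ** U z p) (\<lambda>p. F z p ** (inverse z *\<^sub>C B p))"
  unfolding partials_on_def
proof (intro ballI conjI)
  fix x y assume x: "x \<in> I" and y: "y \<in> I"
  let ?w = "inverse z"
  show "((\<lambda>s. F z (x, s)) has_vector_derivative F z (x, y) ** (inverse z *\<^sub>C B (x, y))) (at y)"
    using has_vector_derivative_matmul[OF has_vector_derivative_const Mf_deriv[OF x y, of ?w], of "Qf (t0, z) x"]
    by (simp add: F_def matrix_mul_assoc matmul_zero_left)
  let ?M = "Mf (x, ?w)"
  \<comment> \<open>By \<open>Mf_deriv_x\<close>, \<open>S y ** ?M y\<close> is the x-derivative of
    the vertical factor.\<close>
  define S where "S v = prim t0 (\<lambda>s. ?M s ** (?w *\<^sub>C Bx (x, s)) ** adj2 (?M s)) v" for v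
  have cS: "continuous_on I (\<lambda>s. ?M s ** (?w *\<^sub>C Bx (x, s)) ** adj2 (?M s))"
    using fundamental_continuous[OF Mf_fundamental[OF x]] continuous_on_slices(2)[OF continuous_Bx x]
    by (intro continuous_on_matmul continuous_on_cscale continuous_on_const continuous_on_adj2)
  \<comment> \<open>The conjugate of U by M and the integral S have the same y-derivative: this is
    the zero curvature equation conjugated by M.\<close>
  have "((\<lambda>v. ?M v ** U z (x, v) ** adj2 (?M v) - S v) has_vector_derivative 0) (at v)" if v: "v \<in> I" for v
  proof -
    let ?W = "?w *\<^sub>C B (x, v)"
    have dM: "(?M has_vector_derivative ?M v ** ?W) (at v)" by (rule Mf_deriv[OF x v])
    have dA: "((\<lambda>v. adj2 (?M v)) has_vector_derivative - (?W ** adj2 (?M v))) (at v)"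
      by (rule fundamental_adj2_deriv[OF Mf_fundamental[OF x] _ v]) (simp add: trace_cscale)
    have "((\<lambda>v. ?M v ** U z (x, v) ** adj2 (?M v) - S v) has_vector_derivative
       (?M v ** U z (x, v)) ** - (?W ** adj2 (?M v)) + (?M v ** (\<beta>2 (x, v) *\<^sub>R e3) + (?M v ** ?W) ** U z (x, v)) ** adj2 (?M v)
       - ?M v ** (?w *\<^sub>C Bx (x, v)) ** adj2 (?M v)) (at v)"
      unfolding S_def
      by (intro has_vector_derivative_diff has_vector_derivative_matmul dM dA U_deriv_y x v
          has_vector_derivative_prim[OF cS t0 v])
    moreover have "(?M v ** U z (x, v)) ** - (?W ** adj2 (?M v)) + (?M v ** (\<beta>2 (x, v) *\<^sub>R e3) + (?M v ** ?W) ** U z (x, v)) ** adj2 (?M v)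
       - ?M v ** (?w *\<^sub>C Bx (x, v)) ** adj2 (?M v)
       = ?M v ** (?W ** U z (x, v) + \<beta>2 (x, v) *\<^sub>R e3 - U z (x, v) ** ?W - ?w *\<^sub>C Bx (x, v)) ** adj2 (?M v)"
      by (simp add: matmul_diff_left matmul_diff_right matmul_minus_right matmul_add_left matmul_add_right matrix_mul_assoc)
    moreover have "\<dots> = 0"
      using zero_curvature[of z ?w "(x, v)"] z by (simp add: matmul_zero_left matmul_zero_right)
    ultimately show ?thesis by simp
  qed
  from constant_on_I[OF this t0 y]
  have "?M y ** U z (x, y) ** adj2 (?M y) - S y = U z (x, t0)"
    by (simp add: S_def Mf_t0 x)
  then have "?M y ** U z (x, y) ** adj2 (?M y) = U z (x, t0) + S y"
    by (simp add: diff_eq_eq)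
  from arg_cong[OF this, of "\<lambda>A. A ** ?M y"]
  have key: "U z (x, t0) ** ?M y + S y ** ?M y = ?M y ** U z (x, y)"
    by (simp add: adj2_inverse det_Mf x y matmul_add_left matrix_mul_assoc[symmetric])
  have "((\<lambda>s. F z (s, y)) has_vector_derivative Qf (t0, z) x ** (S y ** ?M y) + (Qf (t0, z) x ** U z (x, t0)) ** ?M y) (at x)"
    unfolding F_def fst_conv snd_conv S_def
    by (intro has_vector_derivative_matmul Qf_deriv Mf_deriv_x t0 x y)
  moreover have "Qf (t0, z) x ** (S y ** ?M y) + (Qf (t0, z) x ** U z (x, t0)) ** ?M y = F z (x, y) ** U z (x, y)"
    unfolding F_def fst_conv snd_conv matrix_mul_assoc[symmetric] matrix_add_ldistrib[symmetric]
    using key by (simp add: add.commute)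
  ultimately show "((\<lambda>s. F z (s, y)) has_vector_derivative F z (x, y) ** U z (x, y)) (at x)" by simp
qed

lemma continuous_F: "continuous_on II (F z)"
  unfolding F_def[abs_def]
  by (intro continuous_on_matmul continuous_on_Qf continuous_on_Mf continuous_on_fst continuous_on_snd
      continuous_on_id continuous_on_const) (use t0 in auto)

lemma Ck_F: "z \<noteq> 0 \<Longrightarrow> Ck_on k (F z) II"
proof (induction k)
  case 0
  then show ?case by (simp add: continuous_F)
next
  case (Suc k)
  show ?case
    by (rule Ck_on_partials[OF F_partials[OF Suc.prems]])
       (intro Ck_on_bilinear[OF bounded_bilinear_matmul open_II] Ck_on_linear[OF bounded_bilinear.bounded_linear_right[OF bounded_bilinear_cscale] open_II]
         Suc Ck_U Ck_B)+
qed

text \<open>By the chain rule the coefficients of the two directions add up on the diagonal, and the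
  sum has exactly the powers 1, 0, -1 of z that a potential may share between x and y.\<close>

lemma F_diagonal:
  assumes "z \<noteq> 0" "t \<in> I"
  shows "((\<lambda>s. F z (s, s)) has_vector_derivative F z (t, t) ** (U z (t, t) + inverse z *\<^sub>C B (t, t))) (at t)"
proof -
  have "continuous_on II (\<lambda>p. F z p ** (inverse z *\<^sub>C B p))"
    by (intro continuous_on_matmul continuous_F continuous_on_cscale continuous_on_const continuous_B)
  from has_derivative_imp_diagonal[OF partials_imp_has_derivative[OF F_partials[OF assms(1)] this, of "(t, t)"]] assms(2)
  show ?thesis by (simp add: matrix_add_ldistrib)
qed

text \<open>A second factorisation of the frame, with the x-direction travelled last. It comes from
  uniqueness for the x-equation on the line through y.\<close>

lemma F_eq_Qf:
  assumes "z \<noteq> 0" "x \<in> I" "y \<in> I"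
  shows "F z (x, y) = F z (t0, y) ** Qf (y, z) x"
  by (rule fundamental_unique[where Z = "\<lambda>x. F z (x, y)", OF Qf_fundamental[OF assms(3)] _
        continuous_on_slices(1)[OF continuous_U assms(3)] t0 assms(2) partials_onD(1)[OF F_partials[OF assms(1)] _ assms(3)]]) simp_all

lemma F_eq_Mf: "x \<in> I \<Longrightarrow> F z (x, y) = F z (x, t0) ** Mf (x, inverse z) y"
  by (simp add: F_def Mf_t0)

text \<open>The left factor F(x,t0) is the only part that involves z itself, and it cancels, so that
  a function of 1/z is left. In \<open>F_quotient_Qf\<close> the factor F(t0,y), which carries the
  powers of 1/z, cancels in the same way.\<close>

lemma F_quotient_Mf:
  assumes "x \<in> I" "y \<in> I"
  shows "adj2 (F z (x, x)) ** F z (x, y) = adj2 (Mf (x, inverse z) x) ** Mf (x, inverse z) y"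
proof -
  have "adj2 (F z (x, x)) ** F z (x, y) =
      adj2 (Mf (x, inverse z) x) ** (adj2 (F z (x, t0)) ** F z (x, t0)) ** Mf (x, inverse z) y"
    by (subst (1 2) F_eq_Mf[OF assms(1)]) (simp add: adj2_matmul matrix_mul_assoc)
  then show ?thesis using assms t0 by (simp add: adj2_inverse det_F)
qed

lemma F_quotient_Qf:
  assumes "z \<noteq> 0" "x \<in> I" "y \<in> I"
  shows "adj2 (F z (x, y)) ** F z (y, y) = adj2 (Qf (y, z) x) ** Qf (y, z) y"
proof -
  have "adj2 (F z (x, y)) ** F z (y, y) =
      adj2 (Qf (y, z) x) ** (adj2 (F z (t0, y)) ** F z (t0, y)) ** Qf (y, z) y"
    using F_eq_Qf[OF assms] F_eq_Qf[OF assms(1,3,3)] by (simp add: adj2_matmul matrix_mul_assoc)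
  then show ?thesis using assms t0 by (simp add: adj2_inverse det_F)
qed

lemma Mf_cmat_deriv:
  assumes "x \<in> I" "y \<in> I"
  shows "cmat_deriv (\<lambda>w. Mf (x, w) y)
    (prim t0 (\<lambda>s. Mf (x, w) s ** B (x, s) ** adj2 (Mf (x, w) s)) y ** Mf (x, w) y) w"
proof (rule spectral_deriv[where C = "\<lambda>_. 0"])
  show "continuous_on (UNIV \<times> I) (\<lambda>(z, s). Mf (x, z) s)"
    unfolding case_prod_unfold using assms(1)
    by (intro continuous_on_Mf continuous_on_const continuous_on_fst continuous_on_snd continuous_on_id) auto
qed (use Mf_fundamental assms t0 continuous_on_slices(2)[OF continuous_B] in \<open>auto simp: trace2[of 0]\<close>)

lemma Qf_cmat_deriv:
  assumes "x \<in> I" "y \<in> I"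
  shows "cmat_deriv (\<lambda>z. Qf (y, z) x)
    (prim t0 (\<lambda>s. Qf (y, z) s ** e1 ** adj2 (Qf (y, z) s)) x ** Qf (y, z) x) z"
proof (rule spectral_deriv[where C = "\<lambda>s. c (s, y) *\<^sub>R e3" and ?A1.0 = "\<lambda>_. e1"])
  show "continuous_on (UNIV \<times> I) (\<lambda>(z, s). Qf (y, z) s)"
    unfolding case_prod_unfold using assms(2)
    by (intro continuous_on_Qf continuous_on_const continuous_on_fst continuous_on_snd continuous_on_id) auto
  show "fundamental t0 (\<lambda>s. c (s, y) *\<^sub>R e3 + z *\<^sub>C e1) (Qf (y, z))" for z
    using Qf_fundamental[OF assms(2), of z] by (simp add: U_def)
  show "continuous_on I (\<lambda>s. c (s, y) *\<^sub>R e3)"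
    using continuous_on_slices(1)[OF continuous_c assms(2)] by (intro continuous_on_scaleR continuous_on_const)
qed (use assms t0 in \<open>auto simp: trace2 scaleR_nth2 simp del: vector_scaleR_component\<close>)

text \<open>The Sym formula, along the path from \<open>(t0, t0)\<close> via \<open>(x, t0)\<close> to \<open>(x, y)\<close>.\<close>

lemma F_cmat_deriv:
  assumes x: "x \<in> I" and y: "y \<in> I"
  shows "cmat_deriv (\<lambda>z. F z (x, y))
    ((prim t0 (\<lambda>s. F 1 (s, t0) ** e1 ** adj2 (F 1 (s, t0))) x
      - prim t0 (\<lambda>s. F 1 (x, s) ** B (x, s) ** adj2 (F 1 (x, s))) y) ** F 1 (x, y)) 1"
proof -
  let ?Q = "Qf (t0, 1) x" and ?M = "Mf (x, 1)"
  have FQ: "F 1 (s, t0) = Qf (t0, 1) s" if "s \<in> I" for s using that by (simp add: F_def Mf_t0)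
  have FM: "F 1 (x, s) = ?Q ** ?M s" for s by (simp add: F_def)
  define J where "J = prim t0 (\<lambda>s. ?M s ** B (x, s) ** adj2 (?M s)) y"
  define K where "K = prim t0 (\<lambda>s. Qf (t0, 1) s ** e1 ** adj2 (Qf (t0, 1) s)) x"
  have cJ: "continuous_on I (\<lambda>s. ?M s ** B (x, s) ** adj2 (?M s))"
    using fundamental_continuous[OF Mf_fundamental[OF x]] continuous_on_slices(2)[OF continuous_B x]
    by (intro continuous_on_matmul continuous_on_adj2)
  have l: "bounded_linear (\<lambda>A. ?Q ** A ** adj2 ?Q)"
    by (rule bounded_linear_compose[OF bounded_linear_matmul_left bounded_linear_matmul_right])
  have "prim t0 (\<lambda>s. F 1 (x, s) ** B (x, s) ** adj2 (F 1 (x, s))) y = ?Q ** J ** adj2 ?Q"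
    using prim_linear[OF l cJ t0 y] unfolding J_def FM adj2_matmul by (simp add: matrix_mul_assoc)
  moreover have "prim t0 (\<lambda>s. F 1 (s, t0) ** e1 ** adj2 (F 1 (s, t0))) x = K"
    unfolding K_def by (rule prim_cong[OF _ t0 x]) (simp add: FQ)
  moreover have "cmat_deriv (\<lambda>w. Mf (x, w) y) (J ** ?M y) (inverse 1)"
    using Mf_cmat_deriv[OF x y, of 1] by (simp add: J_def)
  \<comment> \<open>The derivative of 1/z at 1 is -1. This is the source of the opposite sign of the
    y-integral, and so of the sign in f_y.\<close>
  then have "cmat_deriv (\<lambda>z. Mf (x, inverse z) y) ((- inverse (1 ^ 2)) *\<^sub>C (J ** ?M y)) 1"
    by (rule cmat_deriv_inverse) simp
  from cmat_deriv_matmul[OF Qf_cmat_deriv[OF x t0, of 1] this]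
  have "cmat_deriv (\<lambda>z. F z (x, y)) ((K ** ?Q) ** ?M y + ?Q ** ((- 1) *\<^sub>C (J ** ?M y))) 1"
    by (simp add: F_def K_def)
  moreover have "(K ** ?Q) ** ?M y + ?Q ** ((- 1) *\<^sub>C (J ** ?M y)) = (K - ?Q ** J ** adj2 ?Q) ** (?Q ** ?M y)"
  proof -
    have "(?Q ** J ** adj2 ?Q) ** (?Q ** ?M y) = ?Q ** J ** (adj2 ?Q ** ?Q) ** ?M y"
      by (simp only: matrix_mul_assoc)
    also have "\<dots> = ?Q ** J ** ?M y" by (simp add: adj2_inverse det_Qf t0 x)
    finally have e: "(?Q ** J ** adj2 ?Q) ** (?Q ** ?M y) = ?Q ** J ** ?M y" .
    have "(- 1) *\<^sub>C A = - A" for A by (simp add: mat2_eq_iff)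
    then show ?thesis unfolding matmul_diff_left e by (simp add: matmul_minus_right matrix_mul_assoc)
  qed
  ultimately show ?thesis by (simp add: FM)
qed

end

section \<open>Loops and the d'Alembert data\<close>

lemma conj_transpose_nth [simp]: "conj_transpose A $ i $ j = cnj (A $ j $ i)"
  by (simp add: conj_transpose_def)

lemma Pmat_nth [simp]: "Pmat $ 1 $ 1 = -1" "Pmat $ 1 $ 2 = 0" "Pmat $ 2 $ 1 = 0" "Pmat $ 2 $ 2 = 1"
  by (simp_all add: Pmat_def)

lemma Pmat_square: "Pmat ** Pmat = mat 1"
  by (simp add: mat2_simps)

lemma matrix_inv_unique2: "A ** B = mat 1 \<Longrightarrow> matrix_inv A = B" for A B :: cmat2
  unfolding matrix_inv_def
  by (rule some_equality) (metis matrix_left_right_inverse matrix_mul_assoc matrix_mul_lid matrix_mul_rid)+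

lemma Ad_Pmat: "Ad Pmat A = Pmat ** A ** Pmat"
  by (simp add: Ad_def matrix_inv_unique2[OF Pmat_square])

lemma Pmat_conj_nth [simp]:
  "(Pmat ** A ** Pmat) $ 1 $ 1 = A $ 1 $ 1" "(Pmat ** A ** Pmat) $ 1 $ 2 = - A $ 1 $ 2"
  "(Pmat ** A ** Pmat) $ 2 $ 1 = - A $ 2 $ 1" "(Pmat ** A ** Pmat) $ 2 $ 2 = A $ 2 $ 2"
  by (simp_all add: matmul2_nth)

lemma Pmat_conj_matmul: "(Pmat ** A ** Pmat) ** (Pmat ** B ** Pmat) = Pmat ** (A ** B) ** Pmat"
  unfolding mat2_eq_iff Pmat_conj_nth by (simp only: matmul2_nth[of "Pmat ** A ** Pmat"] Pmat_conj_nth matmul2_nth[of A]) simp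

lemma conj_transpose_matmul: "conj_transpose (A ** B) = conj_transpose B ** conj_transpose A"
  by (simp add: mat2_eq_iff matmul2_nth mult.commute)

lemma conj_transpose_adj2: "conj_transpose (adj2 A) = adj2 (conj_transpose A)"
  by (simp add: mat2_simps)

lemma det_conj_transpose: "det (conj_transpose A) = cnj (det A)"
  by (simp add: det_2)

lemma bounded_linear_conj_transpose: "bounded_linear conj_transpose"
  unfolding linear_conv_bounded_linear[symmetric]
  by (rule linearI) (simp_all add: mat2_eq_iff scaleR_nth2 del: vector_scaleR_component)

text \<open>The group identities are asked on the whole plane, not only on the circle. Holomorphy at
  0 supplies the power series of a plus loop and, after z \<mapsto> 1/z, of a minus loop.\<close>

definition entire_loop :: "loop \<Rightarrow> bool" where
  "entire_loop G \<longleftrightarrow> (\<forall>i j. (\<lambda>z. G z $ i $ j) holomorphic_on UNIV) \<and>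
     (\<forall>z. det (G z) = 1 \<and> G (- z) = Pmat ** G z ** Pmat \<and> G z ** conj_transpose (G (cnj z)) = mat 1)"

text \<open>Holomorphy away from 0 admits products of functions of z with functions of 1/z, such as
  the frame itself.\<close>

definition punctured_loop :: "loop \<Rightarrow> bool" where
  "punctured_loop G \<longleftrightarrow> (\<forall>i j. (\<lambda>z. G z $ i $ j) holomorphic_on - {0}) \<and>
     (\<forall>z. z \<noteq> 0 \<longrightarrow> det (G z) = 1 \<and> G (- z) = Pmat ** G z ** Pmat \<and> G z ** conj_transpose (G (cnj z)) = mat 1)"

lemma entire_loop_imp_punctured: "entire_loop G \<Longrightarrow> punctured_loop G"
  unfolding entire_loop_def punctured_loop_def by (auto intro: holomorphic_on_subset)

lemma entire_loop_inverse:
  assumes "entire_loop G"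
  shows "punctured_loop (\<lambda>z. G (inverse z))"
  unfolding punctured_loop_def
proof (intro conjI allI impI)
  fix i j
  have "((\<lambda>z. G z $ i $ j) \<circ> inverse) holomorphic_on - {0}"
    by (rule holomorphic_on_compose_gen[where t = UNIV])
       (use assms in \<open>auto simp: entire_loop_def intro!: holomorphic_intros\<close>)
  then show "(\<lambda>z. G (inverse z) $ i $ j) holomorphic_on - {0}" by (simp add: o_def)
qed (use assms in \<open>simp_all add: entire_loop_def flip: complex_cnj_inverse\<close>)

lemma unitary_matmul:
  assumes "A ** conj_transpose A' = mat 1" "B ** conj_transpose B' = mat 1"
  shows "(A ** B) ** conj_transpose (A' ** B') = mat 1"
proof -
  have "(A ** B) ** conj_transpose (A' ** B') = A ** (B ** conj_transpose B') ** conj_transpose A'"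
    by (simp add: conj_transpose_matmul matrix_mul_assoc)
  then show ?thesis using assms by simp
qed

lemma entire_loop_matmul:
  assumes "entire_loop G" "entire_loop H"
  shows "entire_loop (\<lambda>z. G z ** H z)"
  unfolding entire_loop_def
proof (intro conjI allI)
  show "(\<lambda>z. (G z ** H z) $ i $ j) holomorphic_on UNIV" for i j
    unfolding matmul2_nth using assms by (auto simp: entire_loop_def intro!: holomorphic_intros)
qed (use assms in \<open>simp_all add: entire_loop_def det_mul unitary_matmul Pmat_conj_matmul\<close>)

lemma punctured_loop_matmul:
  assumes "punctured_loop G" "punctured_loop H"
  shows "punctured_loop (\<lambda>z. G z ** H z)"
  unfolding punctured_loop_def
proof (intro conjI allI impI)
  show "(\<lambda>z. (G z ** H z) $ i $ j) holomorphic_on - {0}" for i j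
    unfolding matmul2_nth using assms by (auto simp: punctured_loop_def intro!: holomorphic_intros)
qed (use assms in \<open>simp_all add: punctured_loop_def det_mul unitary_matmul Pmat_conj_matmul\<close>)

lemma entire_loop_adj2:
  assumes G: "entire_loop G"
  shows "entire_loop (\<lambda>z. adj2 (G z))"
  unfolding entire_loop_def
proof (intro conjI allI)
  fix i j :: 2
  have h: "(\<lambda>z. G z $ i $ j) holomorphic_on UNIV" for i j using G by (simp add: entire_loop_def)
  show "(\<lambda>z. adj2 (G z) $ i $ j) holomorphic_on UNIV"
    using exhaust_2[of i] exhaust_2[of j] by (auto intro!: holomorphic_intros h)
  fix z
  show "det (adj2 (G z)) = 1" using G by (simp add: entire_loop_def)
  have "G (- z) = Pmat ** G z ** Pmat" using G by (simp add: entire_loop_def)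
  then show "adj2 (G (- z)) = Pmat ** adj2 (G z) ** Pmat"
    unfolding mat2_eq_iff Pmat_conj_nth adj2_nth by simp
  have "G z ** conj_transpose (G (cnj z)) = mat 1" using G by (simp add: entire_loop_def)
  then have "conj_transpose (G (cnj z)) ** G z = mat 1" by (simp add: matrix_left_right_inverse)
  from arg_cong[OF this, of adj2] show "adj2 (G z) ** conj_transpose (adj2 (G (cnj z))) = mat 1"
    by (simp add: adj2_matmul conj_transpose_adj2)
qed

lemma punctured_loop_in_loop_group:
  assumes G: "punctured_loop G"
  shows "G \<in> loop_group"
  unfolding loop_group_def mem_Collect_eq
proof (intro conjI ballI)
  show "extends_to_annulus G"
    unfolding extends_to_annulus_def
  proof (intro exI conjI)
    show "\<forall>i j. (\<lambda>z. G z $ i $ j) holomorphic_on {z. 1/2 < norm z \<and> norm z < 2}"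
    proof (intro allI, rule holomorphic_on_subset)
      show "(\<lambda>z. G z $ i $ j) holomorphic_on - {0}" for i j
        using G by (simp add: punctured_loop_def)
    qed auto
  qed auto
  fix z :: complex assume "z \<in> sphere 0 1"
  then have z: "z \<noteq> 0" by auto
  show "det (G z) = 1" using G z by (simp add: punctured_loop_def)
  have "G (- (- z)) = Pmat ** G (- z) ** Pmat" using G z unfolding punctured_loop_def by (metis neg_equal_0_iff_equal)
  then show "G z = Ad Pmat (G (- z))" by (simp add: Ad_Pmat)
  have "conj_transpose (G (cnj z)) ** G z = mat 1"
    using G z by (simp add: punctured_loop_def matrix_left_right_inverse)
  then show "G z = matrix_inv (conj_transpose (G (cnj z)))"
    by (simp add: matrix_inv_unique2)
qed

lemma has_sum_cmat2:
  fixes f :: "'n \<Rightarrow> cmat2"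
  assumes "\<And>i j. ((\<lambda>n. f n $ i $ j) has_sum S $ i $ j) X"
  shows "(f has_sum S) X"
  unfolding has_sum_def
  by (intro vec_tendstoI) (use assms in \<open>simp add: has_sum_def\<close>)

lemma entire_loop_power_series:
  assumes "entire_loop G"
  obtains A :: "nat \<Rightarrow> cmat2" where "A 0 = G 0"
    "\<And>z. norm z = 1 \<Longrightarrow> ((\<lambda>n. (z ^ n) *\<^sub>C A n) has_sum G z) UNIV"
proof -
  define A :: "nat \<Rightarrow> cmat2" where "A n = (\<chi> i j. (deriv ^^ n) (\<lambda>z. G z $ i $ j) 0 / fact n)" for n
  have "((\<lambda>n. (z ^ n) *\<^sub>C A n) has_sum G z) UNIV" if z: "norm z = 1" for z
  proof (rule has_sum_cmat2)
    fix i j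
    have h: "(\<lambda>z. G z $ i $ j) holomorphic_on ball 0 2"
      using assms by (auto simp: entire_loop_def intro: holomorphic_on_subset)
    have s: "(\<lambda>n. A n $ i $ j * w ^ n) sums G w $ i $ j" if "norm w < 2" for w
      using holomorphic_power_series[OF h, of w] that by (simp add: A_def)
    \<comment> \<open>The unordered sum on the unit circle needs absolute convergence; convergence
      at radius 3/2, strictly outside the circle, provides it.\<close>
    have "summable (\<lambda>n. norm (A n $ i $ j * z ^ n))"
      by (rule powser_insidea[of _ "of_real (3/2)"]) (use s[of "of_real (3/2)"] z in \<open>auto simp: sums_iff\<close>)
    from norm_summable_imp_has_sum[OF this s] z
    show "((\<lambda>n. ((z ^ n) *\<^sub>C A n) $ i $ j) has_sum G z $ i $ j) UNIV"
      by (simp add: mult.commute)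
  qed
  moreover have "A 0 = G 0" by (simp add: A_def vec_eq_iff)
  ultimately show thesis using that by blast
qed

lemma entire_loop_plus:
  assumes "entire_loop G"
  shows "G \<in> loop_group_plus"
proof -
  obtain A :: "nat \<Rightarrow> cmat2" where A: "\<And>z. norm z = 1 \<Longrightarrow> ((\<lambda>n. (z ^ n) *\<^sub>C A n) has_sum G z) UNIV"
    using entire_loop_power_series[OF assms] by metis
  have bij: "bij_betw int UNIV {0..}"
    by (rule bij_betw_byWitness[where f' = nat]) auto
  have "laurent_on_circle {0..} (\<lambda>m. A (nat m)) G"
    unfolding laurent_on_circle_def has_sum_reindex_bij_betw[OF bij, symmetric]
    using A by (simp add: power_int_of_nat)
  then show ?thesis
    unfolding loop_group_plus_def
    using punctured_loop_in_loop_group[OF entire_loop_imp_punctured[OF assms]] by blast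
qed

text \<open>The value of G at 0 is the constant coefficient of the series in 1/z, so G(0) = I is the
  normalisation of the minus factor.\<close>

lemma entire_loop_minus:
  assumes "entire_loop G" "G 0 = mat 1"
  shows "(\<lambda>z. G (inverse z)) \<in> loop_group_minus_star"
proof -
  obtain A :: "nat \<Rightarrow> cmat2" where A0: "A 0 = G 0"
    and A: "\<And>z. norm z = 1 \<Longrightarrow> ((\<lambda>n. (z ^ n) *\<^sub>C A n) has_sum G z) UNIV"
    using entire_loop_power_series[OF assms(1)] by metis
  have bij: "bij_betw (\<lambda>n. - int n) UNIV {..0}"
    by (rule bij_betw_byWitness[where f' = "\<lambda>m. nat (- m)"]) auto
  have "laurent_on_circle {..0} (\<lambda>m. A (nat (- m))) (\<lambda>z. G (inverse z))"
    unfolding laurent_on_circle_def has_sum_reindex_bij_betw[OF bij, symmetric]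
  proof
    fix z :: complex assume "z \<in> sphere 0 1"
    then have "norm (inverse z) = 1" by (simp add: norm_inverse)
    from A[OF this] show "((\<lambda>n. (z powi (- int n)) *\<^sub>C A (nat (- (- int n)))) has_sum G (inverse z)) UNIV"
      by (simp add: power_int_minus power_inverse)
  qed
  moreover have "A (nat (- 0)) = mat 1" using A0 assms(2) by simp
  ultimately show ?thesis
    unfolding loop_group_minus_star_def
    using punctured_loop_in_loop_group[OF entire_loop_inverse[OF assms(1)]]
    by (intro CollectI conjI exI[of _ "\<lambda>m. A (nat (- m))"]) auto
qed

text \<open>\<open>loop_deriv\<close> selects a derivative along the circle by definite description.
  Since 1 is a limit point of the circle, that derivative is unique and the complex one is
  it.\<close>

lemma loop_deriv_eq:
  assumes "cmat_deriv \<gamma> D 1"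
  shows "loop_deriv \<gamma> 1 = D"
proof -
  have "(1::complex) islimpt sphere 0 1"
  proof (rule connected_imp_perfect)
    show "connected (sphere (0::complex) 1)" by (rule connected_sphere) simp
    show "sphere (0::complex) 1 \<noteq> {x}" for x
    proof
      assume "sphere (0::complex) 1 = {x}"
      then have "1 \<in> {x}" "-1 \<in> {x}" by (metis dist_0_norm mem_sphere norm_one, metis dist_0_norm mem_sphere norm_one norm_minus_cancel)
      then show False by auto
    qed
  qed simp
  then have nt: "at (1::complex) within sphere 0 1 \<noteq> bot" by (simp add: trivial_limit_within)
  have "(THE D. ((\<lambda>w. \<gamma> w $ i $ j) has_field_derivative D) (at 1 within sphere 0 1)) = D $ i $ j" for i j
  proof (rule the_equality)
    show D: "((\<lambda>w. \<gamma> w $ i $ j) has_field_derivative D $ i $ j) (at 1 within sphere 0 1)"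
      using assms by (auto simp: cmat_deriv_def intro: has_field_derivative_at_within)
    show "D' = D $ i $ j" if "((\<lambda>w. \<gamma> w $ i $ j) has_field_derivative D') (at 1 within sphere 0 1)" for D'
      by (rule tendsto_unique[OF nt that[unfolded has_field_derivative_iff] D[unfolded has_field_derivative_iff]])
  qed
  then show ?thesis by (simp add: loop_deriv_def vec_eq_iff)
qed

text \<open>Symmetries of the coefficient pass to the solution: its transform by each symmetry
  solves the same equation with the same initial value, so uniqueness applies.\<close>

lemma (in open_interval) entire_loop_fundamental:
  fixes A :: "complex \<Rightarrow> real \<Rightarrow> cmat2"
  assumes Y: "\<And>z. fundamental t0 (A z) (Y z)" and c: "\<And>z. continuous_on I (A z)"
    and tr: "\<And>z s. s \<in> I \<Longrightarrow> trace (A z s) = 0"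
    and tw: "\<And>z s. s \<in> I \<Longrightarrow> A (- z) s = Pmat ** A z s ** Pmat"
    and sk: "\<And>z s. s \<in> I \<Longrightarrow> conj_transpose (A (cnj z) s) = - A z s"
    and d: "\<And>z. \<exists>D. cmat_deriv (\<lambda>z. Y z t) D z" and t0: "t0 \<in> I" and t: "t \<in> I"
  shows "entire_loop (\<lambda>z. Y z t)"
  unfolding entire_loop_def
proof (intro conjI allI)
  show "(\<lambda>z. Y z t $ i $ j) holomorphic_on UNIV" for i j
    using d unfolding cmat_deriv_def holomorphic_on_def field_differentiable_def
    by (metis has_field_derivative_at_within)
  fix z
  have dY: "(Y w has_vector_derivative Y w s ** A w s) (at s)" if "s \<in> I" for w s
    using Y[of w] that unfolding fundamental_def by blast
  have Y0: "Y w t0 = mat 1" for w using Y[of w] unfolding fundamental_def by blast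
  show "det (Y z t) = 1" by (rule fundamental_det[OF Y tr t0 t])
  have "Pmat ** Y z t ** Pmat = (Pmat ** Y z t0 ** Pmat) ** Y (- z) t"
  proof (rule fundamental_unique[OF Y tr c t0 t, where Z = "\<lambda>t. Pmat ** Y z t ** Pmat"])
    fix s assume s: "s \<in> I"
    have "bounded_linear (\<lambda>X. Pmat ** X ** Pmat)"
      by (rule bounded_linear_compose[OF bounded_linear_matmul_left bounded_linear_matmul_right])
    from bounded_linear.has_vector_derivative[OF this dY[OF s]]
    show "((\<lambda>t. Pmat ** Y z t ** Pmat) has_vector_derivative (Pmat ** Y z s ** Pmat) ** A (- z) s) (at s)"
      by (simp add: tw[OF s] Pmat_conj_matmul)
  qed
  then show "Y (- z) t = Pmat ** Y z t ** Pmat" by (simp add: Y0 Pmat_square)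
  \<comment> \<open>The inverse of the conjugate transpose. Skewness of the coefficient makes it a
    solution at parameter z.\<close>
  let ?Z = "\<lambda>t. adj2 (conj_transpose (Y (cnj z) t))"
  have "?Z t = ?Z t0 ** Y z t"
  proof (rule fundamental_unique[OF Y tr c t0 t, where Z = ?Z])
    fix s assume s: "s \<in> I"
    have "adj2 (- A z s) = A z s" by (simp add: linear_neg[OF bounded_linear.linear[OF bounded_linear_adj2]] adj2_traceless[OF tr[OF s]])
    then show "(?Z has_vector_derivative ?Z s ** A z s) (at s)"
      using has_vector_derivative_adj2[OF bounded_linear.has_vector_derivative[OF bounded_linear_conj_transpose dY[OF s, of "cnj z"]]]
      by (simp add: conj_transpose_matmul adj2_matmul sk[OF s])
  qed
  moreover have "conj_transpose (mat 1) = mat 1" by (simp add: mat2_eq_iff mat_1_nth2)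
  ultimately have "Y z t = ?Z t" by (simp add: Y0)
  moreover have "?Z t ** conj_transpose (Y (cnj z) t) = mat 1"
    using fundamental_det[OF Y tr t0 t, of "cnj z"] by (intro adj2_inverse(2)) (simp add: det_conj_transpose)
  ultimately show "Y z t ** conj_transpose (Y (cnj z) t) = mat 1" by simp
qed

section \<open>The Birkhoff factors of the frame as loops\<close>

context angle_frame
begin

lemma B_symmetries:
  "- B p = Pmat ** B p ** Pmat" "conj_transpose (B p) = - B p"
  unfolding mat2_eq_iff Pmat_conj_nth by (simp_all add: B_def scaleR_nth2 del: vector_scaleR_component)

lemma U_symmetries:
  "U (- z) p = Pmat ** U z p ** Pmat" "conj_transpose (U (cnj z) p) = - U z p"
  unfolding mat2_eq_iff Pmat_conj_nth by (simp_all add: U_def scaleR_nth2 del: vector_scaleR_component)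

lemma entire_loop_Mf:
  assumes "x \<in> I" "y \<in> I"
  shows "entire_loop (\<lambda>w. Mf (x, w) y)"
proof (rule entire_loop_fundamental[OF Mf_fundamental[OF assms(1)] _ _ _ _ _ t0 assms(2)])
  show "continuous_on I (\<lambda>s. w *\<^sub>C B (x, s))" for w
    using continuous_on_slices(2)[OF continuous_B assms(1)] by (intro continuous_on_cscale continuous_on_const)
  show "(- w) *\<^sub>C B (x, s) = Pmat ** (w *\<^sub>C B (x, s)) ** Pmat" for w s
    using B_symmetries(1)[of "(x, s)"] unfolding mat2_eq_iff Pmat_conj_nth by simp
  show "conj_transpose (cnj w *\<^sub>C B (x, s)) = - (w *\<^sub>C B (x, s))" for w s
    using B_symmetries(2)[of "(x, s)"] unfolding mat2_eq_iff by simp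
  show "\<exists>D. cmat_deriv (\<lambda>z. Mf (x, z) y) D z" for z using Mf_cmat_deriv[OF assms] by blast
qed (simp_all add: trace_cscale)

lemma entire_loop_Qf:
  assumes "x \<in> I" "y \<in> I"
  shows "entire_loop (\<lambda>z. Qf (y, z) x)"
proof (rule entire_loop_fundamental[OF Qf_fundamental[OF assms(2)] _ _ _ _ _ t0 assms(1)])
  show "\<exists>D. cmat_deriv (\<lambda>z. Qf (y, z) x) D z" for z using Qf_cmat_deriv[OF assms] by blast
qed (simp_all add: U_symmetries continuous_on_slices(1)[OF continuous_U assms(2)])

lemma punctured_loop_F:
  assumes "p \<in> II"
  shows "punctured_loop (\<lambda>z. F z p)"
  unfolding F_def
  by (intro punctured_loop_matmul entire_loop_imp_punctured entire_loop_Qf entire_loop_inverse entire_loop_Mf)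
     (use assms t0 in auto)

text \<open>At w = 0, that is z = \<infinity>, the vertical equation has zero coefficient. This
  normalises the minus factor.\<close>

lemma Mf_0:
  assumes "x \<in> I" "y \<in> I"
  shows "Mf (x, 0) y = mat 1"
proof -
  have "0 *\<^sub>C A = 0" for A by (simp add: mat2_eq_iff)
  then have "Mf (x, 0) y = Mf (x, 0) t0"
    using Mf_deriv[OF assms(1), of _ 0] by (intro constant_on_I[OF _ t0 assms(2)]) (simp add: matmul_zero_right)
  then show ?thesis by (simp add: Mf_t0 assms)
qed

text \<open>The value at z = 1 of the logarithmic derivative of F in z, as computed in
  \<open>F_cmat_deriv\<close>.\<close>

definition sym_formula :: "real \<times> real \<Rightarrow> cmat2" where
  "sym_formula p = prim t0 (\<lambda>s. F 1 (s, t0) ** e1 ** adj2 (F 1 (s, t0))) (fst p)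
      - prim t0 (\<lambda>s. F 1 (fst p, s) ** B (fst p, s) ** adj2 (F 1 (fst p, s))) (snd p)"

definition diagonal_form :: "real \<Rightarrow> loop" where
  "diagonal_form t z = U z (t, t) + inverse z *\<^sub>C B (t, t)"

lemma diagonal_form_in_loop_algebra: "t \<in> I \<Longrightarrow> diagonal_form t \<in> loop_algebra"
  unfolding loop_algebra_def mem_Collect_eq
proof (intro conjI ballI)
  show "extends_to_annulus (diagonal_form t)"
    unfolding extends_to_annulus_def
  proof (intro exI conjI)
    show "\<forall>i j. (\<lambda>z. diagonal_form t z $ i $ j) holomorphic_on {z. 1/2 < norm z \<and> norm z < 2}"
      unfolding diagonal_form_def U_def by (auto intro!: holomorphic_intros)
  qed auto
  fix z :: complex
  show "trace (diagonal_form t z) = 0"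
    by (simp add: diagonal_form_def trace_add trace_cscale)
  have "U (- (- z)) (t, t) = Pmat ** U (- z) (t, t) ** Pmat" by (rule U_symmetries)
  then show "diagonal_form t z = Ad Pmat (diagonal_form t (- z))"
    using B_symmetries(1)[of "(t, t)"]
    unfolding Ad_Pmat mat2_eq_iff Pmat_conj_nth diagonal_form_def by (simp add: add_eq_0_iff)
  show "diagonal_form t z = - conj_transpose (diagonal_form t (cnj z))"
    using U_symmetries(2)[of z "(t, t)"] B_symmetries(2)[of "(t, t)"]
    unfolding mat2_eq_iff diagonal_form_def by (simp add: add_eq_0_iff)
qed

text \<open>The form has only the exponents -1, 0 and 1, which lie both in \<open>{..1}\<close> and
  in \<open>{-1..}\<close>. Hence one form can serve in both places of a potential pair.\<close>

lemma potential_form_diagonal: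
  assumes S: "{-1, 0, 1} \<subseteq> S" and \<eta>: "\<And>t. t \<in> I \<Longrightarrow> \<eta> t = diagonal_form t"
  shows "potential_form I S \<eta>"
proof -
  define A where "A n t = (if n = 0 then c (t, t) *\<^sub>R e3 else if n = 1 then e1 else if n = -1 then B (t, t) else 0)"
    for n :: int and t
  have l: "bounded_linear (\<lambda>t::real. (t, t))"
    by (intro bounded_linear_Pair bounded_linear_ident)
  have "smooth_on (A n) I" for n
  proof -
    have k: "Ck_on k (\<lambda>t. c (t, t)) I" "Ck_on k (\<lambda>t. B (t, t)) I" for k
      by (rule Ck_on_compose_linear[OF l open_I _ Ck_c], simp, rule Ck_on_compose_linear[OF l open_I _ Ck_B], simp)
    show ?thesis
      unfolding smooth_on_def A_def
      by (cases "n = 0"; cases "n = 1"; cases "n = -1")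
         (use k in \<open>auto intro!: Ck_on_scaleR Ck_on_const open_I simp del: Ck_on.simps\<close>)
  qed
  moreover have "laurent_on_circle S (\<lambda>n. A n t) (\<eta> t)" if "t \<in> I" for t
    unfolding laurent_on_circle_def
  proof
    fix z :: complex
    show "((\<lambda>n. (z powi n) *\<^sub>C A n t) has_sum \<eta> t z) S"
    proof (rule has_sum_finite_neutralI[where B = "{-1, 0, 1}"])
      show "(z powi n) *\<^sub>C A n t = 0" if "n \<in> S - {- 1, 0, 1}" for n
        using that by (simp add: A_def mat2_eq_iff)
      show "\<eta> t z = (\<Sum>n\<in>{- 1, 0, 1}. (z powi n) *\<^sub>C A n t)"
        using \<eta>[OF \<open>t \<in> I\<close>] by (simp add: A_def diagonal_form_def U_def power_int_minus add.commute add.left_commute)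
    qed (use S in auto)
  qed
  ultimately show ?thesis
    unfolding potential_form_def using diagonal_form_in_loop_algebra \<eta> by (intro exI[of _ A]) auto
qed

theorem dAlembert_frame:
  assumes \<eta>: "\<And>t. t \<in> I \<Longrightarrow> \<eta> t = diagonal_form t"
    and N: "\<And>p. p \<in> II \<Longrightarrow> su2 (N p) = F 1 p ** e3 ** adj2 (F 1 p)"
    and f: "\<And>p. p \<in> II \<Longrightarrow> su2 (f p) = sym_formula p"
  shows "dAlembert I t0 \<eta> \<eta> N f"
  unfolding dAlembert_def
proof (intro conjI)
  show "potential_pair I \<eta> \<eta>"
    unfolding potential_pair_def using potential_form_diagonal[OF _ \<eta>] by auto
  let ?X = "\<lambda>t z. F z (t, t)"
  let ?Hm = "\<lambda>x y z. adj2 (Mf (x, inverse z) x) ** Mf (x, inverse z) y"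
  let ?Hp = "\<lambda>x y z. adj2 (Qf (y, z) x) ** Qf (y, z) y"
  have X: "integrates I t0 \<eta> ?X"
    unfolding integrates_def
  proof (intro conjI ballI)
    show "(\<lambda>z. F z (t, t)) \<in> loop_group" if "t \<in> I" for t
      using punctured_loop_in_loop_group[OF punctured_loop_F] that by simp
    fix z :: complex assume "z \<in> sphere 0 1"
    then have z: "z \<noteq> 0" by auto
    show "F z (t0, t0) = mat 1" by (rule F_t0)
    show "((\<lambda>s. F z (s, s)) has_vector_derivative F z (t, t) ** \<eta> t z) (at t)" if "t \<in> I" for t
      using F_diagonal[OF z that] by (simp add: \<eta>[OF that] diagonal_form_def)
  qed
  have main: "?Hm x y \<in> loop_group_minus_star \<and> ?Hp x y \<in> loop_group_plus \<and>
      (\<forall>z\<in>sphere 0 1. matrix_inv (?X x z) ** ?X y z = ?Hm x y z ** ?Hp x y z) \<and>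
      (\<forall>z\<in>sphere 0 1. F z (x, y) = ?X x z ** ?Hm x y z) \<and>
      su2 (N (x, y)) = Ad (F 1 (x, y)) e3 \<and>
      su2 (f (x, y)) = (1 *\<^sub>C loop_deriv (\<lambda>z. F z (x, y)) 1) ** matrix_inv (F 1 (x, y))"
    if x: "x \<in> I" and y: "y \<in> I" for x y
  proof (intro conjI ballI)
    show "?Hm x y \<in> loop_group_minus_star"
      by (rule entire_loop_minus[where G = "\<lambda>w. adj2 (Mf (x, w) x) ** Mf (x, w) y"])
         (use x y in \<open>auto intro!: entire_loop_matmul entire_loop_adj2 entire_loop_Mf simp: Mf_0\<close>)
    show "?Hp x y \<in> loop_group_plus"
      by (intro entire_loop_plus entire_loop_matmul entire_loop_adj2 entire_loop_Qf x y)
    have pII: "(x, y) \<in> II" "(x, x) \<in> II" using x y by auto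
    fix z :: complex assume "z \<in> sphere 0 1"
    then have z: "z \<noteq> 0" by auto
    note Hm = F_quotient_Mf[OF x y, of z, symmetric] and Hp = F_quotient_Qf[OF z x y, symmetric]
    show "F z (x, y) = ?X x z ** ?Hm x y z"
      unfolding Hm matrix_mul_assoc using adj2_inverse(1)[OF det_F[OF pII(2)]] by simp
    \<comment> \<open>In the product of the two factors F(x,y) meets its own inverse, and the
      quotient of the diagonal values remains.\<close>
    have "?Hm x y z ** ?Hp x y z = adj2 (F z (x, x)) ** (F z (x, y) ** adj2 (F z (x, y))) ** F z (y, y)"
      unfolding Hm Hp by (simp only: matrix_mul_assoc)
    then show "matrix_inv (?X x z) ** ?X y z = ?Hm x y z ** ?Hp x y z"
      by (simp add: adj2_inverse det_F[OF pII(1)] matrix_inv_eq_adj2[OF det_F[OF pII(2)]])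
  next
    have pII: "(x, y) \<in> II" using x y by auto
    show "su2 (N (x, y)) = Ad (F 1 (x, y)) e3"
      by (simp add: N[OF pII] Ad_def matrix_inv_eq_adj2[OF det_F[OF pII]])
    have "loop_deriv (\<lambda>z. F z (x, y)) 1 = sym_formula (x, y) ** F 1 (x, y)"
      using loop_deriv_eq[OF F_cmat_deriv[OF x y]] by (simp add: sym_formula_def)
    then show "su2 (f (x, y)) = (1 *\<^sub>C loop_deriv (\<lambda>z. F z (x, y)) 1) ** matrix_inv (F 1 (x, y))"
      by (simp add: f[OF pII] matrix_inv_eq_adj2[OF det_F[OF pII]] adj2_inverse[OF det_F[OF pII]] flip: matrix_mul_assoc)
  qed
  show "\<exists>X Y Hm Hp Fhat. integrates I t0 \<eta> X \<and> integrates I t0 \<eta> Y \<and>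
        (\<forall>x\<in>I. \<forall>y\<in>I.
           Hm x y \<in> loop_group_minus_star \<and> Hp x y \<in> loop_group_plus \<and>
           (\<forall>z\<in>sphere 0 1. matrix_inv (X x z) ** Y y z = Hm x y z ** Hp x y z) \<and>
           (\<forall>z\<in>sphere 0 1. Fhat x y z = X x z ** Hm x y z) \<and>
           su2 (N (x, y)) = Ad (Fhat x y 1) e3 \<and>
           su2 (f (x, y)) = (1 *\<^sub>C loop_deriv (Fhat x y) 1) ** matrix_inv (Fhat x y 1))"
    by (rule exI[of _ ?X], rule exI[of _ ?X], rule exI[of _ ?Hm], rule exI[of _ ?Hp],
        rule exI[of _ "\<lambda>x y z. F z (x, y)"]) (intro conjI ballI X; (use main in blast))
qed

end

section \<open>The moving frame and the Cauchy data\<close>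

lemma su2_nth [simp]:
  "su2 v $ 1 $ 1 = \<i> * of_real (v $ 3) / 2" "su2 v $ 1 $ 2 = \<i> * of_real (v $ 1) / 2 - of_real (v $ 2) / 2"
  "su2 v $ 2 $ 1 = \<i> * of_real (v $ 1) / 2 + of_real (v $ 2) / 2" "su2 v $ 2 $ 2 = - \<i> * of_real (v $ 3) / 2"
  by (simp_all add: su2_def scaleR_nth2 del: vector_scaleR_component)

text \<open>Real-linear on all matrices, hence smooth without further argument; it inverts
  \<open>su2\<close> on traceless skew-hermitian matrices.\<close>

definition su2_inv :: "cmat2 \<Rightarrow> real^3" where
  "su2_inv A = vector [2 * Im (A $ 1 $ 2), 2 * Re (A $ 2 $ 1), 2 * Im (A $ 1 $ 1)]"

lemma vec3_eq_iff: "u = v \<longleftrightarrow> u $ 1 = v $ 1 \<and> u $ 2 = v $ 2 \<and> u $ 3 = v $ 3" for u v :: "'a^3"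
  by (auto simp: vec_eq_iff forall_3)

lemma su2_inv_nth [simp]:
  "su2_inv A $ 1 = 2 * Im (A $ 1 $ 2)" "su2_inv A $ 2 = 2 * Re (A $ 2 $ 1)" "su2_inv A $ 3 = 2 * Im (A $ 1 $ 1)"
  by (simp_all add: su2_inv_def)

lemma bounded_linear_su2: "bounded_linear su2"
  unfolding su2_def[abs_def]
  by (intro bounded_linear_add bounded_linear_compose[OF bounded_linear_scaleR_left bounded_linear_vec_nth])

lemma bounded_linear_su2_inv: "bounded_linear su2_inv"
  unfolding linear_conv_bounded_linear[symmetric]
  by (rule linearI) (simp_all add: vec3_eq_iff algebra_simps)

lemma su2_inv_su2 [simp]: "su2_inv (su2 v) = v"
  by (simp add: vec3_eq_iff)

lemma su2_su2_inv:
  assumes "trace A = 0" "conj_transpose A = - A"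
  shows "su2 (su2_inv A) = A"
proof -
  have "cnj (A $ 1 $ 1) = - A $ 1 $ 1" "cnj (A $ 2 $ 1) = - A $ 1 $ 2" "A $ 2 $ 2 = - A $ 1 $ 1"
    using assms by (auto simp: mat2_eq_iff trace2 add_eq_0_iff)
  then show ?thesis by (auto simp: mat2_eq_iff complex_eq_iff)
qed

lemma su2_cross: "su2 (cross3 u v) = su2 u ** su2 v - su2 v ** su2 u"
  by (simp add: mat2_eq_iff matmul2_nth cross3_def complex_eq_iff algebra_simps diff_divide_distrib add_divide_distrib)

lemma det_su2: "det (su2 v) = of_real ((norm v)\<^sup>2 / 4)"
  unfolding power2_norm_eq_inner by (simp add: det_2 inner_vec_def sum_3 complex_eq_iff power2_eq_square algebra_simps)

lemma su2_skew: "conj_transpose (su2 v) = - su2 v" "trace (su2 v) = 0"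
  by (simp_all add: mat2_eq_iff trace2)

lemma conj_transpose_conj_transpose: "conj_transpose (conj_transpose A) = A"
  by (simp add: mat2_eq_iff)

lemma cross3_vector: "cross3 (vector [a, b, d]) (vector [a', b', d']) = vector [b * d' - d * b', d * a' - a * d', a * b' - b * a']"
  by (simp add: cross3_def)

lemma bounded_bilinear_cross: "bounded_bilinear cross3"
  using bilinear_cross bilinear_conv_bounded_bilinear by blast

lemma (in open_interval) partials_on_linear:
  assumes "bounded_linear h" "partials_on g gx gy"
  shows "partials_on (\<lambda>p. h (g p)) (\<lambda>p. h (gx p)) (\<lambda>p. h (gy p))"
  unfolding partials_on_def
  by (intro ballI conjI bounded_linear.has_vector_derivative[OF assms(1)] partials_onD[OF assms(2)])

section \<open>The frame, the harmonic map and the surface in three-space\<close>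

context angle_frame
begin

lemma conj_transpose_F1:
  assumes "p \<in> II"
  shows "conj_transpose (F 1 p) = adj2 (F 1 p)"
proof -
  have "F 1 p ** conj_transpose (F 1 p) = mat 1"
    using punctured_loop_F[OF assms] unfolding punctured_loop_def by (metis complex_cnj_one one_neq_zero)
  then have "(adj2 (F 1 p) ** F 1 p) ** conj_transpose (F 1 p) = adj2 (F 1 p)"
    by (simp flip: matrix_mul_assoc)
  then show ?thesis by (simp add: adj2_inverse det_F assms)
qed

text \<open>The adjoint action of the frame at z = 1, transported to three-space by the
  identification with su(2).\<close>

definition rot :: "real \<times> real \<Rightarrow> real^3 \<Rightarrow> real^3" where
  "rot p v = su2_inv (F 1 p ** su2 v ** adj2 (F 1 p))"

lemma su2_rot:
  assumes p: "p \<in> II"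
  shows "su2 (rot p v) = F 1 p ** su2 v ** adj2 (F 1 p)"
  unfolding rot_def
proof (rule su2_su2_inv)
  have a: "conj_transpose (adj2 (F 1 p)) = F 1 p"
    unfolding conj_transpose_F1[OF p, symmetric] by (rule conj_transpose_conj_transpose)
  show "conj_transpose (F 1 p ** su2 v ** adj2 (F 1 p)) = - (F 1 p ** su2 v ** adj2 (F 1 p))"
    by (simp add: conj_transpose_matmul a conj_transpose_F1[OF p] su2_skew matmul_minus_left matmul_minus_right matrix_mul_assoc)
  have "trace (F 1 p ** su2 v ** adj2 (F 1 p)) = trace ((adj2 (F 1 p) ** F 1 p) ** su2 v)"
    by (simp only: trace_mul_sym[of "F 1 p ** su2 v"] matrix_mul_assoc)
  then show "trace (F 1 p ** su2 v ** adj2 (F 1 p)) = 0"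
    by (simp add: adj2_inverse det_F p su2_skew)
qed

lemma bounded_linear_rot: "bounded_linear (rot p)"
  unfolding rot_def[abs_def]
  by (intro bounded_linear_compose[OF bounded_linear_su2_inv] bounded_linear_compose[OF bounded_linear_matmul_left]
      bounded_linear_compose[OF bounded_linear_matmul_right] bounded_linear_su2)

lemma su2_inj: "su2 u = su2 v \<Longrightarrow> u = v"
  by (metis su2_inv_su2)

text \<open>Conjugation respects commutators, and these are cross products under \<open>su2\<close>.
  Likewise \<open>norm_rot\<close> holds because conjugation preserves the determinant, a multiple
  of the squared norm.\<close>

lemma rot_cross:
  assumes p: "p \<in> II"
  shows "cross3 (rot p u) (rot p v) = rot p (cross3 u v)"
proof (rule su2_inj)
  let ?F = "F 1 p"
  have "su2 (rot p u) ** su2 (rot p v) = ?F ** (su2 u ** su2 v) ** adj2 ?F" for u v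
  proof -
    have "su2 (rot p u) ** su2 (rot p v) = ?F ** su2 u ** (adj2 ?F ** ?F) ** su2 v ** adj2 ?F"
      unfolding su2_rot[OF p] by (simp only: matrix_mul_assoc)
    then show ?thesis by (simp add: adj2_inverse det_F[OF p] matrix_mul_assoc)
  qed
  then show "su2 (cross3 (rot p u) (rot p v)) = su2 (rot p (cross3 u v))"
    unfolding su2_cross su2_rot[OF p] by (simp add: matmul_diff_left matmul_diff_right)
qed

lemma norm_rot:
  assumes p: "p \<in> II"
  shows "norm (rot p v) = norm v"
proof -
  have "det (su2 (rot p v)) = det (su2 v)"
    unfolding su2_rot[OF p] by (simp add: det_mul det_F[OF p])
  then have "(norm (rot p v))\<^sup>2 / 4 = (norm v)\<^sup>2 / 4" unfolding det_su2 of_real_eq_iff .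
  then show ?thesis by simp
qed

lemma rot_t0: "rot (t0, t0) v = v"
  by (simp add: rot_def F_t0)

lemma Ck_rot: "Ck_on k (\<lambda>p. rot p v) II"
  unfolding rot_def
  by (intro Ck_on_linear[OF bounded_linear_su2_inv open_II] Ck_on_bilinear[OF bounded_bilinear_matmul open_II]
      Ck_on_linear[OF bounded_linear_adj2 open_II] Ck_F Ck_on_const[OF open_II]) simp_all

text \<open>If g' = g u, the derivative of the conjugate of v by g is the conjugate of the
  commutator of u and v. The two vectors in the statement are the coefficients of F at z = 1 in the
  basis e1, e2, e3.\<close>

lemma rot_partials:
  "partials_on (\<lambda>p. rot p v) (\<lambda>p. rot p (cross3 (vector [1, 0, c p]) v)) (\<lambda>p. rot p (cross3 (vector [\<beta>1 p, \<beta>2 p, 0]) v))"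
proof -
  have main: "((\<lambda>s. su2_inv (g s ** su2 v ** adj2 (g s))) has_vector_derivative
      su2_inv (g t ** su2 (cross3 u v) ** adj2 (g t))) (at t)"
    if g: "(g has_vector_derivative g t ** su2 u) (at t)" for g t u
  proof -
    have "((\<lambda>s. g s ** su2 v ** adj2 (g s)) has_vector_derivative
       (g t ** su2 v) ** adj2 (g t ** su2 u) + (g t ** 0 + (g t ** su2 u) ** su2 v) ** adj2 (g t)) (at t)"
      by (intro has_vector_derivative_matmul has_vector_derivative_adj2 g has_vector_derivative_const)
    moreover have "(g t ** su2 v) ** adj2 (g t ** su2 u) + (g t ** 0 + (g t ** su2 u) ** su2 v) ** adj2 (g t)
      = g t ** su2 (cross3 u v) ** adj2 (g t)"
      by (simp add: su2_cross adj2_matmul adj2_traceless su2_skew matmul_minus_left matmul_minus_right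
          matmul_diff_left matmul_diff_right matmul_zero_right matrix_mul_assoc)
    ultimately show ?thesis using bounded_linear.has_vector_derivative[OF bounded_linear_su2_inv] by fastforce
  qed
  have 1: "U 1 p = su2 (vector [1, 0, c p])" "B p = su2 (vector [\<beta>1 p, \<beta>2 p, 0])" for p
    by (simp_all add: U_def B_def su2_def)
  have F: "partials_on (F 1) (\<lambda>p. F 1 p ** su2 (vector [1, 0, c p])) (\<lambda>p. F 1 p ** su2 (vector [\<beta>1 p, \<beta>2 p, 0]))"
    using F_partials[of 1] by (simp add: 1)
  show ?thesis
    unfolding partials_on_def rot_def
    by (intro ballI conjI main[of "\<lambda>s. F 1 (s, _)"] main[of "\<lambda>s. F 1 (_, s)"] partials_onD[OF F])
qed

abbreviation "E1 p \<equiv> rot p (vector [1, 0, 0])"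
abbreviation "E2 p \<equiv> rot p (vector [0, 1, 0])"
abbreviation "E3 p \<equiv> rot p (vector [0, 0, 1])"

lemma rot_vector: "rot p (vector [a, b, d]) = a *\<^sub>R E1 p + b *\<^sub>R E2 p + d *\<^sub>R E3 p"
proof -
  interpret bounded_linear "rot p" by (rule bounded_linear_rot)
  have "vector [a, b, d] = a *\<^sub>R vector [1, 0, 0] + b *\<^sub>R vector [0, 1, 0] + d *\<^sub>R (vector [0, 0, 1] :: real^3)"
    by (simp add: vec3_eq_iff)
  then show ?thesis by (simp add: add scaleR)
qed

text \<open>The structure equations of the frame. \<open>E3\<close> will be the harmonic map up to a
  rotation; its x-derivative is -\<open>E2\<close>, so that N \<times> N_x becomes
  \<open>E1\<close>.\<close>

lemma E_partials:
  "partials_on E1 (\<lambda>p. c p *\<^sub>R E2 p) (\<lambda>p. - (\<beta>2 p *\<^sub>R E3 p))"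
  "partials_on E2 (\<lambda>p. E3 p - c p *\<^sub>R E1 p) (\<lambda>p. \<beta>1 p *\<^sub>R E3 p)"
  "partials_on E3 (\<lambda>p. - E2 p) (\<lambda>p. \<beta>2 p *\<^sub>R E1 p - \<beta>1 p *\<^sub>R E2 p)"
  by (rule partials_on_cong[OF rot_partials[of "vector [1, 0, 0]"]],
      simp_all add: cross3_vector rot_vector[of _ 0 "c _" 0] rot_vector[of _ 0 0 "- \<beta>2 _"],
      rule partials_on_cong[OF rot_partials[of "vector [0, 1, 0]"]],
      simp_all add: cross3_vector rot_vector[of _ "- c _" 0 1] rot_vector[of _ 0 0 "\<beta>1 _"],
      rule partials_on_cong[OF rot_partials[of "vector [0, 0, 1]"]],
      simp_all add: cross3_vector rot_vector[of _ 0 "-1" 0] rot_vector[of _ "\<beta>2 _" "- \<beta>1 _" 0])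

lemma E_cross:
  assumes "p \<in> II"
  shows "cross3 (E3 p) (E1 p) = E2 p" "cross3 (E3 p) (E2 p) = - E1 p"
  unfolding rot_cross[OF assms] by (simp_all add: cross3_vector rot_vector[of _ "-1" 0 0])

lemma norm_E3: "p \<in> II \<Longrightarrow> norm (E3 p) = 1"
  by (simp add: norm_rot) (simp add: norm_vec_def L2_set_def sum_3)

text \<open>The Sym formula read in three-space: conjugation by F turns e1 and B into
  \<open>E1\<close> and \<beta>1 \<open>E1\<close> + \<beta>2 \<open>E2\<close>.\<close>

definition surf :: "real \<times> real \<Rightarrow> real^3" where
  "surf p = prim t0 (\<lambda>s. E1 (s, t0)) (fst p)
     - prim t0 (\<lambda>s. \<beta>1 (fst p, s) *\<^sub>R E1 (fst p, s) + \<beta>2 (fst p, s) *\<^sub>R E2 (fst p, s)) (snd p)"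

lemmas Ck_E_intros = Ck_on_add Ck_on_diff Ck_on_minus Ck_on_scaleR Ck_rot Ck_\<beta>1 Ck_\<beta>2 Ck_c open_II

text \<open>The vertical path moves with x. The x-derivative of its integrand is \<beta>2
  \<open>E3\<close>, which is minus the y-derivative of \<open>E1\<close>; hence its contribution
  integrates to E1(x,y) - E1(x,t0), and \<open>E1\<close> at the end point remains.\<close>

lemma surf_partials: "partials_on surf E1 (\<lambda>p. - (\<beta>1 p *\<^sub>R E1 p + \<beta>2 p *\<^sub>R E2 p))"
  unfolding partials_on_def
proof (intro ballI conjI)
  fix x y assume x: "x \<in> I" and y: "y \<in> I"
  let ?G = "\<lambda>p. \<beta>1 p *\<^sub>R E1 p + \<beta>2 p *\<^sub>R E2 p"
  have cG: "continuous_on II ?G" and cE: "continuous_on II (\<lambda>p. rot p v)"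
    and cG': "continuous_on II (\<lambda>p. \<beta>2 p *\<^sub>R E3 p)" for v
    by (rule Ck_on_imp_continuous[where k = 0]; intro Ck_E_intros)+
  show "((\<lambda>s. surf (x, s)) has_vector_derivative - ?G (x, y)) (at y)"
    unfolding surf_def fst_conv snd_conv
    using has_vector_derivative_diff[OF has_vector_derivative_const
        has_vector_derivative_prim[OF continuous_on_slices(2)[OF cG x] t0 y]] by simp
  have Gx: "((\<lambda>u. ?G (u, s)) has_vector_derivative \<beta>2 (u, s) *\<^sub>R E3 (u, s)) (at u)" if "u \<in> I" "s \<in> I" for u s
  proof -
    have "((\<lambda>u. ?G (u, s)) has_vector_derivative
      (\<beta>1 (u, s) *\<^sub>R (c (u, s) *\<^sub>R E2 (u, s)) + (c (u, s) * \<beta>2 (u, s)) *\<^sub>R E1 (u, s))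
      + (\<beta>2 (u, s) *\<^sub>R (E3 (u, s) - c (u, s) *\<^sub>R E1 (u, s)) + (- (c (u, s) * \<beta>1 (u, s))) *\<^sub>R E2 (u, s))) (at u)"
      by (intro has_vector_derivative_add bounded_bilinear.has_vector_derivative[OF bounded_bilinear_scaleR]
          \<beta>1x \<beta>2x that partials_onD(1)[OF E_partials(1)] partials_onD(1)[OF E_partials(2)])
    then show ?thesis by (rule back_subst[where P = "\<lambda>d. (_ has_vector_derivative d) _"]) (simp add: algebra_simps)
  qed
  have "((\<lambda>u. surf (u, y)) has_vector_derivative E1 (x, t0) - prim t0 (\<lambda>s. \<beta>2 (x, s) *\<^sub>R E3 (x, s)) y) (at x)"
    unfolding surf_def fst_conv snd_conv
  proof (intro has_vector_derivative_diff has_vector_derivative_prim_param[OF _ _ _ t0 y x])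
    show "(prim t0 (\<lambda>s. E1 (s, t0)) has_vector_derivative E1 (x, t0)) (at x)"
      by (rule has_vector_derivative_prim[OF continuous_on_slices(1)[OF cE t0] t0 x])
    show "continuous_on I (\<lambda>s. ?G (u, s))" if "u \<in> I" for u using continuous_on_slices(2)[OF cG that] .
    show "continuous_on II (\<lambda>(x, s). \<beta>2 (x, s) *\<^sub>R E3 (x, s))" using cG' by (simp add: case_prod_unfold)
  qed (rule Gx)
  moreover have "prim t0 (\<lambda>s. - (\<beta>2 (x, s) *\<^sub>R E3 (x, s))) y = E1 (x, y) - E1 (x, t0)"
    by (rule prim_eq_increment[OF partials_onD(2)[OF E_partials(1) x] _ t0 y])
       (use continuous_on_slices(2)[OF cG' x] in \<open>auto intro: continuous_on_minus\<close>)
  moreover have "prim t0 (\<lambda>s. - (\<beta>2 (x, s) *\<^sub>R E3 (x, s))) y = - prim t0 (\<lambda>s. \<beta>2 (x, s) *\<^sub>R E3 (x, s)) y"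
    by (rule prim_linear[OF bounded_linear_minus[OF bounded_linear_ident] continuous_on_slices(2)[OF cG' x] t0 y])
  then have "E1 (x, t0) - prim t0 (\<lambda>s. \<beta>2 (x, s) *\<^sub>R E3 (x, s)) y = E1 (x, y)"
    using calculation(2) by (simp add: algebra_simps)
  ultimately show "((\<lambda>u. surf (u, y)) has_vector_derivative E1 (x, y)) (at x)" by simp
qed

lemma Ck_surf: "Ck_on k surf II"
proof (rule Ck_on_Suc_imp, rule Ck_on_partials[OF surf_partials])
  show "Ck_on k E1 II" "Ck_on k (\<lambda>p. - (\<beta>1 p *\<^sub>R E1 p + \<beta>2 p *\<^sub>R E2 p)) II"
    by (intro Ck_E_intros)+
qed

lemma su2_surf:
  assumes p: "p \<in> II"
  shows "su2 (surf p) = sym_formula p"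
proof -
  obtain x y where xy: "p = (x, y)" "x \<in> I" "y \<in> I" using p by auto
  have cG: "continuous_on II (\<lambda>p. \<beta>1 p *\<^sub>R E1 p + \<beta>2 p *\<^sub>R E2 p)" and cE: "continuous_on II E1"
    by (rule Ck_on_imp_continuous[where k = 0]; intro Ck_E_intros)+
  have e: "su2 (vector [1, 0, 0]) = e1" "B p = su2 (vector [\<beta>1 p, \<beta>2 p, 0])" for p
    by (simp_all add: su2_def B_def)
  have G: "\<beta>1 p *\<^sub>R E1 p + \<beta>2 p *\<^sub>R E2 p = rot p (vector [\<beta>1 p, \<beta>2 p, 0])" for p
    by (simp add: rot_vector[of p "\<beta>1 p" "\<beta>2 p" 0])
  interpret bounded_linear su2 by (rule bounded_linear_su2)
  have "su2 (surf p) = su2 (prim t0 (\<lambda>s. E1 (s, t0)) x)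
      - su2 (prim t0 (\<lambda>s. \<beta>1 (x, s) *\<^sub>R E1 (x, s) + \<beta>2 (x, s) *\<^sub>R E2 (x, s)) y)"
    by (simp add: surf_def xy(1) diff)
  also have "\<dots> = prim t0 (\<lambda>s. su2 (E1 (s, t0))) x
      - prim t0 (\<lambda>s. su2 (\<beta>1 (x, s) *\<^sub>R E1 (x, s) + \<beta>2 (x, s) *\<^sub>R E2 (x, s))) y"
    using prim_linear[OF bounded_linear_su2 continuous_on_slices(1)[OF cE t0] t0 xy(2)]
      prim_linear[OF bounded_linear_su2 continuous_on_slices(2)[OF cG xy(2)] t0 xy(3)] by simp
  also have "\<dots> = sym_formula p"
  proof -
    have "prim t0 (\<lambda>s. su2 (E1 (s, t0))) x = prim t0 (\<lambda>s. F 1 (s, t0) ** e1 ** adj2 (F 1 (s, t0))) x"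
      by (rule prim_cong[OF _ t0 xy(2)]) (simp add: su2_rot t0 e(1))
    moreover have "prim t0 (\<lambda>s. su2 (\<beta>1 (x, s) *\<^sub>R E1 (x, s) + \<beta>2 (x, s) *\<^sub>R E2 (x, s))) y
        = prim t0 (\<lambda>s. F 1 (x, s) ** B (x, s) ** adj2 (F 1 (x, s))) y"
      unfolding G by (rule prim_cong[OF _ t0 xy(3)]) (simp add: su2_rot xy e(2))
    ultimately show ?thesis by (simp add: sym_formula_def xy(1))
  qed
  finally show ?thesis .
qed

text \<open>A proper rotation commutes with the cross product, so it preserves both the harmonic map
  equation and its relation to the surface. It is the freedom left by the normalisation of F at
  (t0,t0).\<close>

lemma rotated_frame:
  fixes R :: "real^3^3"
  assumes R: "rotation_matrix R"
  shows "lorentzian_harmonic II (\<lambda>p. R *v E3 p)"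
    and "associated_surface II (\<lambda>p. R *v E3 p) (\<lambda>p. R *v surf p)"
    and "p \<in> II \<Longrightarrow> pdx (\<lambda>p. R *v E3 p) p = - (R *v E2 p)"
proof -
  have lR: "bounded_linear ((*v) R)" by (rule matrix_vector_mul_bounded_linear)
  interpret R: bounded_linear "(*v) R" by (rule lR)
  note comp = partials_on_linear[OF lR]
  let ?N = "\<lambda>p. R *v E3 p"
  note N = partials_on_pd[OF comp[OF E_partials(3)]]
  show px: "pdx ?N p = - (R *v E2 p)" if "p \<in> II" for p using N(1)[OF that] by (simp add: R.neg)
  \<comment> \<open>Harmonicity: the y-derivative of -\<open>E2\<close> is -\<beta>1
    \<open>E3\<close>, a multiple of N.\<close>
  have "partials_on (pdx ?N) (\<lambda>p. - (R *v (E3 p - c p *\<^sub>R E1 p))) (\<lambda>p. - (R *v (\<beta>1 p *\<^sub>R E3 p)))"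
    by (rule partials_on_cong[OF partials_on_linear[OF bounded_linear_minus[OF lR] E_partials(2)]]) (simp_all add: px)
  then have pxy: "pdy (pdx ?N) p = - \<beta>1 p *\<^sub>R ?N p" if "p \<in> II" for p
    using partials_on_pd(2)[OF _ that] by (simp add: R.scaleR)
  have nR: "norm (R *v v) = norm v" for v
    using R orthogonal_transformation_matrix[of "(*v) R"]
    by (auto simp: rotation_matrix_def orthogonal_transformation matrix_of_matrix_vector_mul)
  have R': "cross3 (R *v u) (R *v v) = R *v cross3 u v" for u v using cross_rotation_matrix[OF R] .
  show "lorentzian_harmonic II ?N"
    unfolding lorentzian_harmonic_def smooth_on_def
  proof (intro conjI allI ballI)
    show "Ck_on k ?N II" for k by (rule Ck_on_linear[OF lR open_II Ck_rot])
    show "?N ` II \<subseteq> sphere 0 1" by (auto simp: nR norm_E3)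
    show "cross3 (?N p) (pdy (pdx ?N) p) = 0" if "p \<in> II" for p
      by (simp add: pxy[OF that] cross_mult_right)
  qed
  note f = partials_on_pd[OF comp[OF surf_partials]]
  show "associated_surface II ?N (\<lambda>p. R *v surf p)"
    unfolding associated_surface_def smooth_on_def
  proof (intro conjI allI ballI)
    show "Ck_on k (\<lambda>p. R *v surf p) II" for k by (rule Ck_on_linear[OF lR open_II Ck_surf])
    fix p assume p: "p \<in> II"
    show "pdx (\<lambda>p. R *v surf p) p = cross3 (?N p) (pdx ?N p)"
      by (simp add: f(1)[OF p] px[OF p] R' E_cross[OF p] R.neg)
    have "cross3 (E3 p) (\<beta>2 p *\<^sub>R E1 p - \<beta>1 p *\<^sub>R E2 p) = \<beta>1 p *\<^sub>R E1 p + \<beta>2 p *\<^sub>R E2 p"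
      by (simp add: Cross3.right_diff_distrib cross_mult_right E_cross[OF p] add.commute)
    then show "pdy (\<lambda>p. R *v surf p) p = - cross3 (?N p) (pdy ?N p)"
      unfolding f(2)[OF p] N(2)[OF p] R' by (simp only: R.neg)
  qed
qed

lemma E_diagonal:
  assumes "t \<in> I"
  shows "((\<lambda>s. E1 (s, s)) has_vector_derivative c (t, t) *\<^sub>R E2 (t, t) - \<beta>2 (t, t) *\<^sub>R E3 (t, t)) (at t)"
    and "((\<lambda>s. E2 (s, s)) has_vector_derivative (1 + \<beta>1 (t, t)) *\<^sub>R E3 (t, t) - c (t, t) *\<^sub>R E1 (t, t)) (at t)"
    and "((\<lambda>s. E3 (s, s)) has_vector_derivative \<beta>2 (t, t) *\<^sub>R E1 (t, t) - (1 + \<beta>1 (t, t)) *\<^sub>R E2 (t, t)) (at t)"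
proof -
  have c: "continuous_on II (\<lambda>p. - (\<beta>2 p *\<^sub>R E3 p))" "continuous_on II (\<lambda>p. \<beta>1 p *\<^sub>R E3 p)"
    "continuous_on II (\<lambda>p. \<beta>2 p *\<^sub>R E1 p - \<beta>1 p *\<^sub>R E2 p)"
    by (rule Ck_on_imp_continuous[where k = 0]; intro Ck_E_intros)+
  have m: "(t, t) \<in> II" using assms by simp
  note d = has_derivative_imp_diagonal[OF partials_imp_has_derivative[OF E_partials(1) c(1) m]]
    has_derivative_imp_diagonal[OF partials_imp_has_derivative[OF E_partials(2) c(2) m]]
    has_derivative_imp_diagonal[OF partials_imp_has_derivative[OF E_partials(3) c(3) m]]
  show "((\<lambda>s. E1 (s, s)) has_vector_derivative c (t, t) *\<^sub>R E2 (t, t) - \<beta>2 (t, t) *\<^sub>R E3 (t, t)) (at t)"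
    using d(1) by simp
  show "((\<lambda>s. E2 (s, s)) has_vector_derivative (1 + \<beta>1 (t, t)) *\<^sub>R E3 (t, t) - c (t, t) *\<^sub>R E1 (t, t)) (at t)"
    using d(2) by (simp add: algebra_simps)
  show "((\<lambda>s. E3 (s, s)) has_vector_derivative \<beta>2 (t, t) *\<^sub>R E1 (t, t) - (1 + \<beta>1 (t, t)) *\<^sub>R E2 (t, t)) (at t)"
    using d(3) by (simp add: algebra_simps)
qed

end

section \<open>Orthonormal frames in three-space\<close>

lemma cross_cross: "cross3 x (cross3 y z) = inner x z *\<^sub>R y - inner x y *\<^sub>R z"
  by (simp add: vec3_eq_iff cross3_def inner_vec_def sum_3 algebra_simps)

lemma norm_cross_orthonormal:
  assumes "norm u = 1" "norm v = 1" "inner u v = 0"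
  shows "norm (cross3 u v) = 1"
proof -
  have "(norm (cross3 u v))\<^sup>2 = 1\<^sup>2" using norm_cross_dot[of u v] assms by simp
  then show ?thesis by (subst (asm) power2_eq_iff_nonneg) simp_all
qed

text \<open>The remainder is orthogonal to n and v, so its cross product with n \<times> v vanishes;
  it is also orthogonal to n \<times> v. By Lagrange's identity it is 0.\<close>

lemma orthonormal_expansion:
  assumes n: "norm n = 1" and v: "norm v = 1" and nv: "inner v n = 0"
  shows "w = inner w n *\<^sub>R n + inner w v *\<^sub>R v + inner w (cross3 n v) *\<^sub>R cross3 n v"
proof -
  let ?u = "cross3 n v"
  have nn: "inner n n = 1" and vv: "inner v v = 1" using n v by (simp_all add: norm_eq_1)
  have uu: "norm ?u = 1"
    using norm_cross_orthonormal[OF n v] nv by (simp add: inner_commute)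
  define d where "d = w - (inner w n *\<^sub>R n + inner w v *\<^sub>R v + inner w ?u *\<^sub>R ?u)"
  have "inner d n = 0" "inner d v = 0" "inner d ?u = 0"
    unfolding d_def using nn vv nv uu
    by (simp_all add: inner_diff_left inner_add_left dot_cross_self inner_commute[of n v] norm_eq_1)
  then have "cross3 d ?u = 0" by (simp add: cross_cross)
  with \<open>inner d ?u = 0\<close> have "norm d = 0"
    using norm_cross_dot[of d ?u] uu by simp
  then show ?thesis by (simp add: d_def)
qed

lemma rotation_matrix_columns:
  fixes u v w :: "real^3"
  assumes "norm u = 1" "norm v = 1" "inner u v = 0" "w = cross3 u v"
  obtains R :: "real^3^3" where "rotation_matrix R" "\<And>a b c. R *v vector [a, b, c] = a *\<^sub>R u + b *\<^sub>R v + c *\<^sub>R w"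
proof -
  \<comment> \<open>The given vectors are the rows of M, so its transpose has them as columns. The
    determinant is the triple product of a positively oriented orthonormal frame.\<close>
  define M where "M = (vector [u, v, w] :: real^3^3)"
  have w: "norm w = 1" "inner u w = 0" "inner v w = 0"
    using norm_cross_orthonormal[of u v] assms by (simp_all add: dot_cross_self)
  have "orthogonal_matrix (transpose M)"
    unfolding orthogonal_matrix transpose_transpose
    using assms(1,2,3) w
    by (simp add: vec_eq_iff forall_3 matrix_matrix_mult_def M_def transpose_def mat_def sum_3 inner_vec_def norm_eq_1 mult.commute)
  moreover have "det (transpose M) = 1"
  proof -
    have "det M = inner u (cross3 v w)" by (simp add: M_def dot_cross_det)
    also have "cross3 v w = u"
      unfolding assms(4) cross_cross using assms(2,3) by (simp add: norm_eq_1 inner_commute)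
    finally show ?thesis using assms(1) by (simp add: norm_eq_1)
  qed
  moreover have "transpose M *v vector [a, b, c] = a *\<^sub>R u + b *\<^sub>R v + c *\<^sub>R w" for a b c
    by (simp add: vec3_eq_iff matrix_vector_mult_def sum_3 M_def transpose_def mult.commute)
  ultimately show thesis unfolding rotation_matrix_def[symmetric] by (intro that[of "transpose M"]) (simp_all only: rotation_matrix_def)
qed

section \<open>Uniqueness estimates and mixed derivatives\<close>

context open_interval
begin

lemma derivative_of_constant:
  assumes "(g has_vector_derivative d) (at t)" "t \<in> I" "\<And>s. s \<in> I \<Longrightarrow> g s = k"
  shows "d = 0"
proof -
  have "((\<lambda>_. k) has_vector_derivative d) (at t)"
    by (rule has_vector_derivative_transform_within_open[OF assms(1) open_I assms(2)]) (rule assms(3))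
  then show ?thesis using vector_derivative_unique_at has_vector_derivative_const by blast
qed

text \<open>By skewness the sum of the squared norms of the differences has derivative 0. So no
  growth estimate is needed, and the coefficients k need not be continuous for the argument.\<close>

lemma skew_system_unique:
  fixes e g :: "real \<Rightarrow> 'n::finite \<Rightarrow> 'b::real_inner"
  fixes k :: "real \<Rightarrow> 'n \<Rightarrow> 'n \<Rightarrow> real"
  assumes e: "\<And>t i. t \<in> I \<Longrightarrow> ((\<lambda>t. e t i) has_vector_derivative (\<Sum>j\<in>UNIV. k t i j *\<^sub>R e t j)) (at t)"
    and g: "\<And>t i. t \<in> I \<Longrightarrow> ((\<lambda>t. g t i) has_vector_derivative (\<Sum>j\<in>UNIV. k t i j *\<^sub>R g t j)) (at t)"
    and skew: "\<And>t i j. k t i j = - k t j i" and t0: "t0 \<in> I" and eq: "\<And>i. e t0 i = g t0 i" and t: "t \<in> I"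
  shows "e t i = g t i"
proof -
  define d where "d t i = e t i - g t i" for t i
  define \<phi> where "\<phi> t = (\<Sum>i\<in>UNIV. inner (d t i) (d t i))" for t
  have "\<phi> t = \<phi> t0"
  proof (rule constant_on_I[OF _ t0 t])
    fix s assume s: "s \<in> I"
    have dd: "((\<lambda>t. d t i) has_vector_derivative (\<Sum>j\<in>UNIV. k s i j *\<^sub>R d s j)) (at s)" for i
      using has_vector_derivative_diff[OF e[OF s, of i] g[OF s, of i]]
      by (simp add: d_def scaleR_diff_right sum_subtractf)
    define S where "S = (\<Sum>i\<in>UNIV. \<Sum>j\<in>UNIV. k s i j * inner (d s i) (d s j))"
    have "S = (\<Sum>i\<in>UNIV. \<Sum>j\<in>UNIV. - (k s j i * inner (d s j) (d s i)))"
      unfolding S_def by (intro sum.cong refl) (metis skew inner_commute mult_minus_left)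
    also have "\<dots> = - (\<Sum>j\<in>UNIV. \<Sum>i\<in>UNIV. k s j i * inner (d s j) (d s i))"
      unfolding sum_negf by (subst sum.swap) (rule refl)
    finally have S: "S = 0" by (simp add: S_def)
    have "(\<phi> has_vector_derivative (\<Sum>i\<in>UNIV. inner (d s i) (\<Sum>j\<in>UNIV. k s i j *\<^sub>R d s j) + inner (\<Sum>j\<in>UNIV. k s i j *\<^sub>R d s j) (d s i))) (at s)"
      unfolding \<phi>_def
      by (intro has_vector_derivative_sum bounded_bilinear.has_vector_derivative[OF bounded_bilinear_inner] dd)
    moreover have "(\<Sum>i\<in>UNIV. inner (d s i) (\<Sum>j\<in>UNIV. k s i j *\<^sub>R d s j) + inner (\<Sum>j\<in>UNIV. k s i j *\<^sub>R d s j) (d s i)) = S + S"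
      by (simp add: S_def sum.distrib inner_sum_left inner_sum_right inner_commute sum_distrib_left)
    ultimately show "(\<phi> has_vector_derivative 0) (at s)" using S by simp
  qed
  also have "\<phi> t0 = 0" by (simp add: \<phi>_def d_def eq)
  finally have "inner (d t i) (d t i) = 0"
    unfolding \<phi>_def by (simp add: sum_nonneg_eq_0_iff)
  then show ?thesis by (simp add: d_def)
qed

text \<open>Write g(u,v) as g(u,y) plus the integral of g_y over the vertical segment, differentiate
  in u under the integral, and then differentiate the result in v.\<close>

lemma mixed_partials:
  fixes g :: "real \<times> real \<Rightarrow> 'b::banach"
  assumes g: "Ck_on 2 g II" and p: "p \<in> II"
  shows "pdx (pdy g) p = pdy (pdx g) p"
proof -
  obtain x y where xy: "p = (x, y)" "x \<in> I" "y \<in> I" using p by auto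
  have g2: "Ck_on (Suc (Suc 0)) g II" using g by (simp only: numeral_2_eq_2)
  note P = Ck_on_Suc_imp_partials[OF g2]
  note Px = Ck_on_Suc_imp_partials[OF P(2)] and Py = Ck_on_Suc_imp_partials[OF P(3)]
  have c: "continuous_on II (pdy g)" "continuous_on II (pdx (pdy g))"
    using P(3) Py(2) by (auto intro: Ck_on_imp_continuous simp del: Ck_on.simps)
  have e: "pdx g (x, v) = pdx g (x, y) + prim y (\<lambda>s. pdx (pdy g) (x, s)) v" if v: "v \<in> I" for v
  proof -
    have "((\<lambda>u. g (u, y) + prim y (\<lambda>s. pdy g (u, s)) v) has_vector_derivative
        pdx g (x, y) + prim y (\<lambda>s. pdx (pdy g) (x, s)) v) (at x)"
    proof (intro has_vector_derivative_add partials_onD(1)[OF P(1) xy(2,3)]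
        has_vector_derivative_prim_param[OF _ _ _ xy(3) v xy(2)])
      show "continuous_on II (\<lambda>(x, s). pdx (pdy g) (x, s))" using c(2) by (simp add: case_prod_unfold)
    qed (use partials_onD(1)[OF Py(1)] continuous_on_slices(2)[OF c(1)] in auto)
    then have "((\<lambda>u. g (u, v)) has_vector_derivative pdx g (x, y) + prim y (\<lambda>s. pdx (pdy g) (x, s)) v) (at x)"
    proof (rule has_vector_derivative_transform_within_open[OF _ open_I xy(2)])
      show "g (u, y) + prim y (\<lambda>s. pdy g (u, s)) v = g (u, v)" if u: "u \<in> I" for u
        using prim_eq_increment[OF partials_onD(2)[OF P(1) u] continuous_on_slices(2)[OF c(1) u] xy(3) v] by simp
    qed
    then show ?thesis
      using vector_derivative_unique_at partials_onD(1)[OF P(1) xy(2) v] by blast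
  qed
  have "((\<lambda>v. pdx g (x, y) + prim y (\<lambda>s. pdx (pdy g) (x, s)) v) has_vector_derivative pdx (pdy g) (x, y)) (at y)"
    using has_vector_derivative_add[OF has_vector_derivative_const
        has_vector_derivative_prim[OF continuous_on_slices(2)[OF c(2) xy(2)] xy(3,3)]] by simp
  then have "((\<lambda>v. pdx g (x, v)) has_vector_derivative pdx (pdy g) (x, y)) (at y)"
    by (rule has_vector_derivative_transform_within_open[OF _ open_I xy(3)]) (simp add: e[symmetric])
  then show ?thesis
    using vector_derivative_unique_at partials_onD(2)[OF Px(1) xy(2,3)] xy(1) by blast
qed

text \<open>
  A substitute for Gronwall's inequality: iterating the gain bounds \<open>\<sigma>\<close> by
  \<open>C0 K^n |x - y|^n / n!\<close> for every \<open>n\<close>.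
\<close>

lemma vanishes_if_gains:
  fixes \<sigma> :: "real \<times> real \<Rightarrow> real"
  assumes gain: "\<And>n C q. 0 \<le> C \<Longrightarrow> (\<And>q. q \<in> S \<Longrightarrow> \<sigma> q \<le> C * \<bar>snd q - fst q\<bar> ^ n) \<Longrightarrow> q \<in> S \<Longrightarrow>
      \<sigma> q \<le> K * C * \<bar>snd q - fst q\<bar> ^ Suc n / Suc n"
    and C0: "0 \<le> C0" "\<And>q. q \<in> S \<Longrightarrow> \<sigma> q \<le> C0" and K: "0 \<le> K" and q: "q \<in> S"
  shows "\<sigma> q \<le> 0"
proof -
  have est: "\<sigma> q \<le> C0 * K ^ n / fact n * \<bar>snd q - fst q\<bar> ^ n" if "q \<in> S" for n q
    using that
  proof (induction n arbitrary: q)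
    case 0
    then show ?case using C0(2) by simp
  next
    case (Suc n)
    have "\<sigma> q \<le> K * (C0 * K ^ n / fact n) * \<bar>snd q - fst q\<bar> ^ Suc n / Suc n"
      by (rule gain[OF _ Suc.IH Suc.prems]) (use C0(1) K in auto)
    also have "\<dots> = C0 * K ^ Suc n / fact (Suc n) * \<bar>snd q - fst q\<bar> ^ Suc n" by (simp add: field_simps)
    finally show ?case .
  qed
  define r where "r = K * \<bar>snd q - fst q\<bar>"
  \<comment> \<open>The bounds are terms of an exponential series and therefore tend to 0 for fixed
    q.\<close>
  have "(\<lambda>n. C0 * (inverse (fact n) * r ^ n)) \<longlonglongrightarrow> C0 * 0"
    by (intro tendsto_mult_left summable_LIMSEQ_zero[OF summable_exp])
  moreover have "\<sigma> q \<le> C0 * (inverse (fact n) * r ^ n)" for n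
    using est[OF q, of n] by (simp add: r_def power_mult_distrib field_simps)
  ultimately show ?thesis using LIMSEQ_le_const by fastforce
qed

end

section \<open>The Cauchy problem\<close>

locale cauchy_data = open_interval I for I +
  fixes N0 V :: "real \<Rightarrow> real^3"
  assumes Ck_N0: "\<And>k. Ck_on k N0 I" and Ck_V: "\<And>k. Ck_on k V I"
    and norm_N0: "\<And>t. t \<in> I \<Longrightarrow> norm (N0 t) = 1" and norm_V: "\<And>t. t \<in> I \<Longrightarrow> norm (V t) = 1"
    and V_N0: "\<And>t. t \<in> I \<Longrightarrow> inner (V t) (N0 t) = 0"
begin

abbreviation "a \<equiv> coef_a N0 V"
abbreviation "b \<equiv> coef_b N0 V"
text \<open>The coefficient called c in the potential; the letter \<open>c\<close> is kept for its
  extension to the square.\<close>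

abbreviation "k \<equiv> coef_c N0 V"

definition W :: "real \<Rightarrow> real^3" where
  "W t = cross3 (N0 t) (V t)"

lemma N0_deriv: "t \<in> I \<Longrightarrow> (N0 has_vector_derivative tderiv N0 t) (at t)"
  and V_deriv: "t \<in> I \<Longrightarrow> (V has_vector_derivative tderiv V t) (at t)"
  by (rule Ck_on_Suc_realD(1)[OF open_I Ck_N0], assumption, rule Ck_on_Suc_realD(1)[OF open_I Ck_V], assumption)

lemma frame_products:
  assumes "t \<in> I"
  shows "inner (N0 t) (N0 t) = 1" "inner (V t) (V t) = 1" "inner (N0 t) (V t) = 0" "inner (V t) (N0 t) = 0"
    "inner (W t) (W t) = 1" "inner (W t) (N0 t) = 0" "inner (W t) (V t) = 0" "inner (N0 t) (W t) = 0" "inner (V t) (W t) = 0"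
    "cross3 (N0 t) (V t) = W t" "cross3 (V t) (N0 t) = - W t" "cross3 (N0 t) (W t) = - V t" "cross3 (W t) (N0 t) = V t"
    "cross3 (V t) (W t) = N0 t" "cross3 (W t) (V t) = - N0 t"
proof -
  show *: "inner (N0 t) (N0 t) = 1" "inner (V t) (V t) = 1" "inner (N0 t) (V t) = 0" "inner (V t) (N0 t) = 0"
    using norm_N0[OF assms] norm_V[OF assms] V_N0[OF assms] by (simp_all add: norm_eq_1 inner_commute)
  show "inner (W t) (W t) = 1"
    using norm_cross_dot[of "N0 t" "V t"] norm_N0[OF assms] norm_V[OF assms] *
    by (simp add: W_def norm_eq_1 power2_norm_eq_inner)
  show "inner (W t) (N0 t) = 0" "inner (W t) (V t) = 0" "inner (N0 t) (W t) = 0" "inner (V t) (W t) = 0"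
    by (simp_all add: W_def dot_cross_self)
  show "cross3 (N0 t) (V t) = W t" "cross3 (V t) (N0 t) = - W t"
    by (simp_all add: W_def cross_skew[of "V t"])
  show "cross3 (N0 t) (W t) = - V t" "cross3 (V t) (W t) = N0 t"
    by (simp_all add: W_def cross_cross *)
  then show "cross3 (W t) (N0 t) = V t" "cross3 (W t) (V t) = - N0 t"
    by (simp_all add: cross_skew[of "W t"])
qed

lemma expansion:
  assumes "t \<in> I"
  shows "w = inner w (N0 t) *\<^sub>R N0 t + inner w (V t) *\<^sub>R V t + inner w (W t) *\<^sub>R W t"
  unfolding W_def by (rule orthonormal_expansion) (use assms norm_N0 norm_V V_N0 in auto)

lemma derivative_products:
  assumes t: "t \<in> I"
  shows "inner (tderiv N0 t) (N0 t) = 0" "inner (tderiv N0 t) (V t) = 1 - b t" "inner (tderiv N0 t) (W t) = a t"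
    "inner (tderiv V t) (N0 t) = - (1 - b t)" "inner (tderiv V t) (V t) = 0"
proof -
  note ip = bounded_bilinear.has_vector_derivative[OF bounded_bilinear_inner]
  note N = N0_deriv[OF t] and V = V_deriv[OF t]
  show "inner (tderiv N0 t) (N0 t) = 0" "inner (tderiv V t) (V t) = 0"
    using derivative_of_constant[OF ip[OF N N] t frame_products(1)]
      derivative_of_constant[OF ip[OF V V] t frame_products(2)] by (auto simp: inner_commute)
  show 1: "inner (tderiv N0 t) (V t) = 1 - b t"
    using frame_products(2)[OF t] by (simp add: coef_b_def inner_diff_left)
  show "inner (tderiv N0 t) (W t) = a t" by (simp add: coef_a_def W_def)
  show "inner (tderiv V t) (N0 t) = - (1 - b t)"
    using derivative_of_constant[OF ip[OF V N] t frame_products(4)] 1 by (simp add: inner_commute)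
qed

lemma tderiv_N0: "t \<in> I \<Longrightarrow> tderiv N0 t = (1 - b t) *\<^sub>R V t + a t *\<^sub>R W t"
  using expansion[of t "tderiv N0 t"] derivative_products[of t] by simp

text \<open>V' has no component along V, so its tangential part is a multiple of W, and the sign in
  \<open>coef_c\<close> restores the orientation lost in the norm. This form also shows that the
  coefficient is smooth across its zeros.\<close>

lemma coef_c_eq: "t \<in> I \<Longrightarrow> k t = inner (tderiv V t) (W t)"
proof -
  assume t: "t \<in> I"
  let ?r = "inner (tderiv V t) (W t)"
  have "covariant_deriv N0 V t = ?r *\<^sub>R W t"
  proof -
    have "tderiv V t = inner (tderiv V t) (N0 t) *\<^sub>R N0 t + ?r *\<^sub>R W t"
      using expansion[OF t, of "tderiv V t"] derivative_products(5)[OF t] by simp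
    then show ?thesis unfolding covariant_deriv_def by (metis add_diff_cancel_left')
  qed
  then have "norm (covariant_deriv N0 V t) = \<bar>?r\<bar>"
    using frame_products(5)[OF t] by (simp add: norm_eq_1)
  moreover have "inner (cross3 (tderiv V t) (N0 t)) (V t) = ?r"
    by (simp add: W_def cross3_simps)
  ultimately show ?thesis by (simp add: coef_c_def sgn_mult_abs)
qed

lemma tderiv_V: "t \<in> I \<Longrightarrow> tderiv V t = k t *\<^sub>R W t - (1 - b t) *\<^sub>R N0 t"
  using expansion[of t "tderiv V t"] derivative_products[of t] by (simp add: coef_c_eq algebra_simps)

lemma W_deriv: "t \<in> I \<Longrightarrow> (W has_vector_derivative - (k t *\<^sub>R V t) - a t *\<^sub>R N0 t) (at t)"
proof -
  assume t: "t \<in> I"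
  have "(W has_vector_derivative cross3 (N0 t) (tderiv V t) + cross3 (tderiv N0 t) (V t)) (at t)"
    unfolding W_def[abs_def]
    by (rule bounded_bilinear.has_vector_derivative[OF bounded_bilinear_cross N0_deriv[OF t] V_deriv[OF t]])
  moreover have "cross3 (N0 t) (tderiv V t) + cross3 (tderiv N0 t) (V t) = - (k t *\<^sub>R V t) - a t *\<^sub>R N0 t"
    unfolding tderiv_N0[OF t] tderiv_V[OF t]
    by (simp add: cross_add_left Cross3.right_diff_distrib cross_mult_left cross_mult_right frame_products[OF t])
  ultimately show ?thesis by simp
qed

lemma Ck_coefficients: "Ck_on n a I" "Ck_on n b I" "Ck_on n k I"
proof -
  note dN = Ck_on_Suc_realD(2)[OF open_I Ck_N0] and dV = Ck_on_Suc_realD(2)[OF open_I Ck_V]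
  note ip = Ck_on_bilinear[OF bounded_bilinear_inner open_I] and cp = Ck_on_bilinear[OF bounded_bilinear_cross open_I]
  show "Ck_on n a I" unfolding coef_a_def[abs_def] by (intro ip cp dN Ck_N0 Ck_V)
  show "Ck_on n b I" unfolding coef_b_def[abs_def] by (intro ip Ck_on_diff open_I dN Ck_V)
  have "Ck_on n (\<lambda>t. inner (tderiv V t) (W t)) I" unfolding W_def by (intro ip cp dV Ck_N0 Ck_V)
  then show "Ck_on n k I" by (rule Ck_on_cong[OF open_I, rotated]) (simp add: coef_c_eq)
qed

theorem dAlembert_solution:
  assumes t0: "t0 \<in> I"
  obtains Nhat fhat and R :: "real^3^3" where "dAlembert I t0 (alpha0 N0 V) (alpha0 N0 V) Nhat fhat" "rotation_matrix R"
    "cauchy_solution I N0 V (\<lambda>p. R *v Nhat p)" "associated_surface II (\<lambda>p. R *v Nhat p) (\<lambda>p. R *v fhat p)"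
proof -
  \<comment> \<open>The diagonal values k of c and (-b, a) of (\<beta>1, \<beta>2) are read off
    \<open>alpha0\<close>, so that F along the diagonal integrates the prescribed potential.\<close>
  have "Ck_on n (\<lambda>t. - b t) I" for n by (rule Ck_on_minus[OF open_I Ck_coefficients(2)])
  then obtain c \<beta>1 \<beta>2 :: "real \<times> real \<Rightarrow> real"
    where smooth: "\<And>k. Ck_on k c II" "\<And>k. Ck_on k \<beta>1 II" "\<And>k. Ck_on k \<beta>2 II"
    and diag: "\<And>t. t \<in> I \<Longrightarrow> c (t, t) = k t" "\<And>t. t \<in> I \<Longrightarrow> \<beta>1 (t, t) = - b t" "\<And>t. t \<in> I \<Longrightarrow> \<beta>2 (t, t) = a t"
    and eqs: "\<And>x y. x \<in> I \<Longrightarrow> y \<in> I \<Longrightarrow> ((\<lambda>s. c (x, s)) has_vector_derivative \<beta>2 (x, y)) (at y)"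
    "\<And>x y. x \<in> I \<Longrightarrow> y \<in> I \<Longrightarrow> ((\<lambda>s. \<beta>1 (s, y)) has_vector_derivative c (x, y) * \<beta>2 (x, y)) (at x)"
    "\<And>x y. x \<in> I \<Longrightarrow> y \<in> I \<Longrightarrow> ((\<lambda>s. \<beta>2 (s, y)) has_vector_derivative - (c (x, y) * \<beta>1 (x, y))) (at x)"
    using angle_system_solution[OF Ck_coefficients(3) _ Ck_coefficients(1), of "\<lambda>t. - b t"] by blast
  interpret angle_frame I t0 c \<beta>1 \<beta>2
    by unfold_locales (fact t0 smooth eqs)+
  \<comment> \<open>R carries the standard basis, which is the frame at (t0,t0), to (W, -V, N0) at
    t0; the identity says that this triple is positively oriented.\<close>
  have "cross3 (W t0) (- V t0) = N0 t0" by (simp add: frame_products[OF t0])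
  then obtain R :: "real^3^3" where R: "rotation_matrix R"
    and Rv: "\<And>a b c. R *v vector [a, b, c] = a *\<^sub>R W t0 + b *\<^sub>R (- V t0) + c *\<^sub>R N0 t0"
    using rotation_matrix_columns[of "W t0" "- V t0" "N0 t0"] frame_products[OF t0] norm_V[OF t0]
    by (auto simp: norm_eq_1)
  interpret Rl: bounded_linear "(*v) R" by (rule matrix_vector_mul_bounded_linear)
  define e where "e t i = (if i = 1 then R *v E1 (t, t) else if i = 2 then R *v E2 (t, t) else R *v E3 (t, t))" for t and i :: 3
  define g where "g t i = (if i = 1 then W t else if i = 2 then - V t else N0 t)" for t and i :: 3
  define K :: "real \<Rightarrow> 3 \<Rightarrow> 3 \<Rightarrow> real" where
    "K t i j = (if i = 1 \<and> j = 2 then k t else if i = 2 \<and> j = 1 then - k t else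
      if i = 1 \<and> j = 3 then - a t else if i = 3 \<and> j = 1 then a t else
      if i = 2 \<and> j = 3 then 1 - b t else if i = 3 \<and> j = 2 then b t - 1 else 0)" for t i j
  \<comment> \<open>The rotated frame along the diagonal and (W, -V, N0) solve the same skew system
    and agree at t0. The third member then gives N = N0, the second N_x = V.\<close>
  have eg: "e t i = g t i" if t: "t \<in> I" for t i
  proof (rule skew_system_unique[of e K g t0 t i, OF _ _ _ t0 _ t])
    fix s and i :: 3 assume s: "s \<in> I"
    note d = Rl.has_vector_derivative[OF E_diagonal(1)[OF s]] Rl.has_vector_derivative[OF E_diagonal(2)[OF s]]
      Rl.has_vector_derivative[OF E_diagonal(3)[OF s]]
    show "((\<lambda>t. e t i) has_vector_derivative (\<Sum>j\<in>UNIV. K s i j *\<^sub>R e s j)) (at s)"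
      using exhaust_3[of i] d
      by (auto simp: e_def K_def sum_3 Rl.add Rl.diff Rl.scaleR diag[OF s] algebra_simps)
    have V: "((\<lambda>t. - V t) has_vector_derivative - tderiv V s) (at s)" "(N0 has_vector_derivative tderiv N0 s) (at s)"
      by (intro has_vector_derivative_minus V_deriv N0_deriv s)+
    show "((\<lambda>t. g t i) has_vector_derivative (\<Sum>j\<in>UNIV. K s i j *\<^sub>R g s j)) (at s)"
      using exhaust_3[of i] W_deriv[OF s, unfolded minus_diff_commute[of "k s *\<^sub>R V s"]] V
      by (auto simp: g_def K_def sum_3 tderiv_V[OF s] tderiv_N0[OF s] algebra_simps)
  next
    show "K t i j = - K t j i" for t i j
      using exhaust_3[of i] exhaust_3[of j] by (elim disjE) (simp_all add: K_def)
    show "e t0 i = g t0 i" for i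
      by (simp add: e_def g_def rot_t0 Rv)
  qed
  show thesis
  proof (rule that)
    show "dAlembert I t0 (alpha0 N0 V) (alpha0 N0 V) E3 surf"
    proof (rule dAlembert_frame)
      show "alpha0 N0 V t = diagonal_form t" if "t \<in> I" for t
        by (rule ext) (simp add: alpha0_def diagonal_form_def U_def B_def diag[OF that])
      have "su2 (vector [0, 0, 1]) = e3" by (simp add: su2_def)
      then show "su2 (E3 p) = F 1 p ** e3 ** adj2 (F 1 p)" if "p \<in> II" for p by (simp add: su2_rot[OF that])
    qed (rule su2_surf)
    show "cauchy_solution I N0 V (\<lambda>p. R *v E3 p)"
      unfolding cauchy_solution_def
    proof (intro conjI ballI rotated_frame(1)[OF R])
      fix t assume t: "t \<in> I"
      show "R *v E3 (t, t) = N0 t" using eg[OF t, of 3] by (simp add: e_def g_def)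
      show "pdx (\<lambda>p. R *v E3 p) (t, t) = V t"
        using eg[OF t, of 2] t by (simp add: rotated_frame(3)[OF R] e_def g_def)
    qed
  qed (fact R rotated_frame(2)[OF R])+
qed

end

lemma immersion_at_iff:
  fixes X Y :: "'b::real_normed_vector"
  assumes g: "(g has_derivative (\<lambda>v. fst v *\<^sub>R X + snd v *\<^sub>R Y)) (at p)"
  shows "immersion_at g p \<longleftrightarrow> (\<forall>r s. r *\<^sub>R X + s *\<^sub>R Y = 0 \<longrightarrow> r = 0 \<and> s = 0)"
proof -
  have lin: "linear (\<lambda>v. fst v *\<^sub>R X + snd v *\<^sub>R Y)"
    using has_derivative_bounded_linear[OF g] by (rule bounded_linear.linear)
  have "immersion_at g p \<longleftrightarrow> inj (\<lambda>v. fst v *\<^sub>R X + snd v *\<^sub>R Y)"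
    using g frechet_derivative_at[OF g] by (auto simp: immersion_at_def differentiable_def)
  also have "\<dots> \<longleftrightarrow> (\<forall>r s. r *\<^sub>R X + s *\<^sub>R Y = 0 \<longrightarrow> r = 0 \<and> s = 0)"
    unfolding linear_injective_0[OF lin] by (auto simp: zero_prod_def)
  finally show ?thesis .
qed

lemma (in open_interval) Ck_on_has_derivative:
  assumes "\<And>k. Ck_on k g II" "p \<in> II"
  shows "(g has_derivative (\<lambda>v. fst v *\<^sub>R pdx g p + snd v *\<^sub>R pdy g p)) (at p)"
  by (rule partials_imp_has_derivative[OF Ck_on_Suc_imp_partials(1)[OF assms(1)]
        Ck_on_imp_continuous[OF Ck_on_Suc_imp_partials(3)[OF assms(1)]] assms(2)])

context cauchy_data
begin

section \<open>Identities valid for every solution of the Cauchy problem\<close>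

context
  fixes N :: "real \<times> real \<Rightarrow> real^3"
  assumes sol: "cauchy_solution I N0 V N"
begin

lemma Ck_sol: "Ck_on n N II"
  using sol by (simp add: cauchy_solution_def lorentzian_harmonic_def smooth_on_def)

lemmas partials_sol = Ck_on_Suc_imp_partials[OF Ck_sol]
lemmas partials_sol_x = Ck_on_Suc_imp_partials[OF partials_sol(2)]
lemmas partials_sol_y = Ck_on_Suc_imp_partials[OF partials_sol(3)]

lemma sol_diagonal: "t \<in> I \<Longrightarrow> N (t, t) = N0 t" "t \<in> I \<Longrightarrow> pdx N (t, t) = V t"
  using sol by (simp_all add: cauchy_solution_def)

lemma sol_unit: "p \<in> II \<Longrightarrow> inner (N p) (N p) = 1"
  using sol by (auto simp: cauchy_solution_def lorentzian_harmonic_def norm_eq_1 image_subset_iff)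

lemma sol_orthogonal:
  assumes "p \<in> II"
  shows "inner (pdx N p) (N p) = 0"
proof -
  obtain x y where xy: "p = (x, y)" "x \<in> I" "y \<in> I" using assms by auto
  note d = partials_onD(1)[OF partials_sol(1) xy(2,3)]
  have "inner (N (x, y)) (pdx N (x, y)) + inner (pdx N (x, y)) (N (x, y)) = 0"
    by (rule derivative_of_constant[OF bounded_bilinear.has_vector_derivative[OF bounded_bilinear_inner d d] xy(2)])
       (use sol_unit xy in auto)
  then show ?thesis by (simp add: xy(1) inner_commute)
qed

text \<open>Harmonicity makes N_xy a multiple of N, and differentiating \<langle>N_x, N\<rangle> = 0
  in y determines the multiple. The other order of derivatives is needed to integrate N_y in
  x.\<close>

lemma sol_mixed:
  assumes "p \<in> II"
  shows "pdy (pdx N) p = - inner (pdx N p) (pdy N p) *\<^sub>R N p" "pdx (pdy N) p = - inner (pdx N p) (pdy N p) *\<^sub>R N p"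
proof -
  obtain x y where xy: "p = (x, y)" "x \<in> I" "y \<in> I" using assms by auto
  let ?w = "pdy (pdx N) p"
  have "cross3 (N p) ?w = 0" using sol xy by (simp add: cauchy_solution_def lorentzian_harmonic_def)
  then have "inner (N p) ?w *\<^sub>R N p - inner (N p) (N p) *\<^sub>R ?w = 0"
    unfolding cross_cross[symmetric] by simp
  then have w: "?w = inner (N p) ?w *\<^sub>R N p" by (simp add: sol_unit[OF assms])
  have "inner (pdx N (x, y)) (pdy N (x, y)) + inner (pdy (pdx N) (x, y)) (N (x, y)) = 0"
    by (rule derivative_of_constant[OF bounded_bilinear.has_vector_derivative[OF bounded_bilinear_inner
            partials_onD(2)[OF partials_sol_x(1) xy(2,3)] partials_onD(2)[OF partials_sol(1) xy(2,3)]] xy(3)])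
       (use sol_orthogonal xy in auto)
  then have "inner (N p) ?w = - inner (pdx N p) (pdy N p)" by (simp add: xy(1) inner_commute)
  with w show e: "?w = - inner (pdx N p) (pdy N p) *\<^sub>R N p" by simp
  show "pdx (pdy N) p = - inner (pdx N p) (pdy N p) *\<^sub>R N p"
    unfolding e[symmetric] by (rule mixed_partials[OF Ck_sol assms])
qed

lemma sol_diagonal_y:
  assumes t: "t \<in> I"
  shows "pdy N (t, t) = tderiv N0 t - V t"
proof -
  have tt: "(t, t) \<in> II" using t by simp
  have "((\<lambda>s. N (s, s)) has_vector_derivative V t + pdy N (t, t)) (at t)"
    using has_derivative_imp_diagonal[OF Ck_on_has_derivative[OF Ck_sol tt]] by (simp add: sol_diagonal[OF t])
  then have "(N0 has_vector_derivative V t + pdy N (t, t)) (at t)"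
    by (rule has_vector_derivative_transform_within_open[OF _ open_I t]) (rule sol_diagonal)
  then show ?thesis using vector_derivative_at[of N0] by (simp add: algebra_simps)
qed

lemma sol_continuous: "continuous_on II (pdx N)" "continuous_on II (pdy N)"
  by (rule Ck_on_imp_continuous[OF partials_sol(2)], rule Ck_on_imp_continuous[OF partials_sol(3)])

end

text \<open>N_xy depends on N and both first derivatives, so the three differences are estimated
  together. All vanish on the diagonal, that of N_y because N0' = N_x + N_y there.\<close>

lemma cauchy_solution_unique:
  assumes N: "cauchy_solution I N0 V N" and M: "cauchy_solution I N0 V M" and p: "p \<in> II"
  shows "N p = M p"
proof -
  obtain x0 y0 where xy0: "p = (x0, y0)" "x0 \<in> I" "y0 \<in> I" using p by auto
  obtain l u where lu: "l \<in> I" "u \<in> I" "l < x0" "l < y0" "x0 < u" "y0 < u"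
    using obtain_enclosing[OF xy0(2,3)] by blast
  \<comment> \<open>In a square with equal sides, the horizontal and vertical segments from a point
    to the diagonal stay inside.\<close>
  define S where "S = {l..u} \<times> {l..u}"
  have SI: "S \<subseteq> II" using ivl_subset[OF lu(1,2)] by (auto simp: S_def)
  have cS: "compact S" by (simp add: S_def compact_Times)
  have bd: "\<exists>P>0. \<forall>q\<in>S. norm (g q) \<le> P" if "continuous_on II g" for g :: "real \<times> real \<Rightarrow> real^3"
    using compact_imp_bounded[OF compact_continuous_image[OF continuous_on_subset[OF that SI] cS]]
    by (force simp: bounded_pos)
  obtain P1 P2 P3 where P': "\<And>q. q \<in> S \<Longrightarrow> norm (pdx M q) \<le> P1" "\<And>q. q \<in> S \<Longrightarrow> norm (pdy M q) \<le> P2"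
    "\<And>q. q \<in> S \<Longrightarrow> norm (pdy N q) \<le> P3" "0 < P1" "0 < P2" "0 < P3"
    using bd[OF sol_continuous(1)[OF M]] bd[OF sol_continuous(2)[OF M]] bd[OF sol_continuous(2)[OF N]] by metis
  define P where "P = P1 + P2 + P3"
  have P: "norm (pdx M q) \<le> P" "norm (pdy M q) \<le> P" "norm (pdy N q) \<le> P" "0 < P" if "q \<in> S" for q
    using P'(1)[OF that] P'(2)[OF that] P'(3)[OF that] P'(4-6) by (auto simp: P_def)
  define D where "D q = N q - M q" for q
  define Dx where "Dx q = pdx N q - pdx M q" for q
  define Dy where "Dy q = pdy N q - pdy M q" for q
  define Z where "Z q = pdy (pdx N) q - pdy (pdx M) q" for q
  define \<sigma> where "\<sigma> q = norm (D q) + norm (Dx q) + norm (Dy q)" for q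
  \<comment> \<open>P bounds the terms with one changed derivative, P * P the term in which N itself
    changes; the sum dominates both.\<close>
  define L where "L = P + P * P"
  have P0: "0 < P" using P'(4-6) by (simp add: P_def)
  then have L0: "0 \<le> L" by (simp add: L_def)
  have Z: "norm (Z q) \<le> L * \<sigma> q" if q: "q \<in> S" for q
  proof -
    have qI: "q \<in> II" using q SI by auto
    let ?nx = "pdx N q" and ?ny = "pdy N q" and ?mx = "pdx M q" and ?my = "pdy M q"
    have nN: "norm (N q) = 1" using sol_unit[OF N qI] by (simp add: norm_eq_1)
    \<comment> \<open>The trilinear expression is changed one factor at a time.\<close>
    have "Z q = - (inner (Dx q) ?ny *\<^sub>R N q + inner ?mx (Dy q) *\<^sub>R N q + inner ?mx ?my *\<^sub>R D q)"
      unfolding Z_def sol_mixed(1)[OF N qI] sol_mixed(1)[OF M qI] D_def Dx_def Dy_def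
      by (simp add: inner_diff_left inner_diff_right algebra_simps)
    then have "norm (Z q) \<le> norm (inner (Dx q) ?ny *\<^sub>R N q) + norm (inner ?mx (Dy q) *\<^sub>R N q) + norm (inner ?mx ?my *\<^sub>R D q)"
      by (simp only: norm_minus_cancel) (intro order_trans[OF norm_triangle_ineq] add_mono norm_triangle_ineq order_refl)
    also have "\<dots> = \<bar>inner (Dx q) ?ny\<bar> + \<bar>inner ?mx (Dy q)\<bar> + \<bar>inner ?mx ?my\<bar> * norm (D q)"
      by (simp add: nN)
    also have "\<dots> \<le> norm (Dx q) * P + P * norm (Dy q) + (P * P) * norm (D q)"
    proof (intro add_mono mult_right_mono)
      show "\<bar>inner (Dx q) ?ny\<bar> \<le> norm (Dx q) * P"
        by (rule order_trans[OF Cauchy_Schwarz_ineq2]) (intro mult_left_mono P(3)[OF q] norm_ge_zero)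
      show "\<bar>inner ?mx (Dy q)\<bar> \<le> P * norm (Dy q)"
        by (rule order_trans[OF Cauchy_Schwarz_ineq2]) (intro mult_right_mono P(1)[OF q] norm_ge_zero)
      show "\<bar>inner ?mx ?my\<bar> \<le> P * P"
        by (rule order_trans[OF Cauchy_Schwarz_ineq2]) (use P0 in \<open>intro mult_mono P[OF q]; simp\<close>)
    qed simp
    also have "\<dots> \<le> L * norm (Dx q) + L * norm (Dy q) + L * norm (D q)"
    proof -
      have "P * r \<le> L * r" "P * P * r \<le> L * r" if "0 \<le> r" for r
        using that P0 by (auto simp: L_def algebra_simps)
      from this(1)[of "norm (Dx q)"] this(1)[of "norm (Dy q)"] this(2)[of "norm (D q)"]
      show ?thesis unfolding mult.commute[of "norm (Dx q)" P] by simp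
    qed
    finally show ?thesis by (simp add: \<sigma>_def algebra_simps)
  qed
  have "continuous_on II \<sigma>"
    unfolding \<sigma>_def D_def Dx_def Dy_def
    by (intro continuous_intros sol_continuous N M Ck_on_imp_continuous[OF Ck_sol[OF N]] Ck_on_imp_continuous[OF Ck_sol[OF M]])
  then have "bounded (\<sigma> ` S)"
    using compact_imp_bounded[OF compact_continuous_image[OF continuous_on_subset[OF _ SI] cS]] by blast
  then obtain C0 where C0: "0 < C0" "\<forall>q\<in>S. \<bar>\<sigma> q\<bar> \<le> C0" by (force simp: bounded_pos)
  have "\<sigma> p \<le> 0"
  \<comment> \<open>The constant adds the three gains: 1 for the difference of N, whose y-derivative
    is part of \<sigma>, and L for each first derivative.\<close>
  proof (rule vanishes_if_gains[where S = S and K = "2 * L + 1" and ?C0.0 = C0])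
    show "p \<in> S" using lu xy0 by (simp add: S_def)
    show "0 \<le> 2 * L + 1" using L0 by simp
    show "0 \<le> C0" using C0 by simp
    show "\<sigma> q \<le> C0" if "q \<in> S" for q using C0 that by (auto intro: order_trans[OF abs_ge_self])
    fix n C q
    assume C: "0 \<le> C" and ind: "\<And>q. q \<in> S \<Longrightarrow> \<sigma> q \<le> C * \<bar>snd q - fst q\<bar> ^ n" and q: "q \<in> S"
    obtain x y where xy: "q = (x, y)" "x \<in> {l..u}" "y \<in> {l..u}" using q by (auto simp: S_def)
    then have xyI: "x \<in> I" "y \<in> I" using ivl_subset[OF lu(1,2)] by auto
    have seg: "s \<in> {l..u}" "s \<in> I" if "s \<in> closed_segment x y" for s
      using that xy ivl_subset[OF lu(1,2)] by (auto simp: closed_segment_eq_real_ivl split: if_splits)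
    have Zs: "norm (Z q) \<le> (L * C) * \<bar>snd q - fst q\<bar> ^ n" if "q \<in> S" for q
      using order_trans[OF Z[OF that] mult_left_mono[OF ind[OF that] L0]] by (simp add: mult.assoc)
    have 1: "norm (D (x, y) - D (x, x)) \<le> C * \<bar>y - x\<bar> ^ Suc n / Suc n"
    proof (rule norm_increment_le_power[where g = "\<lambda>s. Dy (x, s)"])
      fix s assume s: "s \<in> closed_segment x y"
      show "((\<lambda>s. D (x, s)) has_vector_derivative Dy (x, s)) (at s)"
        unfolding D_def Dy_def using seg[OF s] xyI
        by (intro has_vector_derivative_diff partials_onD(2)[OF partials_sol(1)] N M)
      show "norm (Dy (x, s)) \<le> C * \<bar>s - x\<bar> ^ n"
        using ind[of "(x, s)"] seg[OF s] xy by (simp add: S_def \<sigma>_def) (smt (verit) norm_ge_zero)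
    qed
    have 2: "norm (Dx (x, y) - Dx (x, x)) \<le> (L * C) * \<bar>y - x\<bar> ^ Suc n / Suc n"
    proof (rule norm_increment_le_power[where g = "\<lambda>s. Z (x, s)"])
      fix s assume s: "s \<in> closed_segment x y"
      show "((\<lambda>s. Dx (x, s)) has_vector_derivative Z (x, s)) (at s)"
        unfolding Dx_def Z_def using seg[OF s] xyI
        by (intro has_vector_derivative_diff partials_onD(2)[OF partials_sol_x(1)] N M)
      show "norm (Z (x, s)) \<le> L * C * \<bar>s - x\<bar> ^ n"
        using Zs[of "(x, s)"] seg[OF s] xy by (simp add: S_def)
    qed
    have 3: "norm (Dy (x, y) - Dy (y, y)) \<le> (L * C) * \<bar>x - y\<bar> ^ Suc n / Suc n"
    proof (rule norm_increment_le_power[where G = "\<lambda>s. Dy (s, y)" and g = "\<lambda>s. Z (s, y)"])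
      fix s assume "s \<in> closed_segment y x"
      then have s: "s \<in> closed_segment x y" by (simp add: closed_segment_commute)
      have sI: "(s, y) \<in> II" using seg[OF s] xyI by simp
      have "Z (s, y) = pdx (pdy N) (s, y) - pdx (pdy M) (s, y)"
        unfolding Z_def sol_mixed[OF N sI] sol_mixed[OF M sI] ..
      then show "((\<lambda>s. Dy (s, y)) has_vector_derivative Z (s, y)) (at s)"
        unfolding Dy_def using seg[OF s] xyI
        by (simp only:) (intro has_vector_derivative_diff partials_onD(1)[OF partials_sol_y(1)] N M)
      show "norm (Z (s, y)) \<le> L * C * \<bar>s - y\<bar> ^ n"
        using Zs[of "(s, y)"] seg[OF s] xy by (simp add: S_def abs_minus_commute)
    qed
    have "D (x, x) = 0" "Dx (x, x) = 0" "Dy (y, y) = 0"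
      using xyI by (simp_all add: D_def Dx_def Dy_def sol_diagonal[OF N] sol_diagonal[OF M] sol_diagonal_y[OF N] sol_diagonal_y[OF M])
    with 1 2 3 have "\<sigma> (x, y) \<le> C * \<bar>y - x\<bar> ^ Suc n / Suc n + (L * C) * \<bar>y - x\<bar> ^ Suc n / Suc n + (L * C) * \<bar>y - x\<bar> ^ Suc n / Suc n"
      unfolding \<sigma>_def by (intro add_mono) (simp_all add: abs_minus_commute)
    also have "\<dots> = (2 * L + 1) * C * \<bar>y - x\<bar> ^ Suc n / Suc n" by (simp add: field_simps del: of_nat_Suc)
    finally show "\<sigma> q \<le> (2 * L + 1) * C * \<bar>snd q - fst q\<bar> ^ Suc n / Suc n" using xy(1) by simp
  qed
  then have "norm (D p) \<le> 0" unfolding \<sigma>_def by (smt (verit) norm_ge_zero)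
  then show ?thesis by (simp add: D_def)
qed

lemma associated_surface_cong:
  assumes N: "cauchy_solution I N0 V N" and M: "cauchy_solution I N0 V M" and f: "associated_surface II M f"
  shows "associated_surface II N f"
proof -
  have "partials_on N (pdx M) (pdy M)"
    by (rule partials_on_cong[OF partials_sol(1)[OF M]]) (simp_all add: cauchy_solution_unique[OF M N])
  then show ?thesis
    using f partials_on_pd[of N "pdx M" "pdy M"] cauchy_solution_unique[OF N M] unfolding associated_surface_def by simp
qed

section \<open>The singularities along the initial curve\<close>

lemma VW_independent:
  assumes "t \<in> I"
  shows "r *\<^sub>R V t + s *\<^sub>R W t = 0 \<longleftrightarrow> r = 0 \<and> s = 0"
proof
  assume e: "r *\<^sub>R V t + s *\<^sub>R W t = 0"
  from arg_cong[OF e, of "\<lambda>v. inner v (V t)"] arg_cong[OF e, of "\<lambda>v. inner v (W t)"]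
  show "r = 0 \<and> s = 0" by (simp add: inner_add_left frame_products[OF assms])
qed simp

context
  fixes N f :: "real \<times> real \<Rightarrow> real^3" and t :: real
  assumes sol: "cauchy_solution I N0 V N" and surface: "associated_surface II N f" and t: "t \<in> I"
begin

lemma tt: "(t, t) \<in> II" using t by simp

lemma Ny_diagonal: "s \<in> I \<Longrightarrow> pdy N (s, s) = a s *\<^sub>R W s - b s *\<^sub>R V s"
  by (simp add: sol_diagonal_y[OF sol] tderiv_N0 algebra_simps)

lemma Ck_surface: "Ck_on n f II"
  using surface by (simp add: associated_surface_def smooth_on_def)

lemma N_derivative: "(N has_derivative (\<lambda>v. fst v *\<^sub>R V t + snd v *\<^sub>R (a t *\<^sub>R W t - b t *\<^sub>R V t))) (at (t, t))"
  using Ck_on_has_derivative[OF Ck_sol[OF sol] tt] by (simp add: Ny_diagonal[OF t] sol_diagonal[OF sol t])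

lemma f_derivative: "(f has_derivative (\<lambda>v. fst v *\<^sub>R W t + snd v *\<^sub>R (a t *\<^sub>R V t + b t *\<^sub>R W t))) (at (t, t))"
proof -
  have "pdx f (t, t) = W t" "pdy f (t, t) = a t *\<^sub>R V t + b t *\<^sub>R W t"
    using surface tt unfolding associated_surface_def
    by (simp_all add: Ny_diagonal[OF t] sol_diagonal[OF sol t] Cross3.right_diff_distrib cross_mult_right frame_products[OF t])
  then show ?thesis using Ck_on_has_derivative[OF Ck_surface tt] by simp
qed

lemma immersion_N: "immersion_at N (t, t) \<longleftrightarrow> a t \<noteq> 0"
proof -
  have "r *\<^sub>R V t + s *\<^sub>R (a t *\<^sub>R W t - b t *\<^sub>R V t) = (r - s * b t) *\<^sub>R V t + (s * a t) *\<^sub>R W t" for r s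
    by (simp add: algebra_simps)
  then have "immersion_at N (t, t) \<longleftrightarrow> (\<forall>r s. r - s * b t = 0 \<and> s * a t = 0 \<longrightarrow> r = 0 \<and> s = 0)"
    by (simp only: immersion_at_iff[OF N_derivative] VW_independent[OF t])
  also have "\<dots> \<longleftrightarrow> a t \<noteq> 0"
  proof
    assume "\<forall>r s. r - s * b t = 0 \<and> s * a t = 0 \<longrightarrow> r = 0 \<and> s = 0"
    \<comment> \<open>If a = 0 then N_y = - b N_x, so (b, 1) is in the kernel of the
      differential.\<close>
    from spec[OF spec[OF this, of "b t"], of 1] show "a t \<noteq> 0" by auto
  qed auto
  finally show ?thesis .
qed

lemma immersion_f: "immersion_at f (t, t) \<longleftrightarrow> a t \<noteq> 0"
proof -
  have "r *\<^sub>R W t + s *\<^sub>R (a t *\<^sub>R V t + b t *\<^sub>R W t) = (s * a t) *\<^sub>R V t + (r + s * b t) *\<^sub>R W t" for r s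
    by (simp add: algebra_simps)
  then have "immersion_at f (t, t) \<longleftrightarrow> (\<forall>r s. s * a t = 0 \<and> r + s * b t = 0 \<longrightarrow> r = 0 \<and> s = 0)"
    by (simp only: immersion_at_iff[OF f_derivative] VW_independent[OF t])
  also have "\<dots> \<longleftrightarrow> a t \<noteq> 0"
  proof
    assume "\<forall>r s. s * a t = 0 \<and> r + s * b t = 0 \<longrightarrow> r = 0 \<and> s = 0"
    \<comment> \<open>If a = 0 then f_y = b f_x, so (-b, 1) is in the kernel of the
      differential.\<close>
    from spec[OF spec[OF this, of "- b t"], of 1] show "a t \<noteq> 0" by auto
  qed auto
  finally show ?thesis .
qed

text \<open>For a = 0 the kernels of the differentials of f and N are spanned by (-b, 1) and (b, 1).
  They meet nontrivially only when b = 0 as well.\<close>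

lemma wave_front_diagonal: "wave_front_at f N (t, t) \<longleftrightarrow> (a t, b t) \<noteq> (0, 0)"
proof -
  have "((\<lambda>q. (f q, N q)) has_derivative (\<lambda>v. fst v *\<^sub>R (W t, V t) + snd v *\<^sub>R (a t *\<^sub>R V t + b t *\<^sub>R W t, a t *\<^sub>R W t - b t *\<^sub>R V t))) (at (t, t))"
    using has_derivative_Pair[OF f_derivative N_derivative] by simp
  note i = immersion_at_iff[OF this]
  have "r *\<^sub>R (W t, V t) + s *\<^sub>R (a t *\<^sub>R V t + b t *\<^sub>R W t, a t *\<^sub>R W t - b t *\<^sub>R V t) =
    ((s * a t) *\<^sub>R V t + (r + s * b t) *\<^sub>R W t, (r - s * b t) *\<^sub>R V t + (s * a t) *\<^sub>R W t)" for r s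
    by (simp add: algebra_simps)
  then have "wave_front_at f N (t, t) \<longleftrightarrow>
    (\<forall>r s. (s * a t = 0 \<and> r + s * b t = 0) \<and> r - s * b t = 0 \<and> s * a t = 0 \<longrightarrow> r = 0 \<and> s = 0)"
    unfolding wave_front_at_def i zero_prod_def by (simp only: prod.inject VW_independent[OF t])
  also have "\<dots> \<longleftrightarrow> (a t, b t) \<noteq> (0, 0)"
  proof
    assume "\<forall>r s. (s * a t = 0 \<and> r + s * b t = 0) \<and> r - s * b t = 0 \<and> s * a t = 0 \<longrightarrow> r = 0 \<and> s = 0"
    from spec[OF spec[OF this, of 0], of 1] show "(a t, b t) \<noteq> (0, 0)" by auto
  next
    assume "(a t, b t) \<noteq> (0, 0)"
    have "r = 0 \<and> s = 0"
      if "(s * a t = 0 \<and> r + s * b t = 0) \<and> r - s * b t = 0 \<and> s * a t = 0" for r s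
    proof -
      have "s * b t = 0" "r = 0" using that by linarith+
      then show ?thesis using that \<open>(a t, b t) \<noteq> (0, 0)\<close> by auto
    qed
    then show "\<forall>r s. (s * a t = 0 \<and> r + s * b t = 0) \<and> r - s * b t = 0 \<and> s * a t = 0 \<longrightarrow> r = 0 \<and> s = 0"
      by blast
  qed
  finally show ?thesis .
qed

lemma singular_function_eq: "singular_function N = (\<lambda>p. inner (pdx N p) (cross3 (pdy N p) (N p)))"
  by (rule ext) (simp add: singular_function_def dot_cross_det)

lemma Ck_singular_function: "Ck_on n (singular_function N) II"
  unfolding singular_function_eq
  by (intro Ck_on_bilinear[OF bounded_bilinear_inner open_II] Ck_on_bilinear[OF bounded_bilinear_cross open_II]
      partials_sol[OF sol] Ck_sol[OF sol])

lemma singular_function_diagonal: "s \<in> I \<Longrightarrow> singular_function N (s, s) = a s"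
  by (simp add: singular_function_eq sol_diagonal[OF sol] Ny_diagonal Cross3.left_diff_distrib cross_mult_left
      frame_products inner_add_right)

text \<open>Only N_xx contributes: \<langle>N_x, N_y \<times> N_x\<rangle> vanishes and N_xy is
  parallel to N. As N_y \<times> N = b W, the component of N_xx along W is what counts; it comes
  from differentiating N_x = V along the diagonal, where the N_xy term is normal to the
  sphere.\<close>

lemma singular_function_x:
  assumes "a t = 0"
  shows "pdx (singular_function N) (t, t) = b t * k t"
proof -
  let ?w = "pdx (pdx N) (t, t)"
  note x = partials_onD(1)[OF partials_sol(1)[OF sol] t t] partials_onD(1)[OF partials_sol_x(1)[OF sol] t t]
    partials_onD(1)[OF partials_sol_y(1)[OF sol] t t]
  have "((\<lambda>s. singular_function N (s, t)) has_vector_derivative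
      inner (pdx N (t, t)) (cross3 (pdy N (t, t)) (pdx N (t, t)) + cross3 (pdx (pdy N) (t, t)) (N (t, t)))
      + inner ?w (cross3 (pdy N (t, t)) (N (t, t)))) (at t)"
    unfolding singular_function_eq
    by (intro bounded_bilinear.has_vector_derivative[OF bounded_bilinear_inner]
        bounded_bilinear.has_vector_derivative[OF bounded_bilinear_cross] x)
  moreover have "cross3 (pdx (pdy N) (t, t)) (N (t, t)) = 0"
    by (simp add: sol_mixed(2)[OF sol tt] cross_mult_left)
  moreover have "cross3 (pdy N (t, t)) (N (t, t)) = b t *\<^sub>R W t"
    using assms by (simp add: Ny_diagonal[OF t] sol_diagonal[OF sol t] cross_mult_left frame_products[OF t])
  moreover have "inner ?w (W t) = k t"
  proof -
    have "((\<lambda>s. pdx N (s, s)) has_vector_derivative ?w + pdy (pdx N) (t, t)) (at t)"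
      using has_derivative_imp_diagonal[OF Ck_on_has_derivative[OF partials_sol(2)[OF sol] tt]] by simp
    then have "(V has_vector_derivative ?w + pdy (pdx N) (t, t)) (at t)"
      by (rule has_vector_derivative_transform_within_open[OF _ open_I t]) (rule sol_diagonal(2)[OF sol])
    then have "tderiv V t = ?w + pdy (pdx N) (t, t)" by (rule vector_derivative_at)
    then show ?thesis
      by (simp add: coef_c_eq[OF t] inner_add_left inner_diff_left sol_mixed(1)[OF sol tt] sol_diagonal[OF sol t] frame_products[OF t])
  qed
  ultimately have "((\<lambda>s. singular_function N (s, t)) has_vector_derivative b t * k t) (at t)"
    by (simp add: dot_cross_self)
  then show ?thesis by (simp add: pdx_def vector_derivative_at)
qed

text \<open>The singular function restricts to a on the diagonal, so a' is the sum of its two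
  partial derivatives. The x-derivative is b c, hence both partials vanish exactly when b c and a'
  do.\<close>

lemma singular_set_diagonal:
  assumes "(t, t) \<in> singular_set II N"
  shows "singular_set_locally_regular_at N (t, t) \<longleftrightarrow> (b t * k t, deriv a t) \<noteq> (0, 0)"
proof -
  let ?m = "singular_function N"
  have a0: "a t = 0" using assms singular_function_diagonal[OF t] by (simp add: singular_set_def)
  note d = Ck_on_has_derivative[OF Ck_singular_function tt]
  have "((\<lambda>s. ?m (s, s)) has_vector_derivative pdx ?m (t, t) + pdy ?m (t, t)) (at t)"
    using has_derivative_imp_diagonal[OF d] by simp
  then have "(a has_vector_derivative pdx ?m (t, t) + pdy ?m (t, t)) (at t)"
    by (rule has_vector_derivative_transform_within_open[OF _ open_I t]) (rule singular_function_diagonal)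
  then have a': "deriv a t = pdx ?m (t, t) + pdy ?m (t, t)"
    by (intro DERIV_imp_deriv) (simp add: has_real_derivative_iff_has_vector_derivative)
  have "singular_set_locally_regular_at N (t, t) \<longleftrightarrow>
      (\<lambda>v. fst v *\<^sub>R pdx ?m (t, t) + snd v *\<^sub>R pdy ?m (t, t)) \<noteq> (\<lambda>v. 0)"
    unfolding singular_set_locally_regular_at_def frechet_derivative_at[OF d, symmetric]
    using d by (auto simp: differentiable_def)
  also have "\<dots> \<longleftrightarrow> pdx ?m (t, t) \<noteq> 0 \<or> pdy ?m (t, t) \<noteq> 0"
  proof -
    have "pdx ?m (t, t) = 0 \<and> pdy ?m (t, t) = 0"
      if e: "(\<lambda>v. fst v *\<^sub>R pdx ?m (t, t) + snd v *\<^sub>R pdy ?m (t, t)) = (\<lambda>v. 0)"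
      using fun_cong[OF e, of "(1, 0)"] fun_cong[OF e, of "(0, 1)"] by simp
    then show ?thesis by (auto simp: fun_eq_iff)
  qed
  finally show ?thesis using a' singular_function_x[OF a0] by auto
qed

end

end

section \<open>Real analytic curves are smooth\<close>

lemma sums_vec:
  fixes f :: "nat \<Rightarrow> real^'n"
  assumes "\<And>i. (\<lambda>n. f n $ i) sums (s $ i)"
  shows "f sums s"
  unfolding sums_def by (intro vec_tendstoI) (use assms in \<open>simp add: sums_def\<close>)

lemma field_derivative_shift:
  fixes g :: "real \<Rightarrow> real"
  assumes "(g has_field_derivative d) (at (s - t))"
  shows "((\<lambda>u. g (u - t)) has_field_derivative d) (at s)"
proof -
  have "((\<lambda>u. u - t) has_field_derivative 1) (at s)" by (auto intro!: derivative_eq_intros)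
  from DERIV_chain2[OF assms this] show ?thesis by simp
qed

lemma has_vector_derivative_vec:
  fixes f :: "real \<Rightarrow> real^'n"
  assumes "\<And>i. ((\<lambda>s. f s $ i) has_real_derivative d $ i) (at t)"
  shows "(f has_vector_derivative d) (at t)"
proof -
  have e: "(\<Sum>i\<in>UNIV. x $ i *\<^sub>R axis i 1) = x" for x :: "real^'n"
    using basis_expansion[of x] by (simp add: scalar_mult_eq_scaleR)
  have "((\<lambda>s. \<Sum>i\<in>UNIV. f s $ i *\<^sub>R axis i 1) has_vector_derivative (\<Sum>i\<in>UNIV. d $ i *\<^sub>R axis i (1::real))) (at t)"
    using assms unfolding has_real_derivative_iff_has_vector_derivative
    by (intro has_vector_derivative_sum bounded_linear.has_vector_derivative[OF bounded_linear_scaleR_left])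
  then show ?thesis by (simp add: e)
qed

text \<open>Termwise differentiation of the power series in each component; iterating it makes
  analytic curves smooth.\<close>

lemma real_analytic_derivative:
  fixes f :: "real \<Rightarrow> real^'n"
  assumes "real_analytic_on f S"
  shows "t \<in> S \<Longrightarrow> (f has_vector_derivative vector_derivative f (at t)) (at t)"
    and "real_analytic_on (\<lambda>t. vector_derivative f (at t)) S"
proof -
  \<comment> \<open>All s near t are treated with one coefficient sequence, since expanding the
    derivative about t needs its values at nearby points.\<close>
  have local: "\<exists>r>0. \<exists>e. \<forall>s. \<bar>s - t\<bar> < r \<longrightarrow> (f has_vector_derivative vector_derivative f (at s)) (at s) \<and>
      (\<lambda>n. (s - t) ^ n *\<^sub>R e n) sums vector_derivative f (at s)" if t: "t \<in> S" for t
  proof -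
    obtain r c where r: "0 < r" and c: "\<And>s. \<bar>s - t\<bar> < r \<Longrightarrow> (\<lambda>n. (s - t) ^ n *\<^sub>R c n) sums f s"
      using assms t unfolding real_analytic_on_def by metis
    \<comment> \<open>The coefficients of the termwise differentiated series about t.\<close>
    define e where "e n = real (Suc n) *\<^sub>R c (Suc n)" for n
    have main: "\<exists>d. (f has_vector_derivative d) (at s) \<and> (\<lambda>n. (s - t) ^ n *\<^sub>R e n) sums d" if s: "\<bar>s - t\<bar> < r" for s
    proof -
      define d where "d = (\<chi> i. \<Sum>n. diffs (\<lambda>n. c n $ i) n * (s - t) ^ n)"
      have ci: "(\<lambda>n. c n $ i * z ^ n) sums (f (t + z) $ i)" if "norm z < r" for z i
        using bounded_linear.sums[OF bounded_linear_vec_nth c[of "t + z"], of i] that by (simp add: mult.commute)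
      have ds: "((\<lambda>s. f s $ i) has_real_derivative d $ i) (at s) \<and>
          (\<lambda>n. diffs (\<lambda>n. c n $ i) n * (s - t) ^ n) sums (d $ i)" for i
      proof
        have sm: "summable (\<lambda>n. c n $ i * z ^ n)" if "norm z < r" for z using ci[OF that] by (rule sums_summable)
        have "((\<lambda>z. \<Sum>n. c n $ i * z ^ n) has_field_derivative d $ i) (at (s - t))"
          using termdiffs_strong'[of r "\<lambda>n. c n $ i" "s - t", OF sm] s by (simp add: d_def)
        then have "((\<lambda>u. \<Sum>n. c n $ i * (u - t) ^ n) has_field_derivative d $ i) (at s)"
          by (rule field_derivative_shift)
        then show "((\<lambda>s. f s $ i) has_real_derivative d $ i) (at s)"
        proof (rule has_field_derivative_transform_within_open)
          show "open (ball t r)" "s \<in> ball t r" using s by (auto simp: dist_real_def)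
          show "(\<Sum>n. c n $ i * (u - t) ^ n) = f u $ i" if "u \<in> ball t r" for u
            using sums_unique[OF ci[of "u - t" i]] that by (simp add: dist_real_def abs_minus_commute)
        qed
        have "summable (\<lambda>n. diffs (\<lambda>n. c n $ i) n * (s - t) ^ n)"
          by (rule termdiff_converges[OF _ sm]) (use s in auto)
        then show "(\<lambda>n. diffs (\<lambda>n. c n $ i) n * (s - t) ^ n) sums (d $ i)"
          by (simp add: d_def summable_sums)
      qed
      have "(\<lambda>n. (s - t) ^ n *\<^sub>R e n) sums d"
        by (rule sums_vec) (use ds in \<open>simp add: e_def diffs_def mult_ac\<close>)
      then show ?thesis using has_vector_derivative_vec ds by blast
    qed
    show ?thesis
      by (rule exI[of _ r], rule conjI[OF r], rule exI[of _ e]) (use main vector_derivative_at in metis)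
  qed
  show "(f has_vector_derivative vector_derivative f (at t)) (at t)" if "t \<in> S"
    using local[OF that] by force
  show "real_analytic_on (\<lambda>t. vector_derivative f (at t)) S"
    unfolding real_analytic_on_def using local by blast
qed

lemma real_analytic_imp_Ck:
  fixes f :: "real \<Rightarrow> real^'n"
  assumes "open S"
  shows "real_analytic_on f S \<Longrightarrow> Ck_on k f S"
proof (induction k arbitrary: f)
  case 0
  then show ?case
    using real_analytic_derivative(1)[OF 0]
    by (auto intro!: continuous_at_imp_continuous_on has_vector_derivative_continuous)
next
  case (Suc k)
  show ?case
    by (rule Ck_on_Suc_realI[OF assms real_analytic_derivative(1)[OF Suc.prems] Suc.IH[OF real_analytic_derivative(2)[OF Suc.prems]]])
qed

theorem theorem5p1:
  fixes I :: "real set" and N0 V :: "real \<Rightarrow> real^3"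
  assumes "open I" and "is_interval I"
    and "real_analytic_on N0 I" and "N0 ` I \<subseteq> sphere 0 1"
    and "real_analytic_on V I" and "V ` I \<subseteq> sphere 0 1"
    and "\<forall>t\<in>I. inner (V t) (N0 t) = 0"
    and "\<exists>t\<in>I. inner (V t - vector_derivative N0 (at t)) (V t) \<noteq> 0"
  shows "(\<exists>N. cauchy_solution I N0 V N) \<and>
    (\<forall>N N'. cauchy_solution I N0 V N \<and> cauchy_solution I N0 V N' \<longrightarrow>
       (\<exists>T. orthogonal_transformation T \<and> (\<forall>p \<in> I \<times> I. N' p = T (N p)))) \<and>
    (\<forall>N. cauchy_solution I N0 V N \<longrightarrow>
       (\<forall>t0\<in>I. \<exists>Nhat fhat. dAlembert I t0 (alpha0 N0 V) (alpha0 N0 V) Nhat fhat \<and>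
          (\<exists>R :: real^3^3. rotation_matrix R \<and> (\<forall>p \<in> I \<times> I. N p = R *v Nhat p) \<and>
             associated_surface (I \<times> I) N (\<lambda>p. R *v fhat p))) \<and>
       (\<forall>f. associated_surface (I \<times> I) N f \<longrightarrow>
          (\<forall>t\<in>I.
             (wave_front_at f N (t, t) \<longleftrightarrow> (coef_a N0 V t, coef_b N0 V t) \<noteq> (0, 0)) \<and>
             (immersion_at N (t, t) \<longleftrightarrow> coef_a N0 V t \<noteq> 0) \<and>
             (immersion_at f (t, t) \<longleftrightarrow> coef_a N0 V t \<noteq> 0) \<and>
             ((t, t) \<in> singular_set (I \<times> I) N \<longrightarrow>
               (singular_set_locally_regular_at N (t, t) \<longleftrightarrow>
                  (coef_b N0 V t * coef_c N0 V t, deriv (coef_a N0 V) t) \<noteq> (0, 0))))))"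
proof -
  interpret cauchy_data I N0 V
    using assms(1,2,4,6,7) real_analytic_imp_Ck[OF assms(1,3)] real_analytic_imp_Ck[OF assms(1,5)]
    by unfold_locales auto
  show ?thesis
  proof (intro conjI allI impI ballI)
    obtain t0 where "t0 \<in> I" using assms(8) by blast
    then show "\<exists>N. cauchy_solution I N0 V N" using dAlembert_solution by metis
  next
    fix N N' assume "cauchy_solution I N0 V N \<and> cauchy_solution I N0 V N'"
    \<comment> \<open>The initial conditions fix N itself, so the isometry is the identity.\<close>
    then have "\<forall>p \<in> I \<times> I. N' p = id (N p)" using cauchy_solution_unique by simp
    then show "\<exists>T. orthogonal_transformation T \<and> (\<forall>p \<in> I \<times> I. N' p = T (N p))"
      using orthogonal_transformation_id by (metis id_def)
  next
    fix N t0 assume N: "cauchy_solution I N0 V N" and t0: "t0 \<in> I"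
    obtain Nhat fhat and R :: "real^3^3" where
      R: "dAlembert I t0 (alpha0 N0 V) (alpha0 N0 V) Nhat fhat" "rotation_matrix R"
      and M: "cauchy_solution I N0 V (\<lambda>p. R *v Nhat p)" "associated_surface II (\<lambda>p. R *v Nhat p) (\<lambda>p. R *v fhat p)"
      using dAlembert_solution[OF t0] by metis
    with cauchy_solution_unique[OF N M(1)] associated_surface_cong[OF N M]
    show "\<exists>Nhat fhat. dAlembert I t0 (alpha0 N0 V) (alpha0 N0 V) Nhat fhat \<and>
          (\<exists>R :: real^3^3. rotation_matrix R \<and> (\<forall>p \<in> I \<times> I. N p = R *v Nhat p) \<and>
             associated_surface (I \<times> I) N (\<lambda>p. R *v fhat p))" by blast
  qed (rule wave_front_diagonal immersion_N immersion_f singular_set_diagonal; assumption)+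
qed

end
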